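(* Assume that $\mathbb F$ is algebraically closed with $\operatorname{char}\mathbb F=0$, and let $d$ be a nonnegative integer. Let $\mathbf M$ denote the set of all isomorphism classes of irreducible $\Re$-modules of dimension $d+1$. Then the map $\mathcal R\colon \mathbf P_d/\{\pm1\}^3\to\mathbf M$, $[a,b,c]\mapsto$ the isomorphism class of $R_d(a,b,c)$, is well defined and is a bijection.
   Context: The Racah algebra $\Re$ is the unital associative $\mathbb F$-algebra with generators $A,B,C,D$ and relations $[A,B]=[B,C]=[C,A]=2D$ together with the requirement that each of $\alpha:=[A,D]+AC-BA$, $\beta:=[B,D]+BA-CB$, $\gamma:=[C,D]+CB-AC$ is central in $\Re$; put $\delta:=A+B+C$ (also central). Here $[X,Y]=XY-YX$. For $a,b,c\in\mathbb F$ and $d\in\mathbb N$ set $\theta_i=(a+\tfrac d2-i)(a+\tfrac d2-i+1)$, $\theta_i^*=(b+\tfrac d2-i)(b+\tfrac d2-i+1)$ for $0\le i\le d$, and $\varphi_i=i(i-d-1)(a+b+c+\tfrac d2-i+2)(a+b-c+\tfrac d2-i+1)$ for $1\le i\le d$. $R_d(a,b,c)$ denotes the $(d+1)$-dimensional $\Re$-module with a basis $v_0,\dots,v_d$ such that $Av_i=\theta_iv_i+v_{i+1}$ (with $v_{d+1}=0$), $Bv_i=\theta_i^*v_i+\varphi_iv_{i-1}$ (with $v_{-1}=0$), and $\alpha,\beta,\delta$ act as the scalars $(c-b)(c+b+1)(a-\tfrac d2)(a+\tfrac d2+1)$, $(a-c)(a+c+1)(b-\tfrac d2)(b+\tfrac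 d2+1)$, $\tfrac d2(\tfrac d2+1)+a(a+1)+b(b+1)+c(c+1)$ respectively (such a module exists and is unique up to isomorphism). $\mathbf P_d$ is the set of $(a,b,c)\in\mathbb F^3$ such that none of $a+b+c+1$, $-a+b+c$, $a-b+c$, $a+b-c$ lies in $\{\tfrac d2-i\mid i=1,\dots,d\}$. The group $\{\pm1\}^3$ acts on $\mathbf P_d$ by $(a,b,c)^{(-1,1,1)}=(-a-1,b,c)$, $(a,b,c)^{(1,-1,1)}=(a,-b-1,c)$, $(a,b,c)^{(1,1,-1)}=(a,b,-c-1)$; $[a,b,c]$ denotes the orbit of $(a,b,c)$ and $\mathbf P_d/\{\pm1\}^3$ the set of orbits. *)

theory Defs
  imports "HOL-Computational_Algebra.Polynomial" "Jordan_Normal_Form.Matrix"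
begin

text \<open>A finite-dimensional module of the Racah algebra on the coordinate space F^n is
  given by the four matrices by which the generators A, B, C, D act.\<close>

type_synonym 'a rtuple = "'a mat \<times> 'a mat \<times> 'a mat \<times> 'a mat"

definition comm :: "'a::comm_ring_1 mat \<Rightarrow> 'a mat \<Rightarrow> 'a mat" where
  "comm X Y = X * Y - Y * X"

definition racah_alpha :: "'a::comm_ring_1 rtuple \<Rightarrow> 'a mat" where
  "racah_alpha M = (case M of (A,B,C,D) \<Rightarrow> comm A D + A * C - B * A)"

definition racah_beta :: "'a::comm_ring_1 rtuple \<Rightarrow> 'a mat" where
  "racah_beta M = (case M of (A,B,C,D) \<Rightarrow> comm B D + B * A - C * B)"

definition racah_gamma :: "'a::comm_ring_1 rtuple \<Rightarrow> 'a mat" where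
  "racah_gamma M = (case M of (A,B,C,D) \<Rightarrow> comm C D + C * B - A * C)"

text \<open>Representation of the Racah algebra on F^n: the defining relations hold and
  the images of alpha, beta, gamma commute with the images of all generators
  (equivalently, with the image of the whole algebra).\<close>
definition racah_module :: "nat \<Rightarrow> 'a::comm_ring_1 rtuple \<Rightarrow> bool" where
  "racah_module n M = (case M of (A,B,C,D) \<Rightarrow>
     A \<in> carrier_mat n n \<and> B \<in> carrier_mat n n \<and> C \<in> carrier_mat n n \<and> D \<in> carrier_mat n n \<and>
     comm A B = 2 \<cdot>\<^sub>m D \<and> comm B C = 2 \<cdot>\<^sub>m D \<and> comm C A = 2 \<cdot>\<^sub>m D \<and>
     (\<forall>Z \<in> {racah_alpha M, racah_beta M, racah_gamma M}. \<forall>X \<in> {A,B,C,D}. X * Z = Z * X))"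

definition racah_irreducible :: "nat \<Rightarrow> 'a::field rtuple \<Rightarrow> bool" where
  "racah_irreducible n M = (n > 0 \<and> (case M of (A,B,C,D) \<Rightarrow>
     (\<forall>W. W \<subseteq> carrier_vec n \<and> 0\<^sub>v n \<in> W \<and>
          (\<forall>v\<in>W. \<forall>w\<in>W. v + w \<in> W) \<and> (\<forall>k. \<forall>v\<in>W. k \<cdot>\<^sub>v v \<in> W) \<and>
          (\<forall>X\<in>{A,B,C,D}. \<forall>v\<in>W. X *\<^sub>v v \<in> W)
        \<longrightarrow> W = {0\<^sub>v n} \<or> W = carrier_vec n)))"

definition racah_iso :: "nat \<Rightarrow> 'a::comm_ring_1 rtuple \<Rightarrow> 'a rtuple \<Rightarrow> bool" where
  "racah_iso n M N = (case M of (A,B,C,D) \<Rightarrow> case N of (A',B',C',D') \<Rightarrow>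
     (\<exists>P \<in> carrier_mat n n. invertible_mat P \<and>
        P * A = A' * P \<and> P * B = B' * P \<and> P * C = C' * P \<and> P * D = D' * P))"

definition iso_class :: "nat \<Rightarrow> 'a::comm_ring_1 rtuple \<Rightarrow> 'a rtuple set" where
  "iso_class n M = {N. racah_module n N \<and> racah_iso n M N}"

definition irred_classes :: "nat \<Rightarrow> 'a::field rtuple set set" where
  "irred_classes n = {iso_class n M | M. racah_module n M \<and> racah_irreducible n M}"

definition th :: "'a::field \<Rightarrow> nat \<Rightarrow> nat \<Rightarrow> 'a" where
  "th a d i = (a + of_nat d / 2 - of_nat i) * (a + of_nat d / 2 - of_nat i + 1)"

definition ph :: "'a::field \<Rightarrow> 'a \<Rightarrow> 'a \<Rightarrow> nat \<Rightarrow> nat \<Rightarrow> 'a" where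
  "ph a b c d i = of_nat i * (of_nat i - of_nat d - 1) * (a + b + c + of_nat d / 2 - of_nat i + 2)
                  * (a + b - c + of_nat d / 2 - of_nat i + 1)"

definition delta_val :: "'a::field \<Rightarrow> 'a \<Rightarrow> 'a \<Rightarrow> nat \<Rightarrow> 'a" where
  "delta_val a b c d = of_nat d / 2 * (of_nat d / 2 + 1) + a * (a + 1) + b * (b + 1) + c * (c + 1)"

text \<open>R_d(a,b,c) in the basis v_0..v_d (column i = image of v_i). C and D are forced:
  C = delta - A - B and D = [A,B]/2.\<close>
definition R_mod :: "nat \<Rightarrow> 'a::field \<Rightarrow> 'a \<Rightarrow> 'a \<Rightarrow> 'a rtuple" where
  "R_mod d a b c =
    (let n = d + 1;
         A = mat n n (\<lambda>(r,s). if r = s then th a d s else if r = s + 1 then 1 else 0);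
         B = mat n n (\<lambda>(r,s). if r = s then th b d s else if s = r + 1 then ph a b c d s else 0);
         C = delta_val a b c d \<cdot>\<^sub>m 1\<^sub>m n - A - B;
         D = (1 / 2) \<cdot>\<^sub>m comm A B
     in (A, B, C, D))"

definition P_set :: "nat \<Rightarrow> ('a::field \<times> 'a \<times> 'a) set" where
  "P_set d = {(a,b,c). \<forall>x \<in> {a + b + c + 1, -a + b + c, a - b + c, a + b - c}.
                          x \<notin> {of_nat d / 2 - of_nat i | i. 1 \<le> i \<and> i \<le> d}}"

definition signs :: "(int \<times> int \<times> int) set" where
  "signs = {-1,1} \<times> {-1,1} \<times> {-1,1}"

definition sact :: "(int \<times> int \<times> int) \<Rightarrow> ('a::field \<times> 'a \<times> 'a) \<Rightarrow> 'a \<times> 'a \<times> 'a" where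
  "sact g p = (case g of (e1,e2,e3) \<Rightarrow> case p of (a,b,c) \<Rightarrow>
     (if e1 = -1 then -a-1 else a, if e2 = -1 then -b-1 else b, if e3 = -1 then -c-1 else c))"

definition orbit :: "('a::field \<times> 'a \<times> 'a) \<Rightarrow> ('a \<times> 'a \<times> 'a) set" where
  "orbit p = (\<lambda>g. sact g p) ` signs"

definition P_orbits :: "nat \<Rightarrow> ('a::field \<times> 'a \<times> 'a) set set" where
  "P_orbits d = orbit ` P_set d"

end

theory Submission
  imports Defs "HOL-Library.Function_Algebras" "Jordan_Normal_Form.Char_Poly"
begin

text \<open>
  Eliminating \<open>C\<close> and \<open>D\<close>, a module on which \<open>\<alpha>, \<beta>, \<delta>\<close> are scalars is a pair of operators \<open>A, B\<close> with
  \<open>A\<^sup>2B - 2ABA + BA\<^sup>2 - 2AB - 2BA = 2A\<^sup>2 - 2\<delta>A + 2\<alpha>\<close> and the relation with \<open>A, B\<close> exchanged and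
  \<open>\<alpha>\<close> replaced by \<open>-\<beta>\<close>. By these relations \<open>B\<close> acts on the Krylov flag of \<open>A\<close> at a suitable \<open>B\<close>-eigenvector
  triangularly, with diagonal \<open>y(y+1), (y-1)y, \<dots>\<close>, and likewise with \<open>A, B\<close> exchanged. Irreducibility makes the
  two flags opposite, which yields a basis on which \<open>A\<close> is lower and \<open>B\<close> upper bidiagonal. The
  superdiagonal entries \<open>\<phi>\<^sub>i\<close> have a prescribed second difference depending only on \<open>\<delta>\<close> and
  vanish at \<open>0\<close> and \<open>d+1\<close>, so they are those of some \<open>R\<^sub>d(a,b,c)\<close>.

  The sequence \<open>v\<^sub>i = (A - \<theta>\<^sub>i\<^sub>-\<^sub>1)\<cdots>(A - \<theta>\<^sub>0)v\<^sub>0\<close> formed with \<open>\<theta>\<^sub>d, \<theta>\<^sub>d\<^sub>-\<^sub>1, \<dots>\<close> in place of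
  \<open>\<theta>\<^sub>0, \<theta>\<^sub>1, \<dots>\<close> is a split basis for \<open>(-a-1,b,c)\<close> inside \<open>R\<^sub>d(a,b,c)\<close>. It gives the isomorphism for the first
  sign change, and, as all \<open>\<phi>\<^sub>i\<close> for both parameter triples are nonzero exactly on \<open>P\<^sub>d\<close>, the
  irreducibility criterion. The second sign change is the first one conjugated by the exchange of
  \<open>A\<close> and \<open>B\<close>, which maps \<open>R\<^sub>d(a,b,c)\<close> to \<open>R\<^sub>d(-b-1,-a-1,c)\<close>. The orbit of \<open>(a,b,c)\<close> is recovered from
  the traces of \<open>A\<close> and \<open>B\<close> and from \<open>\<delta>\<close>.
\<close>

section \<open>The relations in terms of two operators\<close>

text \<open>Vectors of \<open>F\<^sup>n\<close> are functions on \<open>nat\<close> vanishing from \<open>n\<close> on, so that all dimensions share one type.\<close>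

definition sc :: "'a::times \<Rightarrow> (nat \<Rightarrow> 'a) \<Rightarrow> nat \<Rightarrow> 'a" where
  "sc k f = (\<lambda>i. k * f i)"

lemma sc_apply [simp]: "sc k f i = k * f i"
  by (simp add: sc_def)

definition lin_op :: "((nat \<Rightarrow> 'a::comm_ring_1) \<Rightarrow> (nat \<Rightarrow> 'a)) \<Rightarrow> bool" where
  "lin_op A \<longleftrightarrow> (\<forall>f g. A (f + g) = A f + A g) \<and> (\<forall>k f. A (sc k f) = sc k (A f))"

lemma lin_op_add: "lin_op A \<Longrightarrow> A (f + g) = A f + A g"
  and lin_op_sc: "lin_op A \<Longrightarrow> A (sc k f) = sc k (A f)"
  by (auto simp: lin_op_def)

lemma lin_op_diff: "lin_op A \<Longrightarrow> A (f - g) = A f - A g"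
  by (metis add_diff_cancel diff_add_cancel lin_op_add)

lemma lin_op_zero: "lin_op A \<Longrightarrow> A 0 = 0"
  by (metis diff_self lin_op_diff)

lemmas lin_op_simps = lin_op_add lin_op_sc lin_op_diff lin_op_zero

text \<open>Twice the relation \<open>racah_alpha = al\<close>, with \<open>dl - A - B\<close> put
  for \<open>C\<close> and half the commutator of \<open>A\<close> and \<open>B\<close> for
  \<open>D\<close>. It is stated at a single vector because operators coming from matrices satisfy
  it in general only on \<open>fin_space n\<close>.\<close>

definition racah_rel where
  "racah_rel A B dl al f \<longleftrightarrow>
     A (A (B f)) - sc 2 (A (B (A f))) + B (A (A f)) - sc 2 (A (B f)) - sc 2 (B (A f))
       = sc 2 (A (A f)) - sc (2 * dl) (A f) + sc (2 * al) (f :: nat \<Rightarrow> 'a::comm_ring_1)"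

definition alpha_val :: "'a::field \<Rightarrow> 'a \<Rightarrow> 'a \<Rightarrow> nat \<Rightarrow> 'a" where
  "alpha_val a b c d = (c - b) * (c + b + 1) * (a - of_nat d / 2) * (a + of_nat d / 2 + 1)"

definition beta_val :: "'a::field \<Rightarrow> 'a \<Rightarrow> 'a \<Rightarrow> nat \<Rightarrow> 'a" where
  "beta_val a b c d = (a - c) * (a + c + 1) * (b - of_nat d / 2) * (b + of_nat d / 2 + 1)"

text \<open>
  The index runs over all of \<open>nat\<close>: in \<open>R\<^sub>d(a,b,c)\<close> the sequence is \<open>v\<^sub>0, \<dots>, v\<^sub>d, 0, 0, \<dots>\<close>, which is consistent
  because \<open>ph a b c d (d + 1) = 0\<close>.
\<close>

definition split_seq where
  "split_seq A B a b c d w \<longleftrightarrow>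
     (\<forall>i. A (w i) = sc (th a d i) (w i) + w (Suc i)) \<and>
     B (w 0) = sc (th b d 0) (w 0) \<and>
     (\<forall>i. B (w (Suc i)) = sc (th b d (Suc i)) (w (Suc i)) + sc (ph a b c d (Suc i)) (w i))"

text \<open>Writing \<open>of_nat d\<close> as \<open>2 * h\<close> removes the halves from
  \<open>th\<close>, \<open>ph\<close> and the scalars, so that
  \<open>Groebner_Basis.algebra\<close> meets polynomial identities only.\<close>

lemma of_nat_eq_double_half: "of_nat d = 2 * (of_nat d / 2 :: 'a::field_char_0)"
  by simp

text \<open>At \<open>w i\<close> both sides expand into multiples of \<open>w (i - 1)\<close>, ...,
  \<open>w (i + 2)\<close> whose coefficients agree as polynomials in the parameters and
  \<open>i\<close>. Index 0 is separate because \<open>B\<close> does not lower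
  \<open>w 0\<close>.\<close>

lemma split_seq_rel_A:
  fixes w :: "nat \<Rightarrow> nat \<Rightarrow> 'a::field_char_0"
  assumes A: "lin_op A" and B: "lin_op B" and w: "split_seq A B a b c d w"
  shows "racah_rel A B (delta_val a b c d) (alpha_val a b c d) (w i)"
proof -
  obtain h :: 'a where h: "of_nat d = 2 * h" using of_nat_eq_double_half by blast
  have h2: "of_nat d / 2 = h" using h by simp
  have wA: "\<And>i. A (w i) = sc (th a d i) (w i) + w (Suc i)"
    and wB0: "B (w 0) = sc (th b d 0) (w 0)"
    and wB: "\<And>i. B (w (Suc i)) = sc (th b d (Suc i)) (w (Suc i)) + sc (ph a b c d (Suc i)) (w i)"
    using w by (auto simp: split_seq_def)
  show ?thesis
  proof (cases i)
    case 0
    show ?thesis unfolding 0 racah_rel_def fun_eq_iff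
      apply (simp only: wA wB wB0 lin_op_simps[OF A] lin_op_simps[OF B]
          plus_fun_apply sc_apply minus_apply th_def ph_def delta_val_def alpha_val_def h2
              of_nat_Suc of_nat_0)
      by (simp only: h) (rule allI, subst eq_iff_diff_eq_0, Groebner_Basis.algebra)
  next
    case (Suc j)
    show ?thesis unfolding Suc racah_rel_def fun_eq_iff
      apply (simp only: wA wB wB0 lin_op_simps[OF A] lin_op_simps[OF B]
          plus_fun_apply sc_apply minus_apply th_def ph_def delta_val_def alpha_val_def h2
              of_nat_Suc of_nat_0)
      by (simp only: h) (rule allI, subst eq_iff_diff_eq_0, Groebner_Basis.algebra)
  qed
qed

lemma split_seq_rel_B:
  fixes w :: "nat \<Rightarrow> nat \<Rightarrow> 'a::field_char_0"
  assumes A: "lin_op A" and B: "lin_op B" and w: "split_seq A B a b c d w"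
  shows "racah_rel B A (delta_val a b c d) (- beta_val a b c d) (w i)"
proof -
  obtain h :: 'a where h: "of_nat d = 2 * h" using of_nat_eq_double_half by blast
  have h2: "of_nat d / 2 = h" using h by simp
  have wA: "\<And>i. A (w i) = sc (th a d i) (w i) + w (Suc i)"
    and wB0: "B (w 0) = sc (th b d 0) (w 0)"
    and wB: "\<And>i. B (w (Suc i)) = sc (th b d (Suc i)) (w (Suc i)) + sc (ph a b c d (Suc i)) (w i)"
    using w by (auto simp: split_seq_def)
  \<comment> \<open>Each cubic term contains \<open>B\<close> twice, so the index can drop by
    two.\<close>
  consider "i = 0" | "i = Suc 0" | j where "i = Suc (Suc j)"
    by (metis nat.exhaust)
  then show ?thesis
  proof cases
    case 1
    show ?thesis unfolding 1 racah_rel_def fun_eq_iff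
      apply (simp only: wA wB wB0 lin_op_simps[OF A] lin_op_simps[OF B]
          plus_fun_apply sc_apply minus_apply th_def ph_def delta_val_def beta_val_def h2 of_nat_Suc
              of_nat_0)
      by (simp only: h) (rule allI, subst eq_iff_diff_eq_0, Groebner_Basis.algebra)
  next
    case 2
    show ?thesis unfolding 2 racah_rel_def fun_eq_iff
      apply (simp only: wA wB wB0 lin_op_simps[OF A] lin_op_simps[OF B]
          plus_fun_apply sc_apply minus_apply th_def ph_def delta_val_def beta_val_def h2 of_nat_Suc
              of_nat_0)
      by (simp only: h) (rule allI, subst eq_iff_diff_eq_0, Groebner_Basis.algebra)
  next
    case 3
    show ?thesis unfolding 3 racah_rel_def fun_eq_iff
      apply (simp only: wA wB wB0 lin_op_simps[OF A] lin_op_simps[OF B]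
          plus_fun_apply sc_apply minus_apply th_def ph_def delta_val_def beta_val_def h2 of_nat_Suc
              of_nat_0)
      by (simp only: h) (rule allI, subst eq_iff_diff_eq_0, Groebner_Basis.algebra)
  qed
qed

text \<open>In the relation at \<open>w i\<close> the term \<open>B (A (A (w i)))\<close> contains
  \<open>B (w (i + 2))\<close> with coefficient 1, and everything else is known from
  \<open>B (w i)\<close> and \<open>B (w (i + 1))\<close>. Thus the relation propagates the action
  of \<open>B\<close> from the first two vectors to all others.\<close>

lemma split_seqI:
  fixes w :: "nat \<Rightarrow> nat \<Rightarrow> 'a::field_char_0"
  assumes A: "lin_op A" and B: "lin_op B"
    and wA: "\<And>i. A (w i) = sc (th a d i) (w i) + w (Suc i)"
    and rel: "\<And>i. racah_rel A B (delta_val a b c d) (alpha_val a b c d) (w i)"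
    and wB0: "B (w 0) = sc (th b d 0) (w 0)"
    and wB1: "B (w (Suc 0)) = sc (th b d (Suc 0)) (w (Suc 0)) + sc (ph a b c d (Suc 0)) (w 0)"
  shows "split_seq A B a b c d w"
proof -
  obtain h :: 'a where h: "of_nat d = 2 * h" using of_nat_eq_double_half by blast
  have h2: "of_nat d / 2 = h" using h by simp
  have "B (w (Suc i)) = sc (th b d (Suc i)) (w (Suc i)) + sc (ph a b c d (Suc i)) (w i)" for i
  proof (induction i rule: induct_nat_012)
    case 0
    show ?case by (rule wB1)
  next
    case 1
    have "B (w (Suc (Suc 0))) x - (sc (th b d (Suc (Suc 0))) (w (Suc (Suc 0))) + sc (ph a b c d (Suc
        (Suc 0))) (w (Suc 0))) x = 0" for x
    proof -
      \<comment> \<open>Subtracting the two sides of the relation at \<open>w 0\<close> cancels the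
        unknown \<open>B (w 2)\<close> and leaves a polynomial identity.\<close>
      have "B (w (Suc (Suc 0))) x - (sc (th b d (Suc (Suc 0))) (w (Suc (Suc 0))) + sc (ph a b c d
          (Suc (Suc 0))) (w (Suc 0))) x -
       ((A (A (B (w 0))) - sc 2 (A (B (A (w 0)))) + B (A (A (w 0))) - sc 2 (A (B (w 0))) - sc 2 (B
           (A (w 0)))) x -
        (sc 2 (A (A (w 0))) - sc (2 * delta_val a b c d) (A (w 0)) + sc (2 * alpha_val a b c d) (w
            0)) x) = 0"
        apply (simp only: wA wB0 wB1 lin_op_simps[OF A] lin_op_simps[OF B]
          plus_fun_apply sc_apply minus_apply th_def ph_def delta_val_def alpha_val_def h2
              of_nat_Suc of_nat_0)
        by (simp only: h) Groebner_Basis.algebra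
      then show ?thesis
        unfolding rel[of 0, unfolded racah_rel_def] by simp
    qed
    then show ?case by (intro ext) (metis eq_iff_diff_eq_0)
  next
    case (ge2 j)
    have e1: "B (w (Suc j)) = sc (th b d (Suc j)) (w (Suc j)) + sc (ph a b c d (Suc j)) (w j)"
      by (rule ge2)
    have e2: "B (w (Suc (Suc j))) = sc (th b d (Suc (Suc j))) (w (Suc (Suc j))) + sc (ph a b c d
        (Suc (Suc j))) (w (Suc j))"
      by (rule ge2)
    have "B (w (Suc (Suc (Suc j)))) x - (sc (th b d (Suc (Suc (Suc j)))) (w (Suc (Suc (Suc j)))) +
        sc (ph a b c d (Suc (Suc (Suc j)))) (w (Suc (Suc j)))) x = 0" for x
    proof -
      have "B (w (Suc (Suc (Suc j)))) x - (sc (th b d (Suc (Suc (Suc j)))) (w (Suc (Suc (Suc j)))) +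
          sc (ph a b c d (Suc (Suc (Suc j)))) (w (Suc (Suc j)))) x -
       ((A (A (B (w (Suc j)))) - sc 2 (A (B (A (w (Suc j))))) + B (A (A (w (Suc j)))) - sc 2 (A (B
           (w (Suc j)))) - sc 2 (B (A (w (Suc j))))) x -
        (sc 2 (A (A (w (Suc j)))) - sc (2 * delta_val a b c d) (A (w (Suc j))) + sc (2 * alpha_val a
            b c d) (w (Suc j))) x) = 0"
        apply (simp only: wA e1 e2 lin_op_simps[OF A] lin_op_simps[OF B]
          plus_fun_apply sc_apply minus_apply th_def ph_def delta_val_def alpha_val_def h2
              of_nat_Suc of_nat_0)
        by (simp only: h) Groebner_Basis.algebra
      then show ?thesis
        unfolding rel[of "Suc j", unfolded racah_rel_def] by simp
    qed
    then show ?case by (intro ext) (metis eq_iff_diff_eq_0)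
  qed
  then show ?thesis
    using wA wB0 by (simp add: split_seq_def)
qed

section \<open>Matrices as operators\<close>

definition fin_space :: "nat \<Rightarrow> (nat \<Rightarrow> 'a::zero) set" where
  "fin_space n = {f. \<forall>i\<ge>n. f i = 0}"

definition mop :: "nat \<Rightarrow> 'a::comm_ring_1 mat \<Rightarrow> (nat \<Rightarrow> 'a) \<Rightarrow> nat \<Rightarrow> 'a" where
  "mop n M f = (\<lambda>r. if r < n then \<Sum>s<n. M $$ (r, s) * f s else 0)"

definition vfun :: "'a::zero vec \<Rightarrow> nat \<Rightarrow> 'a" where
  "vfun v = (\<lambda>i. if i < dim_vec v then v $ i else 0)"

text \<open>It is the zero vector for \<open>i\<close> at least \<open>n\<close>; so the standard
  basis continues to a sequence over all of \<open>nat\<close>, as \<open>split_seq\<close>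
  requires.\<close>

definition uv :: "nat \<Rightarrow> nat \<Rightarrow> nat \<Rightarrow> 'a::zero_neq_one" where
  "uv n i = (\<lambda>j. if j = i \<and> i < n then 1 else 0)"

lemma fin_space_closed:
  "0 \<in> fin_space n"
  "f \<in> fin_space n \<Longrightarrow> g \<in> fin_space n \<Longrightarrow> f + g \<in> fin_space n"
  "f \<in> fin_space n \<Longrightarrow> g \<in> fin_space n \<Longrightarrow> f - g \<in> fin_space n"
  "f \<in> fin_space n \<Longrightarrow> sc k f \<in> fin_space n"
  for f g :: "nat \<Rightarrow> 'a::comm_ring_1"
  by (auto simp: fin_space_def)

lemma uv_in_fin_space: "uv n i \<in> fin_space n"
  by (auto simp: fin_space_def uv_def)

lemma vfun_in_fin_space: "v \<in> carrier_vec n \<Longrightarrow> vfun v \<in> fin_space n"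
  by (auto simp: fin_space_def vfun_def)

lemma vfun_vec: "f \<in> fin_space n \<Longrightarrow> vfun (vec n f) = f"
  by (auto simp: fin_space_def vfun_def fun_eq_iff)

lemma vec_vfun: "v \<in> carrier_vec n \<Longrightarrow> vec n (vfun v) = v"
  by (intro eq_vecI) (auto simp: vfun_def)

lemma mop_in_fin_space: "mop n M f \<in> fin_space n"
  by (auto simp: fin_space_def mop_def)

lemma lin_op_mop: "lin_op (mop n M)"
  by (auto simp: lin_op_def mop_def fun_eq_iff algebra_simps sum.distrib sum_distrib_left)

lemmas mop_simps = lin_op_simps[OF lin_op_mop]

lemma mop_add: "M \<in> carrier_mat n n \<Longrightarrow> N \<in> carrier_mat n n \<Longrightarrow> mop n (M + N) f = mop n M f + mop n N f"
  by (auto simp: mop_def fun_eq_iff algebra_simps sum.distrib)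

lemma mop_minus: "M \<in> carrier_mat n n \<Longrightarrow> N \<in> carrier_mat n n \<Longrightarrow> mop n (M - N) f = mop n M f - mop n N
    f"
  by (auto simp: mop_def fun_eq_iff algebra_simps sum_subtractf)

lemma mop_smult: "M \<in> carrier_mat n n \<Longrightarrow> mop n (k \<cdot>\<^sub>m M) f = sc k (mop n M f)"
  by (auto simp: mop_def fun_eq_iff algebra_simps sum_distrib_left)

lemma mop_one: "f \<in> fin_space n \<Longrightarrow> mop n (1\<^sub>m n) f = f"
  by (auto simp: mop_def fun_eq_iff fin_space_def if_distrib[of "\<lambda>x. x * _"] cong: if_cong)

lemma mop_mult:
  assumes "M \<in> carrier_mat n n" "N \<in> carrier_mat n n"
  shows "mop n (M * N) f = mop n M (mop n N f)"
proof
  fix r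
  show "mop n (M * N) f r = mop n M (mop n N f) r"
  proof (cases "r < n")
    case True
    have "mop n (M * N) f r = (\<Sum>s<n. (\<Sum>t<n. M $$ (r,t) * N $$ (t,s)) * f s)"
      using True assms by (auto simp: mop_def scalar_prod_def atLeast0LessThan intro!: sum.cong)
    also have "\<dots> = (\<Sum>s<n. \<Sum>t<n. M $$ (r,t) * N $$ (t,s) * f s)"
      by (simp add: sum_distrib_right)
    also have "\<dots> = (\<Sum>t<n. \<Sum>s<n. M $$ (r,t) * N $$ (t,s) * f s)"
      by (rule sum.swap)
    also have "\<dots> = mop n M (mop n N f) r"
      using True by (simp add: mop_def sum_distrib_left mult.assoc)
    finally show ?thesis .
  qed (simp add: mop_def)
qed

lemma mop_uv: "s < n \<Longrightarrow> mop n M (uv n s) r = (if r < n then M $$ (r, s) else 0)"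
  by (simp add: mop_def uv_def if_distrib[of "\<lambda>x. _ * x"] cong: if_cong)

lemma mop_vfun:
  assumes "M \<in> carrier_mat n n" "v \<in> carrier_vec n"
  shows "vfun (M *\<^sub>v v) = mop n M (vfun v)"
  using assms by (auto simp: mop_def vfun_def scalar_prod_def fun_eq_iff atLeast0LessThan intro!:
      sum.cong)

lemma lin_op_sum: "lin_op F \<Longrightarrow> F (\<Sum>i\<in>S. g i) = (\<Sum>i\<in>S. F (g i))"
  by (induction S rule: infinite_finite_induct) (auto simp: lin_op_simps)

lemma sum_fun_apply: "(\<Sum>i\<in>S. g i) x = (\<Sum>i\<in>S. g i x)"
  by (induction S rule: infinite_finite_induct) auto

lemma fin_space_expand: "(f :: nat \<Rightarrow> 'a::comm_ring_1) \<in> fin_space n \<Longrightarrow> f = (\<Sum>i<n. sc (f i) (uv n i))"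
proof
  fix x
  assume f: "f \<in> fin_space n"
  have "(\<Sum>i<n. sc (f i) (uv n i)) x = (\<Sum>i<n. if x = i then f i else 0)"
    unfolding sum_fun_apply by (intro sum.cong) (auto simp: uv_def)
  then show "f x = (\<Sum>i<n. sc (f i) (uv n i)) x"
    using f by (simp add: fin_space_def)
qed

lemma lin_op_eqI:
  assumes F: "lin_op F" and G: "lin_op G" and eq: "\<And>i. i < n \<Longrightarrow> F (uv n i) = G (uv n i)"
    and f: "f \<in> fin_space n"
  shows "F f = G f"
proof -
  have "F f = (\<Sum>i<n. sc (f i) (F (uv n i)))"
    by (subst fin_space_expand[OF f]) (simp add: lin_op_sum[OF F] lin_op_simps[OF F])
  also have "\<dots> = (\<Sum>i<n. sc (f i) (G (uv n i)))"
    by (simp add: eq)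
  also have "\<dots> = G f"
    by (subst (2) fin_space_expand[OF f]) (simp add: lin_op_sum[OF G] lin_op_simps[OF G])
  finally show ?thesis .
qed

lemma mat_eq_iff_mop:
  assumes "M \<in> carrier_mat n n" "N \<in> carrier_mat n n"
  shows "M = N \<longleftrightarrow> (\<forall>f\<in>fin_space n. mop n M f = mop n N f)"
proof
  assume eq: "\<forall>f\<in>fin_space n. mop n M f = mop n N f"
  show "M = N"
  proof (rule eq_matI)
    fix i j assume ij: "i < dim_row N" "j < dim_col N"
    then have "mop n M (uv n j) i = mop n N (uv n j) i"
      using eq uv_in_fin_space by metis
    then show "M $$ (i,j) = N $$ (i,j)"
      using ij assms by (simp add: mop_uv)
  qed (use assms in auto)
qed simp

lemma racah_rel_fin_space:
  assumes A: "lin_op A" and B: "lin_op B" and rel: "\<And>i. i < n \<Longrightarrow> racah_rel A B dl al (uv n i)"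
    and f: "f \<in> fin_space n"
  shows "racah_rel A B dl al f"
  unfolding racah_rel_def
  apply (rule lin_op_eqI[OF _ _ _ f])
  subgoal by (auto simp: lin_op_def lin_op_simps[OF A] lin_op_simps[OF B] fun_eq_iff algebra_simps)
  subgoal by (auto simp: lin_op_def lin_op_simps[OF A] lin_op_simps[OF B] fun_eq_iff algebra_simps)
  subgoal by (rule rel[unfolded racah_rel_def])
  done

section \<open>Tuples determined by A, B and the scalar delta\<close>

lemma square_mat_closed:
  "M \<in> carrier_mat n n \<Longrightarrow> N \<in> carrier_mat n n \<Longrightarrow> M + N \<in> carrier_mat n n"
  "M \<in> carrier_mat n n \<Longrightarrow> N \<in> carrier_mat n n \<Longrightarrow> M - N \<in> carrier_mat n n"
  "M \<in> carrier_mat n n \<Longrightarrow> N \<in> carrier_mat n n \<Longrightarrow> M * N \<in> carrier_mat n n"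
  "M \<in> carrier_mat n n \<Longrightarrow> k \<cdot>\<^sub>m M \<in> carrier_mat n n"
  "1\<^sub>m n \<in> carrier_mat n n"
  by auto

lemmas mop_mat_simps = mop_add mop_minus mop_smult mop_mult mop_one mop_simps
  square_mat_closed mop_in_fin_space

text \<open>The common shape of \<open>R_mod\<close> and of every irreducible module: once
  \<open>A + B + C\<close> is a scalar \<open>dl\<close>, the matrices \<open>C\<close> and
  \<open>D\<close> are forced.\<close>

definition racah_tuple :: "nat \<Rightarrow> 'a::field mat \<Rightarrow> 'a mat \<Rightarrow> 'a \<Rightarrow> 'a rtuple" where
  "racah_tuple n A B dl = (A, B, dl \<cdot>\<^sub>m 1\<^sub>m n - A - B, (1 / 2) \<cdot>\<^sub>m comm A B)"

context
  fixes n :: nat and A B :: "'a::field_char_0 mat" and dl :: 'a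
  assumes A: "A \<in> carrier_mat n n" and B: "B \<in> carrier_mat n n"
begin

lemma racah_tuple_carrier:
  "racah_alpha (racah_tuple n A B dl) \<in> carrier_mat n n"
  "racah_beta (racah_tuple n A B dl) \<in> carrier_mat n n"
  "racah_gamma (racah_tuple n A B dl) \<in> carrier_mat n n"
  using A B by (simp_all add: racah_tuple_def racah_alpha_def racah_beta_def racah_gamma_def
      comm_def square_mat_closed)

lemma racah_alpha_scalar_iff:
  "racah_alpha (racah_tuple n A B dl) = al \<cdot>\<^sub>m 1\<^sub>m n \<longleftrightarrow>
   (\<forall>f\<in>fin_space n. racah_rel (mop n A) (mop n B) dl al f)"
proof -
  have "mop n (racah_alpha (racah_tuple n A B dl)) f = mop n (al \<cdot>\<^sub>m 1\<^sub>m n) f \<longleftrightarrow>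
      racah_rel (mop n A) (mop n B) dl al f" if f: "f \<in> fin_space n" for f
  proof -
    \<comment> \<open>\<open>racah_rel\<close> is twice the relation for \<open>racah_alpha\<close>;
      here \<open>p\<close> is a coordinate of the image under \<open>racah_alpha\<close>, and
      \<open>l\<close>, \<open>r\<close> are the parts of \<open>racah_rel\<close> without
      \<open>al\<close>.\<close>
    have *: "p = al * y \<longleftrightarrow> l = r + 2 * al * y" if "2 * p = l - r" for p l r y :: 'a
    proof -
      have "l = r + 2 * p" using that by simp
      then show ?thesis by simp
    qed
    show ?thesis
      unfolding racah_rel_def fun_eq_iff
      by (rule iff_allI, simp only: plus_fun_apply[of "_ - _"] mop_mat_simps f sc_apply, rule *)
        (simp add: f A B racah_tuple_def racah_alpha_def comm_def mop_mat_simps field_simps)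
  qed
  then show ?thesis
    using racah_tuple_carrier by (subst mat_eq_iff_mop) (auto simp: square_mat_closed)
qed

lemma racah_beta_scalar_iff:
  "racah_beta (racah_tuple n A B dl) = be \<cdot>\<^sub>m 1\<^sub>m n \<longleftrightarrow>
   (\<forall>f\<in>fin_space n. racah_rel (mop n B) (mop n A) dl (- be) f)"
proof -
  have "mop n (racah_beta (racah_tuple n A B dl)) f = mop n (be \<cdot>\<^sub>m 1\<^sub>m n) f \<longleftrightarrow>
      racah_rel (mop n B) (mop n A) dl (- be) f" if f: "f \<in> fin_space n" for f
  proof -
    have *: "p = be * y \<longleftrightarrow> l = r + 2 * - be * y" if "2 * p = r - l" for p l r y :: 'a
    proof -
      have "l = r - 2 * p" using that by simp
      then show ?thesis by auto
    qed
    show ?thesis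
      unfolding racah_rel_def fun_eq_iff
      by (rule iff_allI, simp only: plus_fun_apply[of "_ - _"] mop_mat_simps f sc_apply, rule *)
        (simp add: f A B racah_tuple_def racah_beta_def comm_def mop_mat_simps field_simps)
  qed
  then show ?thesis
    using racah_tuple_carrier by (subst mat_eq_iff_mop) (auto simp: square_mat_closed)
qed

text \<open>In the sum of the three elements the commutators add up to the one of
  \<open>A + B + C\<close> with \<open>D\<close>, which is 0 as \<open>A + B + C\<close> is scalar,
  and the products cancel in pairs. So \<open>racah_gamma\<close> is scalar as soon as the other two
  are.\<close>

lemma racah_gamma_eq:
  "racah_gamma (racah_tuple n A B dl) =
     - 1 \<cdot>\<^sub>m racah_alpha (racah_tuple n A B dl) - racah_beta (racah_tuple n A B dl)"
  apply (subst mat_eq_iff_mop[of _ n])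
  subgoal by (rule racah_tuple_carrier)
  subgoal by (intro square_mat_closed racah_tuple_carrier)
  by (intro ballI) (simp add: A B racah_tuple_carrier mop_mat_simps,
     simp add: racah_tuple_def racah_alpha_def racah_beta_def racah_gamma_def comm_def mop_mat_simps
         A B fun_eq_iff field_simps)

lemma racah_module_tuple:
  assumes "\<forall>f\<in>fin_space n. racah_rel (mop n A) (mop n B) dl al f"
    and "\<forall>f\<in>fin_space n. racah_rel (mop n B) (mop n A) dl (- be) f"
  shows "racah_module n (racah_tuple n A B dl)"
proof -
  define M where "M = racah_tuple n A B dl"
  obtain C D where M: "M = (A, B, C, D)" and C: "C = dl \<cdot>\<^sub>m 1\<^sub>m n - A - B" and D: "D = (1 / 2) \<cdot>\<^sub>m
      comm A B"
    by (auto simp: M_def racah_tuple_def)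
  have scal: "racah_alpha M = al \<cdot>\<^sub>m 1\<^sub>m n" "racah_beta M = be \<cdot>\<^sub>m 1\<^sub>m n"
    using assms racah_alpha_scalar_iff racah_beta_scalar_iff by (simp_all add: M_def)
  have car: "C \<in> carrier_mat n n" "D \<in> carrier_mat n n"
    using A B by (auto simp: C D comm_def square_mat_closed)
  have gam: "racah_gamma M = (- al - be) \<cdot>\<^sub>m 1\<^sub>m n"
    unfolding M_def racah_gamma_eq unfolding scal[unfolded M_def]
    by (rule eq_matI) auto
  have cent: "\<forall>Z \<in> {racah_alpha M, racah_beta M, racah_gamma M}. \<forall>X \<in> {A,B,C,D}. X * Z = Z * X"
  proof (intro ballI)
    fix Z X assume "Z \<in> {racah_alpha M, racah_beta M, racah_gamma M}" "X \<in> {A,B,C,D}"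
    obtain k where "Z = k \<cdot>\<^sub>m 1\<^sub>m n" using \<open>Z \<in> _\<close> scal gam by auto
    moreover have "X \<in> carrier_mat n n" using \<open>X \<in> _\<close> A B car by auto
    ultimately show "X * Z = Z * X"
      by (simp add: mult_smult_distrib[of X n n _ n] mult_smult_assoc_mat[of _ n n _ n])
  qed
  have "comm A B = 2 \<cdot>\<^sub>m D"
    unfolding D by (rule eq_matI) auto
  moreover have "comm B C = 2 \<cdot>\<^sub>m D" "comm C A = 2 \<cdot>\<^sub>m D"
    by (subst mat_eq_iff_mop[of _ n]; simp add: C D A B comm_def mop_mat_simps fun_eq_iff
        field_simps)+
  ultimately show ?thesis
    unfolding M_def[symmetric] racah_module_def M prod.case using A B car cent[unfolded M] by blast
qed

end

section \<open>The modules R_d(a,b,c) as pairs of operators\<close>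

definition RA :: "nat \<Rightarrow> 'a::field \<Rightarrow> 'a mat" where
  "RA d a = mat (d + 1) (d + 1) (\<lambda>(r,s). if r = s then th a d s else if r = s + 1 then 1 else 0)"

definition RB :: "nat \<Rightarrow> 'a::field \<Rightarrow> 'a \<Rightarrow> 'a \<Rightarrow> 'a mat" where
  "RB d a b c = mat (d + 1) (d + 1) (\<lambda>(r,s). if r = s then th b d s else if s = r + 1 then ph a b c
      d s else 0)"

lemma RA_carrier: "RA d a \<in> carrier_mat (d + 1) (d + 1)"
  and RB_carrier: "RB d a b c \<in> carrier_mat (d + 1) (d + 1)"
  by (simp_all add: RA_def RB_def)

lemma R_mod_eq_tuple: "R_mod d a b c = racah_tuple (d + 1) (RA d a) (RB d a b c) (delta_val a b c
    d)"
  by (simp add: R_mod_def racah_tuple_def RA_def RB_def Let_def)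

lemma uv_ge: "n \<le> i \<Longrightarrow> uv n i = 0"
  by (auto simp: uv_def)

lemma split_seq_R:
  fixes a :: "'a::field_char_0"
  shows "split_seq (mop (d + 1) (RA d a)) (mop (d + 1) (RB d a b c)) a b c d (uv (d + 1))"
  unfolding split_seq_def
proof (intro conjI allI)
  fix i
  show "mop (d + 1) (RA d a) (uv (d + 1) i) = sc (th a d i) (uv (d + 1) i) + uv (d + 1) (Suc i)"
  proof (cases "i < d + 1")
    case True
    then show ?thesis
      unfolding fun_eq_iff by (subst mop_uv) (auto simp: RA_def uv_def)
  qed (auto simp: uv_ge fun_eq_iff mop_simps)
  show "mop (d + 1) (RB d a b c) (uv (d + 1) (Suc i)) =
    sc (th b d (Suc i)) (uv (d + 1) (Suc i)) + sc (ph a b c d (Suc i)) (uv (d + 1) i)"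
  proof (cases "Suc i < d + 1")
    case True
    then show ?thesis
      unfolding fun_eq_iff by (subst mop_uv) (auto simp: RB_def uv_def)
  next
    case False
    show ?thesis
    proof (cases "i = d")
      case True
      then show ?thesis by (auto simp: uv_ge fun_eq_iff ph_def mop_simps)
    next
      case False
      then show ?thesis using \<open>\<not> Suc i < d + 1\<close> by (auto simp: uv_ge fun_eq_iff mop_simps)
    qed
  qed
next
  show "mop (d + 1) (RB d a b c) (uv (d + 1) 0) = sc (th b d 0) (uv (d + 1) 0)"
    unfolding fun_eq_iff by (subst mop_uv) (auto simp: RB_def uv_def)
qed

text \<open>The relations are linear in the vector, and the standard basis is a split sequence, on
  which they are already verified.\<close>

lemma racah_rel_R:
  fixes a :: "'a::field_char_0"
  assumes "f \<in> fin_space (d + 1)"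
  shows "racah_rel (mop (d + 1) (RA d a)) (mop (d + 1) (RB d a b c)) (delta_val a b c d) (alpha_val
      a b c d) f"
    and "racah_rel (mop (d + 1) (RB d a b c)) (mop (d + 1) (RA d a)) (delta_val a b c d) (- beta_val
        a b c d) f"
  by (rule racah_rel_fin_space[OF lin_op_mop lin_op_mop _ assms],
      rule split_seq_rel_A[OF lin_op_mop lin_op_mop split_seq_R],
      rule racah_rel_fin_space[OF lin_op_mop lin_op_mop _ assms],
      rule split_seq_rel_B[OF lin_op_mop lin_op_mop split_seq_R])

lemma racah_module_R: "racah_module (d + 1) (R_mod d a b (c :: 'a::field_char_0))"
  unfolding R_mod_eq_tuple by (rule racah_module_tuple) (blast intro: RA_carrier RB_carrier
      racah_rel_R)+

section \<open>Irreducibility in terms of two operators\<close>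

global_interpretation fvs: vector_space "sc :: 'a::field \<Rightarrow> (nat \<Rightarrow> 'a) \<Rightarrow> nat \<Rightarrow> 'a"
  by unfold_locales (auto simp: fun_eq_iff algebra_simps)

definition irr_pair :: "nat \<Rightarrow> ((nat \<Rightarrow> 'a::field) \<Rightarrow> nat \<Rightarrow> 'a) \<Rightarrow> ((nat \<Rightarrow> 'a) \<Rightarrow> nat \<Rightarrow> 'a) \<Rightarrow> bool" where
  "irr_pair n A B \<longleftrightarrow> n > 0 \<and>
     (\<forall>W \<subseteq> fin_space n. fvs.subspace W \<and> A ` W \<subseteq> W \<and> B ` W \<subseteq> W \<longrightarrow> W = {0} \<or> W = fin_space n)"

lemma vfun_add: "v \<in> carrier_vec n \<Longrightarrow> w \<in> carrier_vec n \<Longrightarrow> vfun (v + w) = vfun v + vfun (w ::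
    'a::comm_ring_1 vec)"
  by (auto simp: vfun_def fun_eq_iff)

lemma vfun_smult: "vfun (k \<cdot>\<^sub>v v) = sc k (vfun (v :: 'a::comm_ring_1 vec))"
  by (auto simp: vfun_def fun_eq_iff)

lemma vfun_zero: "vfun (0\<^sub>v n) = 0"
  by (auto simp: vfun_def fun_eq_iff)

lemma vfun_inj: "v \<in> carrier_vec n \<Longrightarrow> w \<in> carrier_vec n \<Longrightarrow> vfun v = vfun w \<Longrightarrow> v = w"
  by (metis vec_vfun)

text \<open>In such a tuple \<open>C\<close> and \<open>D\<close> are polynomials in
  \<open>A\<close> and \<open>B\<close>, so a subspace invariant under \<open>A\<close> and
  \<open>B\<close> is a submodule. The maps \<open>vfun\<close> and \<open>vec n\<close> carry
  subspaces back and forth between the two encodings of vectors.\<close>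

lemma racah_irreducible_tuple_iff:
  fixes A B :: "'a::field_char_0 mat"
  assumes A: "A \<in> carrier_mat n n" and B: "B \<in> carrier_mat n n"
  shows "racah_irreducible n (racah_tuple n A B dl) \<longleftrightarrow> irr_pair n (mop n A) (mop n B)"
proof
  assume irr: "racah_irreducible n (racah_tuple n A B dl)"
  show "irr_pair n (mop n A) (mop n B)"
    unfolding irr_pair_def
  proof (intro conjI allI impI)
    show "n > 0" using irr by (simp add: racah_irreducible_def)
    fix W assume WV: "W \<subseteq> fin_space n"
      and W: "fvs.subspace W \<and> mop n A ` W \<subseteq> W \<and> mop n B ` W \<subseteq> W"
    define C where "C = dl \<cdot>\<^sub>m 1\<^sub>m n - A - B"
    define D where "D = (1 / 2) \<cdot>\<^sub>m comm A B"
    have C: "C \<in> carrier_mat n n" and D: "D \<in> carrier_mat n n"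
      using A B by (simp_all add: C_def D_def comm_def square_mat_closed)
    define U where "U = {v \<in> carrier_vec n. vfun v \<in> W}"
    have cl: "mop n X f \<in> W" if "X \<in> {A,B,C,D}" "f \<in> W" for X f
    proof -
      have f: "f \<in> fin_space n" using WV that by auto
      have "mop n C f = sc dl f - mop n A f - mop n B f"
        using A B f by (simp add: C_def mop_mat_simps)
      moreover have "mop n D f = sc (1 / 2) (mop n A (mop n B f) - mop n B (mop n A f))"
        using A B f by (simp add: D_def comm_def mop_mat_simps)
      moreover have "mop n A g \<in> W" "mop n B g \<in> W" if "g \<in> W" for g
        using W that by auto
      ultimately show ?thesis
        using that W by (auto intro!: fvs.subspace_diff fvs.subspace_scale)
    qed
    have "U \<subseteq> carrier_vec n \<and> 0\<^sub>v n \<in> U \<and> (\<forall>v\<in>U. \<forall>w\<in>U. v + w \<in> U) \<and> (\<forall>k. \<forall>v\<in>U. k \<cdot>\<^sub>v v \<in> U) \<and>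
          (\<forall>X\<in>{A,B,C,D}. \<forall>v\<in>U. X *\<^sub>v v \<in> U)"
    proof (intro conjI ballI allI)
      fix X v assume X: "X \<in> {A,B,C,D}" and v: "v \<in> U"
      then have "X \<in> carrier_mat n n" using A B C D by auto
      then show "X *\<^sub>v v \<in> U"
        using cl[OF X, of "vfun v"] v by (auto simp: U_def mop_vfun)
    qed (use W in \<open>auto simp: U_def vfun_zero vfun_add vfun_smult fvs.subspace_0 intro:
        fvs.subspace_add fvs.subspace_scale\<close>)
    then have "U = {0\<^sub>v n} \<or> U = carrier_vec n"
      using irr unfolding racah_irreducible_def racah_tuple_def C_def D_def prod.case by blast
    moreover have "W = vfun ` U"
    proof
      show "W \<subseteq> vfun ` U"
      proof
        fix f assume "f \<in> W"
        then have "vfun (vec n f) = f" using WV vfun_vec by blast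
        then show "f \<in> vfun ` U" using \<open>f \<in> W\<close> by (intro image_eqI[of _ _ "vec n f"]) (auto simp:
            U_def)
      qed
    qed (auto simp: U_def)
    moreover have "vfun ` carrier_vec n = (fin_space n :: (nat \<Rightarrow> 'a) set)"
    proof
      show "fin_space n \<subseteq> (vfun ` carrier_vec n :: (nat \<Rightarrow> 'a) set)"
        by (metis image_eqI subsetI vec_carrier vfun_vec)
    qed (auto intro: vfun_in_fin_space)
    ultimately show "W = {0} \<or> W = fin_space n"
      by (auto simp: vfun_zero)
  qed
next
  assume irr: "irr_pair n (mop n A) (mop n B)"
  show "racah_irreducible n (racah_tuple n A B dl)"
    unfolding racah_irreducible_def racah_tuple_def prod.case
  proof (intro conjI allI impI)
    show "n > 0" using irr by (simp add: irr_pair_def)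
    fix U assume U: "U \<subseteq> carrier_vec n \<and> 0\<^sub>v n \<in> U \<and> (\<forall>v\<in>U. \<forall>w\<in>U. v + w \<in> U) \<and> (\<forall>k. \<forall>v\<in>U. k \<cdot>\<^sub>v v \<in>
        U) \<and>
          (\<forall>X\<in>{A, B, dl \<cdot>\<^sub>m 1\<^sub>m n - A - B, (1 / 2) \<cdot>\<^sub>m comm A B}. \<forall>v\<in>U. X *\<^sub>v v \<in> U)"
    define W where "W = vfun ` U"
    have Uc: "v \<in> carrier_vec n" if "v \<in> U" for v using U that by auto
    have "fvs.subspace W"
      unfolding fvs.subspace_def W_def
    proof (intro conjI ballI allI)
      show "0 \<in> vfun ` U" using U vfun_zero by (metis image_eqI)
      show "x + y \<in> vfun ` U" if "x \<in> vfun ` U" "y \<in> vfun ` U" for x y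
        using that U Uc by (auto simp: vfun_add[symmetric, of _ n])
      show "sc k x \<in> vfun ` U" if "x \<in> vfun ` U" for k x
        using that U by (auto simp: vfun_smult[symmetric])
    qed
    moreover have "mop n A ` W \<subseteq> W" "mop n B ` W \<subseteq> W"
      using U Uc by (auto simp: W_def mop_vfun[OF A, symmetric] mop_vfun[OF B, symmetric])
    moreover have "W \<subseteq> fin_space n"
      using Uc vfun_in_fin_space by (auto simp: W_def)
    ultimately have "W = {0} \<or> W = fin_space n"
      using irr unfolding irr_pair_def by blast
    moreover have "U = vec n ` W"
    proof -
      have "vec n ` W = (\<lambda>v. v) ` U"
        unfolding W_def image_image by (rule image_cong) (auto dest: Uc vec_vfun)
      then show ?thesis by simp
    qed
    moreover have "vec n ` fin_space n = (carrier_vec n :: 'a vec set)"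
    proof
      show "carrier_vec n \<subseteq> (vec n ` fin_space n :: 'a vec set)"
        by (metis image_eqI subsetI vec_vfun vfun_in_fin_space)
    qed auto
    moreover have "vec n 0 = (0\<^sub>v n :: 'a vec)"
      by auto
    ultimately show "U = {0\<^sub>v n} \<or> U = carrier_vec n"
      by auto
  qed
qed

section \<open>Homomorphisms and the first sign change\<close>

lemma mop_RA:
  "mop (d + 1) (RA d a) f r =
    (if r \<le> d then th a d r * f r + (if r = 0 then 0 else f (r - 1)) else 0)"
proof (cases "r \<le> d")
  case True
  \<comment> \<open>For \<open>r = 0\<close> truncated subtraction makes \<open>r - 1\<close> equal
    to \<open>r\<close>, hence the inner test that sets the second summand to 0.\<close>
  have "RA d a $$ (r, s) * f s = (if s = r then th a d r * f r else 0) +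
      (if s = r - 1 then if r = 0 then 0 else f (r - 1) else 0)" if "s < d + 1" for s
    using True that by (auto simp: RA_def)
  then have "mop (d + 1) (RA d a) f r = (\<Sum>s<d+1. (if s = r then th a d r * f r else 0) +
      (if s = r - 1 then if r = 0 then 0 else f (r - 1) else 0))"
    unfolding mop_def using True by (simp del: sum.lessThan_Suc)
  then show ?thesis using True by (simp add: sum.distrib del: sum.lessThan_Suc)
qed (simp add: mop_def)

lemma mop_RB:
  "mop (d + 1) (RB d a b c) f r =
    (if r \<le> d then th b d r * f r + (if r < d then ph a b c d (Suc r) * f (Suc r) else 0) else 0)"
proof (cases "r \<le> d")
  case True
  have "RB d a b c $$ (r, s) * f s = (if s = r then th b d r * f r else 0) +
      (if s = Suc r then ph a b c d (Suc r) * f (Suc r) else 0)" if "s < d + 1" for s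
    using True that by (auto simp: RB_def)
  then have "mop (d + 1) (RB d a b c) f r = (\<Sum>s<d+1. (if s = r then th b d r * f r else 0) +
      (if s = Suc r then ph a b c d (Suc r) * f (Suc r) else 0))"
    unfolding mop_def using True by (simp del: sum.lessThan_Suc)
  then show ?thesis using True by (auto simp add: sum.distrib simp del: sum.lessThan_Suc)
qed (simp add: mop_def)

definition col_mat :: "nat \<Rightarrow> (nat \<Rightarrow> nat \<Rightarrow> 'a) \<Rightarrow> 'a mat" where
  "col_mat n w = mat n n (\<lambda>(r, s). w s r)"

lemma col_mat_carrier: "col_mat n w \<in> carrier_mat n n"
  by (simp add: col_mat_def)

lemma mop_col_mat: "s < n \<Longrightarrow> w s \<in> fin_space n \<Longrightarrow> mop n (col_mat n w) (uv n s) = w s"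
  unfolding fun_eq_iff by (subst mop_uv) (auto simp: col_mat_def fin_space_def mop_uv)

lemma mat_eqI_uv:
  assumes "M \<in> carrier_mat n n" "N \<in> carrier_mat n n"
    and "\<And>i. i < n \<Longrightarrow> mop n M (uv n i) = mop n N (uv n i)"
  shows "M = N"
  unfolding mat_eq_iff_mop[OF assms(1,2)]
  by (intro ballI) (rule lin_op_eqI[OF lin_op_mop lin_op_mop assms(3)])

text \<open>A split sequence that ends after \<open>d\<close> is the image of the standard basis
  under a homomorphism from the module with these parameters. The vanishing of
  \<open>w (d + 1)\<close> matches that of \<open>uv (d + 1) (d + 1)\<close>.\<close>

lemma split_seq_intertwines:
  fixes A B :: "'a::field_char_0 mat"
  assumes A: "A \<in> carrier_mat (d + 1) (d + 1)" and B: "B \<in> carrier_mat (d + 1) (d + 1)"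
    and w: "split_seq (mop (d + 1) A) (mop (d + 1) B) a b c d w"
    and wV: "\<And>i. w i \<in> fin_space (d + 1)" and w0: "w (Suc d) = 0"
  defines "P \<equiv> col_mat (d + 1) w"
  shows "P * RA d a = A * P" and "P * RB d a b c = B * P"
proof -
  have P: "P \<in> carrier_mat (d + 1) (d + 1)" by (simp add: P_def col_mat_def)
  have Pw: "mop (d + 1) P (uv (d + 1) i) = w i" if "i \<le> Suc d" for i
  proof (cases "i = Suc d")
    case True
    then show ?thesis using w0 by (simp add: uv_ge mop_simps)
  next
    case False
    then show ?thesis using that wV unfolding P_def by (intro mop_col_mat) auto
  qed
  note cl = lin_op_mop RA_carrier RB_carrier A B P square_mat_closed
  from split_seq_R[of d a b c] have
    RAu: "\<And>i. mop (d + 1) (RA d a) (uv (d + 1) i) = sc (th a d i) (uv (d + 1) i) + uv (d + 1) (Suc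
        i)" and
    RBu: "mop (d + 1) (RB d a b c) (uv (d + 1) 0) = sc (th b d 0) (uv (d + 1) 0)"
    "\<And>i. mop (d + 1) (RB d a b c) (uv (d + 1) (Suc i)) =
       sc (th b d (Suc i)) (uv (d + 1) (Suc i)) + sc (ph a b c d (Suc i)) (uv (d + 1) i)"
    unfolding split_seq_def by blast+
  from w have
    Aw: "\<And>i. mop (d + 1) A (w i) = sc (th a d i) (w i) + w (Suc i)" and
    Bw: "mop (d + 1) B (w 0) = sc (th b d 0) (w 0)"
    "\<And>i. mop (d + 1) B (w (Suc i)) = sc (th b d (Suc i)) (w (Suc i)) + sc (ph a b c d (Suc i)) (w
        i)"
    unfolding split_seq_def by blast+
  have eA: "mop (d + 1) (P * RA d a) (uv (d + 1) i) = mop (d + 1) (A * P) (uv (d + 1) i)" if "i < d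
      + 1" for i
  proof -
    have "i \<le> Suc d" "Suc i \<le> Suc d" using that by auto
    then show ?thesis by (simp only: mop_mult cl RAu mop_simps Pw Aw)
  qed
  show "P * RA d a = A * P"
    by (rule mat_eqI_uv[OF square_mat_closed(3)[OF P RA_carrier] square_mat_closed(3)[OF A P] eA])
  have eB: "mop (d + 1) (P * RB d a b c) (uv (d + 1) i) = mop (d + 1) (B * P) (uv (d + 1) i)" if "i
      < d + 1" for i
  proof (cases i)
    case 0
    then show ?thesis by (simp only: mop_mult cl RBu mop_simps Pw Bw le0)
  next
    case (Suc j)
    then have "j \<le> Suc d" "Suc j \<le> Suc d" using that by auto
    with Suc show ?thesis by (simp only: mop_mult cl RBu mop_simps Pw Bw)
  qed
  show "P * RB d a b c = B * P"
    by (rule mat_eqI_uv[OF square_mat_closed(3)[OF P RB_carrier] square_mat_closed(3)[OF B P] eB])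
qed

text \<open>Schur's lemma: the image of the intertwiner is a nonzero submodule.\<close>

lemma intertwiner_invertible:
  fixes A B :: "'a::field_char_0 mat"
  assumes irr: "irr_pair n (mop n A) (mop n B)"
    and cl: "A \<in> carrier_mat n n" "B \<in> carrier_mat n n" "A' \<in> carrier_mat n n" "B' \<in> carrier_mat n
        n"
      "P \<in> carrier_mat n n"
    and PA: "P * A' = A * P" and PB: "P * B' = B * P"
    and nz: "f \<in> fin_space n" "mop n P f \<noteq> 0"
  shows "invertible_mat P"
proof -
  define W where "W = mop n P ` fin_space n"
  have "fvs.subspace W"
    unfolding fvs.subspace_def
  proof (intro conjI ballI allI)
    show "0 \<in> W" unfolding W_def using fin_space_closed(1) by (intro image_eqI[of _ _ 0]) (auto
        simp: mop_simps)
    show "x + y \<in> W" if "x \<in> W" "y \<in> W" for x y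
      using that unfolding W_def by (auto simp: mop_simps[symmetric] intro!: fin_space_closed)
    show "sc k x \<in> W" if "x \<in> W" for k x
      using that unfolding W_def by (auto simp: mop_simps[symmetric] intro!: fin_space_closed)
  qed
  moreover have "mop n A ` W \<subseteq> W"
    unfolding W_def using cl by (auto simp: mop_mult[symmetric] PA[symmetric]) (auto simp: mop_mult
        mop_in_fin_space)
  moreover have "mop n B ` W \<subseteq> W"
    unfolding W_def using cl by (auto simp: mop_mult[symmetric] PB[symmetric]) (auto simp: mop_mult
        mop_in_fin_space)
  moreover have "W \<subseteq> fin_space n"
    by (auto simp: W_def mop_in_fin_space)
  moreover have "W \<noteq> {0}"
    using nz by (auto simp: W_def)
  ultimately have "W = fin_space n"
    using irr by (auto simp: irr_pair_def)
  then have "\<forall>i. \<exists>g. g \<in> fin_space n \<and> mop n P g = uv n i"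
    using uv_in_fin_space[of n] unfolding W_def by (metis imageE)
  then obtain g where g: "\<And>i. g i \<in> fin_space n" "\<And>i. mop n P (g i) = uv n i"
    by metis
  \<comment> \<open>Preimages of the unit vectors are the columns of a right inverse, which for
    square matrices is two-sided.\<close>
  let ?Q = "col_mat n g"
  have "P * ?Q = 1\<^sub>m n"
    by (rule mat_eqI_uv[OF square_mat_closed(3)[OF cl(5) col_mat_carrier] square_mat_closed(5)])
      (simp add: mop_mult cl col_mat_carrier mop_col_mat g mop_one uv_in_fin_space)
  moreover from this have "?Q * P = 1\<^sub>m n"
    by (rule mat_mult_left_right_inverse[OF cl(5) col_mat_carrier])
  ultimately show ?thesis
    using cl col_mat_carrier[of n g] unfolding invertible_mat_def inverts_mat_def
    by (auto intro!: exI[of _ ?Q])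
qed

text \<open>If the entry at \<open>i\<close> vanishes, \<open>B\<close> cannot leave the span of the
  basis vectors from index \<open>i\<close> on. \<open>A\<close> only raises indices, so this span
  is a proper nonzero submodule.\<close>

lemma irr_pair_R_imp_ph_nonzero:
  fixes a :: "'a::field_char_0"
  assumes irr: "irr_pair (d + 1) (mop (d + 1) (RA d a)) (mop (d + 1) (RB d a b c))"
    and i: "1 \<le> i" "i \<le> d"
  shows "ph a b c d i \<noteq> 0"
proof
  assume ph: "ph a b c d i = 0"
  define W where "W = {f \<in> fin_space (d + 1). \<forall>j<i. f j = (0::'a)}"
  have "fvs.subspace W"
    by (auto simp: fvs.subspace_def W_def intro!: fin_space_closed)
  moreover have "mop (d + 1) (RA d a) f \<in> W" if "f \<in> W" for f
    using that mop_in_fin_space[of "d + 1"] by (auto simp: W_def mop_RA[simplified])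
  moreover have "mop (d + 1) (RB d a b c) f \<in> W" if "f \<in> W" for f
  proof -
    have "ph a b c d (Suc j) * f (Suc j) = 0" if "j < i" for j
      using ph that \<open>f \<in> W\<close> by (cases "Suc j = i") (auto simp: W_def)
    then show ?thesis
      using that mop_in_fin_space[of "d + 1" "RB d a b c" f] by (auto simp: W_def
          mop_RB[simplified])
  qed
  moreover have "W \<subseteq> fin_space (d + 1)"
    by (auto simp: W_def)
  moreover have "uv (d + 1) i \<in> W"
    using uv_in_fin_space[of "d + 1" i] by (auto simp: W_def uv_def)
  moreover have "uv (d + 1) i \<noteq> (0 :: nat \<Rightarrow> 'a)"
    using i by (auto simp: uv_def fun_eq_iff)
  moreover have "uv (d + 1) 0 \<notin> W"
    using i by (auto simp: W_def uv_def)
  moreover have "uv (d + 1) 0 \<in> fin_space (d + 1)"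
    by (rule uv_in_fin_space)
  ultimately show False
    using irr unfolding irr_pair_def by (elim conjE) (drule spec[of _ W], auto)
qed

text \<open>The two factors of \<open>th\<close> change sign and trade places. So replacing
  \<open>a\<close> by \<open>- a - 1\<close> reverses the list of eigenvalues of
  \<open>A\<close>.\<close>

lemma th_flip: "i \<le> d \<Longrightarrow> th (- a - 1) d (d - i) = th (a :: 'a::field_char_0) d i"
proof -
  assume i: "i \<le> d"
  obtain h :: 'a where h: "of_nat d = 2 * h" using of_nat_eq_double_half by blast
  have h2: "of_nat d / 2 = h" using h by simp
  show ?thesis
    unfolding th_def of_nat_diff[OF i] h2 unfolding h
    by (subst eq_iff_diff_eq_0) Groebner_Basis.algebra
qed

text \<open>A product of \<open>i\<close> factors \<open>A - th (- a - 1) d j\<close>, a polynomial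
  in \<open>A\<close>. Applied to the first basis vector it yields the split basis for the
  sign-changed parameters.\<close>

primrec flip_op where
  "flip_op A a d 0 f = f"
| "flip_op A a d (Suc i) f = A (flip_op A a d i f) - sc (th (- a - 1) d i) (flip_op A a d i f)"

lemma flip_op_Suc: "flip_op A a d (Suc i) f = A (flip_op A a d i f) - sc (th (- a - 1) d i) (flip_op
    A a d i f)"
  by (simp add: fun_eq_iff)

declare flip_op.simps(2) [simp del] flip_op_Suc [simp]

lemma lin_op_flip_op:
  assumes "lin_op A"
  shows "lin_op (flip_op A a d i)"
proof (induction i)
  case 0
  show ?case by (simp add: lin_op_def)
next
  case (Suc i)
  show ?case
    by (auto simp: lin_op_def lin_op_simps[OF Suc] lin_op_simps[OF assms] fun_eq_iff algebra_simps)
qed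

lemma flip_op_commute: "lin_op A \<Longrightarrow> flip_op A a d i (A f) = A (flip_op A a d i f)"
proof (induction i)
  case (Suc i)
  have "flip_op A a d i (A f) = A (flip_op A a d i f)" by (rule Suc.IH) (rule Suc.prems)
  then show ?case unfolding flip_op_Suc by (simp only: lin_op_simps[OF Suc.prems])
qed simp

context
  fixes d :: nat and a b c :: "'a::field_char_0" and A B :: "(nat \<Rightarrow> 'a) \<Rightarrow> nat \<Rightarrow> 'a" and u :: "nat \<Rightarrow>
      nat \<Rightarrow> 'a"
  defines "A \<equiv> mop (d + 1) (RA d a)" and "B \<equiv> mop (d + 1) (RB d a b c)" and "u \<equiv> uv (d + 1)"
begin

text \<open>The new factor is \<open>A - th a d (d - i)\<close> by \<open>th_flip\<close>; commuted
  to the right, it sends \<open>u (d - i)\<close> to \<open>u (d - i + 1)\<close>, which the first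
  \<open>i\<close> factors kill. For \<open>i = d + 1\<close> this says that the flipped sequence
  stops after index \<open>d\<close>.\<close>

lemma flip_op_uv: "i \<le> d + 1 \<Longrightarrow> flip_op A a d i (u (d + 1 - i)) = 0"
proof (induction i)
  case 0
  show ?case by (simp add: u_def uv_ge)
next
  case (Suc i)
  have A: "lin_op A" by (simp add: A_def lin_op_mop)
  note F = lin_op_flip_op[OF A, of a d i]
  have e: "A (u (d - i)) = sc (th a d (d - i)) (u (d - i)) + u (Suc (d - i))"
    using split_seq_R[of d a b c] by (simp add: split_seq_def A_def u_def)
  have "flip_op A a d (Suc i) (u (d - i)) = flip_op A a d i (A (u (d - i))) - sc (th a d (d - i))
      (flip_op A a d i (u (d - i)))"
    using Suc.prems th_flip[of "d - i" d a] by (simp add: flip_op_commute[OF A])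
  also have "\<dots> = flip_op A a d i (u (Suc (d - i)))"
    unfolding e by (simp add: lin_op_simps[OF F])
  also have "\<dots> = 0"
  proof -
    have "flip_op A a d i (u (d + 1 - i)) = 0" by (rule Suc.IH) (use Suc.prems in simp)
    moreover have "d + 1 - i = Suc (d - i)" using Suc.prems by simp
    ultimately show ?thesis by simp
  qed
  finally have "flip_op A a d (Suc i) (u (d - i)) = 0" .
  then show ?case using Suc.prems by (simp only: diff_Suc_Suc Suc_eq_plus1[symmetric])
qed

text \<open>If no \<open>\<phi>\<^sub>i\<close> vanishes, every nonzero submodule has a vector with \<open>f 0 \<noteq> 0\<close> and hence contains the last vector of the flipped basis.\<close>

lemma flip_op_d:
  assumes "f \<in> fin_space (d + 1)"
  shows "flip_op A a d d f = sc (f 0) (flip_op A a d d (u 0))"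
proof -
  have A: "lin_op A" by (simp add: A_def lin_op_mop)
  note F = lin_op_flip_op[OF A, of a d d]
  \<comment> \<open>The operator kills \<open>u 1\<close> and commutes with \<open>A\<close>, and
    \<open>A\<close> generates the later basis vectors from \<open>u 1\<close>.\<close>
  have z: "flip_op A a d d (u (Suc i)) = 0" for i
  proof (induction i)
    case 0
    show ?case using flip_op_uv[of d] by simp
  next
    case (Suc i)
    have "A (u (Suc i)) = sc (th a d (Suc i)) (u (Suc i)) + u (Suc (Suc i))"
      using split_seq_R[of d a b c] by (simp add: split_seq_def A_def u_def)
    then have "u (Suc (Suc i)) = A (u (Suc i)) - sc (th a d (Suc i)) (u (Suc i))" by simp
    then show ?case
      by (simp only: lin_op_simps[OF F] flip_op_commute[OF A] Suc lin_op_simps[OF A]) (simp add: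
          fun_eq_iff)
  qed
  show ?thesis
  proof (rule lin_op_eqI[OF F _ _ assms])
    show "lin_op (\<lambda>f. sc (f 0) (flip_op A a d d (u 0)))"
      by (auto simp: lin_op_def fun_eq_iff algebra_simps)
    fix i
    show "flip_op A a d d (uv (d + 1) i) = sc (uv (d + 1) i 0) (flip_op A a d d (u 0))"
      using z by (cases i) (auto simp: u_def fun_eq_iff uv_def)
  qed
qed

lemma flip_op_in: "flip_op A a d i (u 0) \<in> fin_space (d + 1)"
proof (induction i)
  case 0
  show ?case by (simp add: u_def uv_in_fin_space)
next
  case (Suc i)
  then show ?case
    unfolding flip_op_Suc by (intro fin_space_closed) (simp_all only: A_def mop_in_fin_space)
qed

text \<open>The sign change leaves \<open>delta_val\<close> and \<open>alpha_val\<close> unchanged,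
  so by \<open>split_seqI\<close> only \<open>B\<close> on the first two vectors has to be computed.
  These are \<open>u 0\<close> and \<open>u 1\<close> plus a multiple of \<open>u 0\<close>.\<close>

lemma split_seq_flip: "split_seq A B (- a - 1) b c d (\<lambda>i. flip_op A a d i (u 0))"
proof (rule split_seqI)
  show A: "lin_op A" and B: "lin_op B" by (simp_all add: A_def B_def lin_op_mop)
  show "A (flip_op A a d i (u 0)) = sc (th (- a - 1) d i) (flip_op A a d i (u 0)) + flip_op A a d
      (Suc i) (u 0)" for i
    by simp
  obtain h :: 'a where h: "of_nat d = 2 * h" using of_nat_eq_double_half by blast
  have h2: "of_nat d / 2 = h" using h by simp
  have "delta_val (- a - 1) b c d = delta_val a b c d" "alpha_val (- a - 1) b c d = alpha_val a b c
      d"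
    unfolding delta_val_def alpha_val_def h2 by (subst eq_iff_diff_eq_0, Groebner_Basis.algebra)+
  then show "racah_rel A B (delta_val (- a - 1) b c d) (alpha_val (- a - 1) b c d) (flip_op A a d i
      (u 0))" for i
    using racah_rel_R(1)[OF flip_op_in] by (simp add: A_def B_def)
  have Au: "A (u 0) = sc (th a d 0) (u 0) + u (Suc 0)"
    and Bu0: "B (u 0) = sc (th b d 0) (u 0)"
    and Bu1: "B (u (Suc 0)) = sc (th b d (Suc 0)) (u (Suc 0)) + sc (ph a b c d (Suc 0)) (u 0)"
    using split_seq_R[of d a b c] by (simp_all add: split_seq_def A_def B_def u_def)
  show "B (flip_op A a d 0 (u 0)) = sc (th b d 0) (flip_op A a d 0 (u 0))"
    using Bu0 by simp
  show "B (flip_op A a d (Suc 0) (u 0)) = sc (th b d (Suc 0)) (flip_op A a d (Suc 0) (u 0)) +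
      sc (ph (- a - 1) b c d (Suc 0)) (flip_op A a d 0 (u 0))"
    unfolding fun_eq_iff
    apply (simp only: flip_op.simps(1) flip_op_Suc Au Bu0 Bu1 lin_op_simps[OF B] plus_fun_apply
        sc_apply minus_apply th_def ph_def h2 of_nat_Suc of_nat_0)
    by (simp only: h) (rule allI, subst eq_iff_diff_eq_0, Groebner_Basis.algebra)
qed

end

section \<open>Irreducibility\<close>

definition half_range :: "nat \<Rightarrow> 'a::field_char_0 set" where
  "half_range d = {of_nat d / 2 - of_nat i | i. 1 \<le> i \<and> i \<le> d}"

text \<open>The reflection replaces \<open>i\<close> by \<open>d + 1 - i\<close>. It is what makes
  the conditions of \<open>P_set\<close> invariant under sign changes.\<close>

lemma half_range_refl: "- 1 - x \<in> half_range d \<longleftrightarrow> x \<in> half_range d"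
proof -
  have "- 1 - y \<in> half_range d" if y: "y \<in> half_range d" for y :: 'a
  proof -
    obtain i where i: "1 \<le> i" "i \<le> d" "y = of_nat d / 2 - of_nat i"
      using y by (auto simp: half_range_def)
    have "- 1 - y = of_nat d / 2 - of_nat (d + 1 - i)"
      using i by (simp add: of_nat_diff field_simps)
    then show ?thesis
      using i unfolding half_range_def by (auto intro!: exI[of _ "d + 1 - i"])
  qed
  from this[of x] this[of "- 1 - x"] show ?thesis by auto
qed

text \<open>For \<open>i\<close> from 1 to \<open>d\<close> the factor
  \<open>i * (i - d - 1)\<close> is nonzero, so one of the two linear factors must vanish. Each of
  these equations is a condition on \<open>half_range d\<close> up to the reflection.\<close>

lemma ph_zero_iff:
  fixes a :: "'a::field_char_0"
  shows "(\<exists>i. 1 \<le> i \<and> i \<le> d \<and> ph a b c d i = 0) \<longleftrightarrow>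
     a + b + c + 1 \<in> half_range d \<or> a + b - c \<in> half_range d"
proof -
  have *: "ph a b c d i = 0 \<longleftrightarrow> - 1 - (a + b + c + 1) = of_nat d / 2 - of_nat i \<or>
      - 1 - (a + b - c) = of_nat d / 2 - of_nat i" if "1 \<le> i" "i \<le> d" for i
  proof -
    have z: "p = 0 \<longleftrightarrow> l = r" if "p = r - l" for p l r :: 'a using that by auto
    have "of_nat i \<noteq> (0::'a)" using that by simp
    moreover have "of_nat i - of_nat d - 1 \<noteq> (0::'a)"
    proof -
      have "of_nat i - of_nat d - 1 = - (of_nat (d + 1 - i) :: 'a)"
        using that by (simp add: of_nat_diff)
      then show ?thesis using that by (simp del: of_nat_diff)
    qed
    moreover have "a + b + c + of_nat d / 2 - of_nat i + 2 = 0 \<longleftrightarrow> - 1 - (a + b + c + 1) = of_nat d /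
        2 - of_nat i"
      by (rule z) (simp add: algebra_simps)
    moreover have "a + b - c + of_nat d / 2 - of_nat i + 1 = 0 \<longleftrightarrow> - 1 - (a + b - c) = of_nat d / 2 -
        of_nat i"
      by (rule z) (simp add: algebra_simps)
    ultimately show ?thesis unfolding ph_def by simp
  qed
  have "(\<exists>i. 1 \<le> i \<and> i \<le> d \<and> ph a b c d i = 0) \<longleftrightarrow>
     - 1 - (a + b + c + 1) \<in> half_range d \<or> - 1 - (a + b - c) \<in> half_range d"
    unfolding half_range_def using * by blast
  then show ?thesis by (simp only: half_range_refl)
qed

lemma P_set_iff_half_range:
  fixes a :: "'a::field_char_0"
  shows "(a, b, c) \<in> P_set d \<longleftrightarrow> a + b + c + 1 \<notin> half_range d \<and> - a + b + c \<notin> half_range d \<and>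
     a - b + c \<notin> half_range d \<and> a + b - c \<notin> half_range d"
  unfolding P_set_def half_range_def by auto

text \<open>The entries for \<open>(a, b, c)\<close> account for the conditions on
  \<open>a + b + c + 1\<close> and \<open>a + b - c\<close>, those for
  \<open>(- a - 1, b, c)\<close> for the remaining two.\<close>

lemma P_set_iff_ph:
  fixes a :: "'a::field_char_0"
  shows "(a, b, c) \<in> P_set d \<longleftrightarrow> (\<forall>i. 1 \<le> i \<and> i \<le> d \<longrightarrow> ph a b c d i \<noteq> 0 \<and> ph (- a - 1) b c d i \<noteq> 0)"
proof -
  have "- a - 1 + b + c + 1 = - a + b + c" "- a - 1 + b - c = - 1 - (a - b + c)"
    by simp_all
  then have "(\<exists>i. 1 \<le> i \<and> i \<le> d \<and> ph (- a - 1) b c d i = 0) \<longleftrightarrow>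
     - a + b + c \<in> half_range d \<or> a - b + c \<in> half_range d"
    unfolding ph_zero_iff by (simp only: half_range_refl)
  then show ?thesis
    unfolding P_set_iff_half_range using ph_zero_iff[of d a b c] by blast
qed

lemma P_set_flips:
  fixes a :: "'a::field_char_0"
  assumes "(a, b, c) \<in> P_set d"
  shows "(- a - 1, b, c) \<in> P_set d" "(a, - b - 1, c) \<in> P_set d" "(a, b, - c - 1) \<in> P_set d"
    "(- b - 1, - a - 1, c) \<in> P_set d"
proof -
  \<comment> \<open>Every linear form at the new parameters is one of the four old forms or the
    reflection of one.\<close>
  have e: "- (- a - 1) + b + c = a + b + c + 1" "- a - 1 + b + c + 1 = - a + b + c"
    "- a - 1 + b - c = - 1 - (a - b + c)" "- a - 1 - b + c = - 1 - (a + b - c)"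
    "a + (- b - 1) + c + 1 = a - b + c" "- a + (- b - 1) + c = - 1 - (a + b - c)"
    "a - (- b - 1) + c = a + b + c + 1" "a + (- b - 1) - c = - 1 - (- a + b + c)"
    "a + b + (- c - 1) + 1 = a + b - c" "- a + b + (- c - 1) = - 1 - (a - b + c)"
    "a - b + (- c - 1) = - 1 - (- a + b + c)" "a + b - (- c - 1) = a + b + c + 1"
    "- b - 1 + (- a - 1) + c + 1 = - 1 - (a + b - c)" "- (- b - 1) + (- a - 1) + c = - a + b + c"
    "- b - 1 - (- a - 1) + c = a - b + c" "- b - 1 + (- a - 1) - c = - 1 - (a + b + c + 1)"
    by simp_all
  show "(- a - 1, b, c) \<in> P_set d" "(a, - b - 1, c) \<in> P_set d" "(a, b, - c - 1) \<in> P_set d"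
    "(- b - 1, - a - 1, c) \<in> P_set d"
    using assms unfolding P_set_iff_half_range e half_range_refl by auto
qed

text \<open>A nonzero submodule is first shown to contain a vector with nonzero coordinate 0, and
  then the last flipped basis vector. From there \<open>B\<close> descends the flipped basis to its
  first vector \<open>uv (d + 1) 0\<close>, from which \<open>A\<close> produces the whole standard
  basis. Both descents divide by entries \<open>ph\<close>, one for each parameter triple.\<close>

lemma P_set_imp_irr_pair:
  fixes a :: "'a::field_char_0"
  assumes P: "(a, b, c) \<in> P_set d"
  shows "irr_pair (d + 1) (mop (d + 1) (RA d a)) (mop (d + 1) (RB d a b c))"
  unfolding irr_pair_def
proof (intro conjI allI impI)
  define A where "A = mop (d + 1) (RA d a)"
  define B where "B = mop (d + 1) (RB d a b c)"
  fix W assume WV: "W \<subseteq> fin_space (d + 1)"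
    and "fvs.subspace W \<and> mop (d + 1) (RA d a) ` W \<subseteq> W \<and> mop (d + 1) (RB d a b c) ` W \<subseteq> W"
  then have W: "fvs.subspace W" and WA: "\<And>f. f \<in> W \<Longrightarrow> A f \<in> W" and WB: "\<And>f. f \<in> W \<Longrightarrow> B f \<in> W"
    by (auto simp: A_def B_def)
  have nz: "ph a b c d i \<noteq> 0" "ph (- a - 1) b c d i \<noteq> 0" if "1 \<le> i" "i \<le> d" for i
    using P that unfolding P_set_iff_ph by auto
  show "W = {0} \<or> W = fin_space (d + 1)"
  proof (cases "W = {0}")
    case False
    then obtain f0 where "f0 \<in> W" "f0 \<noteq> 0"
      using fvs.subspace_0[OF W] by blast
    moreover from this obtain j where "f0 j \<noteq> 0" by (auto simp: fun_eq_iff)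
    ultimately have ex: "\<exists>j. \<exists>f\<in>W. f j \<noteq> 0" by blast
    define m where "m = (LEAST j. \<exists>f\<in>W. f j \<noteq> 0)"
    obtain f where f: "f \<in> W" "f m \<noteq> 0"
      using LeastI_ex[OF ex] unfolding m_def by blast
    have "m \<le> d"
    proof (rule ccontr)
      assume "\<not> m \<le> d"
      moreover have "f \<in> fin_space (d + 1)" using f WV by blast
      ultimately show False using f by (simp add: fin_space_def)
    qed
    \<comment> \<open>Otherwise \<open>B f\<close> would have the nonzero coordinate
      \<open>ph a b c d m * f m\<close> at position \<open>m - 1\<close>, against the minimality of
      \<open>m\<close>.\<close>
    have "m = 0"
    proof (cases m)
      case (Suc k)
      have k: "g k = 0" if "g \<in> W" for g
        using not_less_Least[of k "\<lambda>j. \<exists>f\<in>W. f j \<noteq> 0", folded m_def] that Suc by auto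
      have "B f k = ph a b c d m * f m"
        using Suc \<open>m \<le> d\<close> k[OF f(1)] by (simp add: B_def mop_RB[simplified])
      then show ?thesis
        using k[OF WB[OF f(1)]] f(2) nz(1)[of m] Suc \<open>m \<le> d\<close> by simp
    qed simp
    then have f0: "f 0 \<noteq> 0" using f by simp
    define w where "w i = flip_op A a d i (uv (d + 1) 0)" for i
    have flipW: "flip_op A a d i g \<in> W" if "g \<in> W" for i g
    proof (induction i)
      case (Suc i)
      then show ?case unfolding flip_op_Suc by (intro fvs.subspace_diff fvs.subspace_scale W WA)
    qed (use that in simp)
    have "flip_op A a d d f = sc (f 0) (w d)"
      unfolding w_def A_def by (rule flip_op_d) (use f(1) WV in blast)
    then have "sc (f 0) (w d) \<in> W" using flipW[OF f(1), of d] by simp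
    then have "sc (inverse (f 0)) (sc (f 0) (w d)) \<in> W" by (rule fvs.subspace_scale[OF W])
    then have wd: "w d \<in> W" using f0 by simp
    have sw: "split_seq A B (- a - 1) b c d w"
      using split_seq_flip[of d a b c] unfolding w_def A_def B_def .
    \<comment> \<open>Descent along the flipped basis: up to a multiple of the current vector,
      \<open>B\<close> yields the previous one times a nonzero \<open>ph\<close>.\<close>
    have "w (d - i) \<in> W" if "i \<le> d" for i
      using that
    proof (induction i)
      case 0
      show ?case using wd by simp
    next
      case (Suc i)
      define k where "k = d - Suc i"
      have k: "Suc k = d - i" "Suc k \<le> d" using Suc.prems by (auto simp: k_def)
      have wk: "w (Suc k) \<in> W" using Suc k by simp
      let ?p = "ph (- a - 1) b c d (Suc k)"
      have "B (w (Suc k)) = sc (th b d (Suc k)) (w (Suc k)) + sc ?p (w k)"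
        using sw by (simp add: split_seq_def)
      then have "sc ?p (w k) = B (w (Suc k)) - sc (th b d (Suc k)) (w (Suc k))" by simp
      then have "sc ?p (w k) \<in> W"
        using wk by (auto intro!: fvs.subspace_diff fvs.subspace_scale W WB)
      then have "sc (inverse ?p) (sc ?p (w k)) \<in> W" by (rule fvs.subspace_scale[OF W])
      then show ?case using nz(2)[of "Suc k"] k by (simp add: k_def)
    qed
    from this[of d] have u0: "uv (d + 1) 0 \<in> W" by (simp add: w_def)
    have u: "uv (d + 1) i \<in> W" for i
    proof (induction i)
      case 0
      show ?case by (rule u0)
    next
      case (Suc i)
      have "A (uv (d + 1) i) = sc (th a d i) (uv (d + 1) i) + uv (d + 1) (Suc i)"
        using split_seq_R[of d a b c] unfolding split_seq_def A_def by blast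
      then have "uv (d + 1) (Suc i) = A (uv (d + 1) i) - sc (th a d i) (uv (d + 1) i)" by simp
      then show ?case using Suc by (simp only:) (intro fvs.subspace_diff fvs.subspace_scale W WA)
    qed
    have "g \<in> W" if "g \<in> fin_space (d + 1)" for g
      by (subst fin_space_expand[OF that]) (intro fvs.subspace_sum W fvs.subspace_scale u)
    then show ?thesis using WV by blast
  qed simp
qed simp

section \<open>Isomorphism classes\<close>

text \<open>Isomorphism on the level of \<open>A\<close> and \<open>B\<close> alone. It allows the
  roles of the two operators to be exchanged, which is not an operation on whole tuples with fixed
  positions.\<close>

definition sim_pair where
  "sim_pair n A B A' B' \<longleftrightarrow> (\<exists>P\<in>carrier_mat n n. invertible_mat P \<and> P * A = A' * P \<and> P * B = B' * P)"

lemma invertible_mat_mop: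
  fixes P :: "'a::field mat"
  assumes "P \<in> carrier_mat n n" "invertible_mat P"
  obtains Q where "Q \<in> carrier_mat n n" "invertible_mat Q"
    "\<And>f. f \<in> fin_space n \<Longrightarrow> mop n P (mop n Q f) = f" "\<And>f. f \<in> fin_space n \<Longrightarrow> mop n Q (mop n P f) = f"
proof -
  obtain Q where Q: "P * Q = 1\<^sub>m n" "Q * P = 1\<^sub>m (dim_row Q)"
    using assms unfolding invertible_mat_def inverts_mat_def by auto
  have "dim_col (P * Q) = n" unfolding Q(1) by simp
  moreover have "dim_col (Q * P) = dim_row Q" unfolding Q(2) by simp
  ultimately have Qc: "Q \<in> carrier_mat n n" using assms(1) by auto
  have "invertible_mat Q"
    unfolding invertible_mat_def inverts_mat_def using Q Qc assms by (auto intro!: exI[of _ P])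
  moreover have "mop n P (mop n Q f) = f" "mop n Q (mop n P f) = f" if "f \<in> fin_space n" for f
    using that Q Qc assms(1) by (simp_all flip: mop_mult add: mop_one)
  ultimately show thesis using that Qc by blast
qed

lemma intertwine_iff_mop:
  fixes A :: "'a::field mat"
  assumes "P \<in> carrier_mat n n" "A \<in> carrier_mat n n" "A' \<in> carrier_mat n n"
  shows "P * A = A' * P \<longleftrightarrow> (\<forall>f\<in>fin_space n. mop n P (mop n A f) = mop n A' (mop n P f))"
  using assms by (simp add: mat_eq_iff_mop[of _ n] mop_mult square_mat_closed)

lemma intertwine_inverse:
  fixes A :: "'a::field mat"
  assumes "P \<in> carrier_mat n n" "Q \<in> carrier_mat n n" "A \<in> carrier_mat n n" "A' \<in> carrier_mat n n"
    and PQ: "\<And>f. f \<in> fin_space n \<Longrightarrow> mop n P (mop n Q f) = f"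
    and QP: "\<And>f. f \<in> fin_space n \<Longrightarrow> mop n Q (mop n P f) = f"
    and e: "P * A = A' * P"
  shows "Q * A' = A * Q"
  unfolding intertwine_iff_mop[OF assms(2,4,3)]
proof
  fix f :: "nat \<Rightarrow> 'a" assume f: "f \<in> fin_space n"
  have "mop n Q (mop n A' f) = mop n Q (mop n A' (mop n P (mop n Q f)))"
    by (simp add: PQ f)
  also have "\<dots> = mop n Q (mop n P (mop n A (mop n Q f)))"
    using e[unfolded intertwine_iff_mop[OF assms(1,3,4)]] mop_in_fin_space by metis
  also have "\<dots> = mop n A (mop n Q f)"
    by (simp add: QP mop_in_fin_space)
  finally show "mop n Q (mop n A' f) = mop n A (mop n Q f)" .
qed

lemma intertwine_compose:
  fixes A :: "'a::field mat"
  assumes "P \<in> carrier_mat n n" "Q \<in> carrier_mat n n" "A \<in> carrier_mat n n" "A' \<in> carrier_mat n n"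
      "A'' \<in> carrier_mat n n"
    and "P * A = A' * P" "Q * A' = A'' * Q"
  shows "(Q * P) * A = A'' * (Q * P)"
  using assms(6,7) unfolding intertwine_iff_mop[OF assms(1,3,4)] intertwine_iff_mop[OF assms(2,4,5)]
    intertwine_iff_mop[OF square_mat_closed(3)[OF assms(2,1)] assms(3,5)]
  by (simp add: mop_mult assms mop_in_fin_space)

lemma invertible_mat_mult:
  fixes P Q :: "'a::field mat"
  assumes "P \<in> carrier_mat n n" "Q \<in> carrier_mat n n" "invertible_mat P" "invertible_mat Q"
  shows "invertible_mat (Q * P)"
proof -
  obtain P' where P': "P' \<in> carrier_mat n n" "invertible_mat P'"
    "\<And>f. f \<in> fin_space n \<Longrightarrow> mop n P (mop n P' f) = f" "\<And>f. f \<in> fin_space n \<Longrightarrow> mop n P' (mop n P f) =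
        f"
    using invertible_mat_mop assms by metis
  obtain Q' where Q': "Q' \<in> carrier_mat n n" "invertible_mat Q'"
    "\<And>f. f \<in> fin_space n \<Longrightarrow> mop n Q (mop n Q' f) = f" "\<And>f. f \<in> fin_space n \<Longrightarrow> mop n Q' (mop n Q f) =
        f"
    using invertible_mat_mop assms by metis
  have "(Q * P) * (P' * Q') = 1\<^sub>m n"
    by (subst mat_eq_iff_mop[of _ n])
      (auto simp add: mop_mult P' Q' assms square_mat_closed mop_in_fin_space mop_one)
  moreover have "(P' * Q') * (Q * P) = 1\<^sub>m n"
    by (subst mat_eq_iff_mop[of _ n])
      (auto simp add: mop_mult P' Q' assms square_mat_closed mop_in_fin_space mop_one)
  moreover have "Q * P \<in> carrier_mat n n" "P' * Q' \<in> carrier_mat n n"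
    using P' Q' assms by (auto intro: square_mat_closed)
  ultimately have "inverts_mat (Q * P) (P' * Q')" "inverts_mat (P' * Q') (Q * P)" "square_mat (Q *
      P)"
    unfolding inverts_mat_def square_mat.simps by (simp_all only: carrier_matD)
  then show ?thesis
    unfolding invertible_mat_def by blast
qed

lemma racah_iso_sym:
  fixes A :: "'a::field mat"
  assumes "racah_iso n (A,B,C,D) (A',B',C',D')"
    and c: "A \<in> carrier_mat n n" "B \<in> carrier_mat n n" "C \<in> carrier_mat n n" "D \<in> carrier_mat n n"
    "A' \<in> carrier_mat n n" "B' \<in> carrier_mat n n" "C' \<in> carrier_mat n n" "D' \<in> carrier_mat n n"
  shows "racah_iso n (A',B',C',D') (A,B,C,D)"
proof -
  obtain P where P: "P \<in> carrier_mat n n" "invertible_mat P"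
    and e: "P * A = A' * P" "P * B = B' * P" "P * C = C' * P" "P * D = D' * P"
    using assms(1) by (auto simp: racah_iso_def)
  from P obtain Q where Q: "Q \<in> carrier_mat n n" "invertible_mat Q"
    and PQ: "\<And>f. f \<in> fin_space n \<Longrightarrow> mop n P (mop n Q f) = f" "\<And>f. f \<in> fin_space n \<Longrightarrow> mop n Q (mop n P
        f) = f"
    by (rule invertible_mat_mop) blast
  have i: "Q * X' = X * Q" if "X \<in> carrier_mat n n" "X' \<in> carrier_mat n n" "P * X = X' * P" for X X'
    by (rule intertwine_inverse[OF P(1) Q(1) that(1,2) _ _ that(3)]) (use PQ in auto)
  show ?thesis
    unfolding racah_iso_def prod.case
    using Q i[OF c(1,5) e(1)] i[OF c(2,6) e(2)] i[OF c(3,7) e(3)] i[OF c(4,8) e(4)] by blast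
qed

lemma racah_iso_trans:
  fixes A :: "'a::field mat"
  assumes "racah_iso n (A,B,C,D) (A',B',C',D')" "racah_iso n (A',B',C',D') (A'',B'',C'',D'')"
    and c: "A \<in> carrier_mat n n" "B \<in> carrier_mat n n" "C \<in> carrier_mat n n" "D \<in> carrier_mat n n"
    "A' \<in> carrier_mat n n" "B' \<in> carrier_mat n n" "C' \<in> carrier_mat n n" "D' \<in> carrier_mat n n"
    "A'' \<in> carrier_mat n n" "B'' \<in> carrier_mat n n" "C'' \<in> carrier_mat n n" "D'' \<in> carrier_mat n n"
  shows "racah_iso n (A,B,C,D) (A'',B'',C'',D'')"
proof -
  obtain P where P: "P \<in> carrier_mat n n" "invertible_mat P"
    and e: "P * A = A' * P" "P * B = B' * P" "P * C = C' * P" "P * D = D' * P"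
    using assms(1) by (auto simp: racah_iso_def)
  obtain Q where Q: "Q \<in> carrier_mat n n" "invertible_mat Q"
    and e': "Q * A' = A'' * Q" "Q * B' = B'' * Q" "Q * C' = C'' * Q" "Q * D' = D'' * Q"
    using assms(2) by (auto simp: racah_iso_def)
  note i = intertwine_compose[OF P(1) Q(1)]
  have "invertible_mat (Q * P)" "Q * P \<in> carrier_mat n n"
    using P Q by (auto intro: invertible_mat_mult square_mat_closed)
  then show ?thesis
    unfolding racah_iso_def prod.case
    using i[OF c(1,5,9) e(1) e'(1)] i[OF c(2,6,10) e(2) e'(2)] i[OF c(3,7,11) e(3) e'(3)] i[OF
        c(4,8,12) e(4) e'(4)]
    by blast
qed

lemma iso_class_cong:
  fixes M :: "'a::field rtuple"
  assumes M: "racah_module n M" and N: "racah_module n N" and iso: "racah_iso n M N"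
  shows "iso_class n M = iso_class n N"
proof -
  obtain A B C D A' B' C' D' where MN: "M = (A,B,C,D)" "N = (A',B',C',D')"
    by (metis prod_cases4)
  note c = M[unfolded racah_module_def MN prod.case] N[unfolded racah_module_def MN prod.case]
  have "racah_iso n M K \<longleftrightarrow> racah_iso n N K" if K: "racah_module n K" for K
  proof -
    obtain A'' B'' C'' D'' where K': "K = (A'',B'',C'',D'')"
      by (metis prod_cases4)
    note c' = K[unfolded racah_module_def K' prod.case]
    have "racah_iso n N M"
      unfolding MN by (rule racah_iso_sym[OF iso[unfolded MN]]) (use c in blast)+
    then show ?thesis
      using iso racah_iso_trans[of n A B C D A' B' C' D' A'' B'' C'' D''] racah_iso_trans[of n A' B'
          C' D' A B C D A'' B'' C'' D''] c c'
      unfolding MN K' by blast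
  qed
  then show ?thesis unfolding iso_class_def by blast
qed

lemma racah_iso_refl:
  fixes M :: "'a::field rtuple"
  assumes "racah_module n M"
  shows "racah_iso n M M"
proof -
  obtain A B C D where M: "M = (A,B,C,D)" by (metis prod_cases4)
  have "invertible_mat (1\<^sub>m n :: 'a mat)"
    unfolding invertible_mat_def inverts_mat_def by (auto intro!: exI[of _ "1\<^sub>m n"])
  then show ?thesis
    using assms unfolding M racah_iso_def racah_module_def prod.case by (intro bexI[of _ "1\<^sub>m n"])
        auto
qed

lemma sim_pair_sym:
  fixes A :: "'a::field mat"
  assumes "sim_pair n A B A' B'"
    and c: "A \<in> carrier_mat n n" "B \<in> carrier_mat n n" "A' \<in> carrier_mat n n" "B' \<in> carrier_mat n n"
  shows "sim_pair n A' B' A B"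
proof -
  \<comment> \<open>Repeating the first matrix in the positions of \<open>C\<close> and
    \<open>D\<close> reduces the claim for pairs to the one for tuples.\<close>
  have "racah_iso n (A',B',A',A') (A,B,A,A)"
    by (rule racah_iso_sym) (use assms in \<open>auto simp: racah_iso_def sim_pair_def\<close>)
  then show ?thesis by (auto simp: racah_iso_def sim_pair_def)
qed

lemma sim_pair_trans:
  fixes A :: "'a::field mat"
  assumes "sim_pair n A B A' B'" "sim_pair n A' B' A'' B''"
    and c: "A \<in> carrier_mat n n" "B \<in> carrier_mat n n" "A' \<in> carrier_mat n n" "B' \<in> carrier_mat n n"
      "A'' \<in> carrier_mat n n" "B'' \<in> carrier_mat n n"
  shows "sim_pair n A B A'' B''"
proof -
  have "racah_iso n (A,B,A,A) (A'',B'',A'',A'')"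
    by (rule racah_iso_trans[of n A B A A A' B' A' A']) (use assms in \<open>auto simp: racah_iso_def
        sim_pair_def\<close>)
  then show ?thesis by (auto simp: racah_iso_def sim_pair_def)
qed

lemma sim_pair_swap: "sim_pair n A B A' B' \<Longrightarrow> sim_pair n B A B' A'"
  by (auto simp: sim_pair_def)

lemma racah_iso_tuple:
  fixes A :: "'a::field_char_0 mat"
  assumes "sim_pair n A B A' B'"
    and c: "A \<in> carrier_mat n n" "B \<in> carrier_mat n n" "A' \<in> carrier_mat n n" "B' \<in> carrier_mat n n"
  shows "racah_iso n (racah_tuple n A B dl) (racah_tuple n A' B' dl)"
proof -
  obtain P where P: "P \<in> carrier_mat n n" "invertible_mat P"
    and e: "P * A = A' * P" "P * B = B' * P"
    using assms(1) by (auto simp: sim_pair_def)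
  have eA: "mop n P (mop n A f) = mop n A' (mop n P f)" and eB: "mop n P (mop n B f) = mop n B' (mop
      n P f)"
    if "f \<in> fin_space n" for f
    using e P c that by (auto simp: intertwine_iff_mop)
  have "P * (dl \<cdot>\<^sub>m 1\<^sub>m n - A - B) = (dl \<cdot>\<^sub>m 1\<^sub>m n - A' - B') * P"
    using P c by (subst intertwine_iff_mop[of _ n]) (simp_all add: mop_mat_simps eA eB)
  moreover have "P * ((1 / 2) \<cdot>\<^sub>m comm A B) = ((1 / 2) \<cdot>\<^sub>m comm A' B') * P"
    using P c by (subst intertwine_iff_mop[of _ n]) (simp_all add: comm_def mop_mat_simps eA eB)
  ultimately show ?thesis
    unfolding racah_iso_def racah_tuple_def prod.case using P e by blast
qed

lemma subspace_image:
  assumes "lin_op F" "fvs.subspace W"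
  shows "fvs.subspace (F ` W)"
  unfolding fvs.subspace_def
proof (intro conjI ballI allI)
  show "0 \<in> F ` W"
    using fvs.subspace_0[OF assms(2)] lin_op_zero[OF assms(1)] by (metis image_eqI)
  show "x + y \<in> F ` W" if "x \<in> F ` W" "y \<in> F ` W" for x y
    using that fvs.subspace_add[OF assms(2)] by (elim imageE) (metis image_eqI lin_op_add[OF
        assms(1)])
  show "sc k x \<in> F ` W" if "x \<in> F ` W" for k x
    using that fvs.subspace_scale[OF assms(2)] by (elim imageE) (metis image_eqI lin_op_sc[OF
        assms(1)])
qed

lemma irr_pair_sim:
  fixes A :: "'a::field_char_0 mat"
  assumes irr: "irr_pair n (mop n A') (mop n B')" and sim: "sim_pair n A B A' B'"
    and c: "A \<in> carrier_mat n n" "B \<in> carrier_mat n n" "A' \<in> carrier_mat n n" "B' \<in> carrier_mat n n"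
  shows "irr_pair n (mop n A) (mop n B)"
  unfolding irr_pair_def
proof (intro conjI allI impI)
  show "n > 0" using irr by (simp add: irr_pair_def)
  fix W :: "(nat \<Rightarrow> 'a) set"
  assume WV: "W \<subseteq> fin_space n" and W: "fvs.subspace W \<and> mop n A ` W \<subseteq> W \<and> mop n B ` W \<subseteq> W"
  obtain P where P: "P \<in> carrier_mat n n" "invertible_mat P"
    and e: "P * A = A' * P" "P * B = B' * P"
    using sim by (auto simp: sim_pair_def)
  have eA: "mop n A' (mop n P f) = mop n P (mop n A f)" and eB: "mop n B' (mop n P f) = mop n P (mop
      n B f)"
    if "f \<in> fin_space n" for f
    using e P c that by (auto simp: intertwine_iff_mop)
  from P obtain Q where Q: "Q \<in> carrier_mat n n" "invertible_mat Q"
    and PQ: "\<And>f. f \<in> fin_space n \<Longrightarrow> mop n P (mop n Q f) = f" and QP: "\<And>f. f \<in> fin_space n \<Longrightarrow> mop n Q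
        (mop n P f) = f"
    by (rule invertible_mat_mop) blast
  let ?W = "mop n P ` W"
  have "fvs.subspace ?W"
    using W subspace_image lin_op_mop by blast
  moreover have "mop n A' ` ?W \<subseteq> ?W" "mop n B' ` ?W \<subseteq> ?W"
    using W WV eA eB by (auto intro!: imageI simp: subset_eq)
  moreover have "?W \<subseteq> fin_space n" by (auto simp: mop_in_fin_space)
  ultimately have "?W = {0} \<or> ?W = fin_space n"
    using irr unfolding irr_pair_def by blast
  moreover have "mop n Q ` ?W = W"
  proof -
    have "mop n Q ` ?W = (\<lambda>f. f) ` W"
      unfolding image_image by (rule image_cong) (use WV QP in auto)
    then show ?thesis by simp
  qed
  moreover have "mop n Q ` fin_space n = fin_space n"
  proof
    show "fin_space n \<subseteq> mop n Q ` fin_space n"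
      using QP mop_in_fin_space by (metis image_eqI subsetI)
  qed (auto simp: mop_in_fin_space)
  ultimately show "W = {0} \<or> W = fin_space n"
    by (auto simp: mop_simps)
qed

text \<open>The sequence defines a homomorphism into an irreducible module, nonzero because
  \<open>w 0\<close> is, hence an isomorphism by Schur's lemma.\<close>

lemma split_seq_sim_pair:
  fixes A B :: "'a::field_char_0 mat"
  assumes irr: "irr_pair (d + 1) (mop (d + 1) A) (mop (d + 1) B)"
    and A: "A \<in> carrier_mat (d + 1) (d + 1)" and B: "B \<in> carrier_mat (d + 1) (d + 1)"
    and w: "split_seq (mop (d + 1) A) (mop (d + 1) B) a b c d w"
    and wV: "\<And>i. w i \<in> fin_space (d + 1)" and wd: "w (Suc d) = 0" and w0: "w 0 \<noteq> 0"
  shows "sim_pair (d + 1) (RA d a) (RB d a b c) A B"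
proof -
  let ?P = "col_mat (d + 1) w"
  note e = split_seq_intertwines[OF A B w wV wd]
  have "mop (d + 1) ?P (uv (d + 1) 0) \<noteq> 0"
    using w0 wV[of 0] by (subst mop_col_mat) auto
  then have "invertible_mat ?P"
    using intertwiner_invertible[OF irr A B RA_carrier RB_carrier col_mat_carrier e uv_in_fin_space]
        by blast
  then show ?thesis
    unfolding sim_pair_def using e col_mat_carrier by blast
qed

section \<open>Sign changes as isomorphisms\<close>

lemma sim_pair_flip_a:
  fixes a :: "'a::field_char_0"
  assumes irr: "irr_pair (d + 1) (mop (d + 1) (RA d a)) (mop (d + 1) (RB d a b c))"
  shows "sim_pair (d + 1) (RA d (- a - 1)) (RB d (- a - 1) b c) (RA d a) (RB d a b c)"
proof (rule split_seq_sim_pair[OF irr RA_carrier RB_carrier split_seq_flip flip_op_in])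
  show "flip_op (mop (d + 1) (RA d a)) a d (Suc d) (uv (d + 1) 0) = 0"
    using flip_op_uv[of "d + 1" d a] by (simp only: Suc_eq_plus1 diff_self_eq_0 order_refl
        simp_thms)
  show "flip_op (mop (d + 1) (RA d a)) a d 0 (uv (d + 1) 0) \<noteq> 0"
    by (auto simp: uv_def fun_eq_iff)
qed

text \<open>The scaling factors for the reversed standard basis: with them \<open>B\<close> raises
  the index with coefficient 1, and the entries \<open>ph\<close> move over to
  \<open>A\<close>.\<close>

primrec swap_coeff :: "'a::field \<Rightarrow> 'a \<Rightarrow> 'a \<Rightarrow> nat \<Rightarrow> nat \<Rightarrow> 'a" where
  "swap_coeff a b c d 0 = 1"
| "swap_coeff a b c d (Suc i) = ph a b c d (d - i) * swap_coeff a b c d i"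

definition swap_seq :: "'a::field \<Rightarrow> 'a \<Rightarrow> 'a \<Rightarrow> nat \<Rightarrow> nat \<Rightarrow> nat \<Rightarrow> 'a" where
  "swap_seq a b c d i = (if i \<le> d then sc (swap_coeff a b c d i) (uv (d + 1) (d - i)) else 0)"

lemma ph_swap: "i \<le> d \<Longrightarrow> ph (- b - 1) (- a - 1) c d (Suc i) = ph a b (c :: 'a::field_char_0) d (d -
    i)"
proof -
  assume i: "i \<le> d"
  obtain h :: 'a where h: "of_nat d = 2 * h" using of_nat_eq_double_half by blast
  have h2: "of_nat d / 2 = h" using h by simp
  show ?thesis
    unfolding ph_def of_nat_diff[OF i] h2 of_nat_Suc unfolding h
    by (subst eq_iff_diff_eq_0) Groebner_Basis.algebra
qed

text \<open>In reversed order \<open>B\<close> raises and \<open>A\<close> lowers the index. By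
  \<open>th_flip\<close> and \<open>ph_swap\<close> the reversed eigenvalue lists and entries are
  those of the triple \<open>(- b - 1, - a - 1, c)\<close>.\<close>

lemma split_seq_swap:
  fixes a :: "'a::field_char_0"
  shows "split_seq (mop (d + 1) (RB d a b c)) (mop (d + 1) (RA d a)) (- b - 1) (- a - 1) c d
      (swap_seq a b c d)"
proof -
  define A where "A = mop (d + 1) (RA d a)"
  define B where "B = mop (d + 1) (RB d a b c)"
  define u :: "nat \<Rightarrow> nat \<Rightarrow> 'a" where "u = uv (d + 1)"
  have A: "lin_op A" and B: "lin_op B" by (simp_all add: A_def B_def lin_op_mop)
  have Au: "A (u i) = sc (th a d i) (u i) + u (Suc i)"
    and Bu0: "B (u 0) = sc (th b d 0) (u 0)"
    and Bu: "B (u (Suc i)) = sc (th b d (Suc i)) (u (Suc i)) + sc (ph a b c d (Suc i)) (u i)" for i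
    using split_seq_R[of d a b c] unfolding split_seq_def A_def B_def u_def by blast+
  have w: "swap_seq a b c d i = sc (swap_coeff a b c d i) (u (d - i))" if "i \<le> d" for i
    using that by (simp add: swap_seq_def u_def)
  have w': "swap_seq a b c d i = 0" if "\<not> i \<le> d" for i
    using that by (simp add: swap_seq_def)
  have u0: "u (Suc d) = 0" by (simp add: u_def uv_ge)
  have thf: "th (- x - 1) d i = th x d (d - i)" if "i \<le> d" for i and x :: 'a
    using th_flip[of "d - i" d x] that by simp
  show ?thesis
    unfolding split_seq_def A_def[symmetric] B_def[symmetric]
  proof (intro conjI allI)
    fix i
    show "B (swap_seq a b c d i) = sc (th (- b - 1) d i) (swap_seq a b c d i) + swap_seq a b c d
        (Suc i)"
    proof (cases "Suc i \<le> d")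
      case True
      then have k: "d - i = Suc (d - Suc i)" "i \<le> d" by auto
      show ?thesis
        unfolding w[OF True] w[OF k(2)] thf[OF k(2)] k(1) lin_op_simps[OF B] Bu swap_coeff.simps
        using k(1) by (simp add: fun_eq_iff algebra_simps)
    next
      case False
      show ?thesis
      proof (cases "i = d")
        case True
        then show ?thesis
          using thf[of d b] by (simp add: w w' lin_op_simps[OF B] Bu0 fun_eq_iff)
      next
        case F: False
        then show ?thesis
          using False by (simp add: w' lin_op_simps[OF B] fun_eq_iff)
      qed
    qed
    show "A (swap_seq a b c d (Suc i)) = sc (th (- a - 1) d (Suc i)) (swap_seq a b c d (Suc i)) +
       sc (ph (- b - 1) (- a - 1) c d (Suc i)) (swap_seq a b c d i)"
    proof (cases "Suc i \<le> d")
      case True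
      then have k: "Suc (d - Suc i) = d - i" "i \<le> d" by auto
      show ?thesis
        unfolding w[OF True] w[OF k(2)] thf[OF True] ph_swap[OF k(2)] lin_op_simps[OF A] Au
            swap_coeff.simps k(1)
        by (simp add: fun_eq_iff algebra_simps)
    next
      case False
      show ?thesis
      proof (cases "i = d")
        case True
        have "ph (- b - 1) (- a - 1) c d (Suc d) = 0" by (simp add: ph_def)
        then show ?thesis
          using True by (simp add: w' lin_op_simps[OF A] fun_eq_iff)
      next
        case F: False
        then show ?thesis
          using False by (simp add: w' lin_op_simps[OF A] fun_eq_iff)
      qed
    qed
  next
    show "A (swap_seq a b c d 0) = sc (th (- a - 1) d 0) (swap_seq a b c d 0)"
      using thf[of 0 a] by (simp add: w lin_op_simps[OF A] Au u0 fun_eq_iff)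
  qed
qed

lemma irr_pair_swap: "irr_pair n A B \<Longrightarrow> irr_pair n B A"
  unfolding irr_pair_def by blast

lemma sim_pair_swap_ab:
  fixes a :: "'a::field_char_0"
  assumes irr: "irr_pair (d + 1) (mop (d + 1) (RA d a)) (mop (d + 1) (RB d a b c))"
  shows "sim_pair (d + 1) (RA d (- b - 1)) (RB d (- b - 1) (- a - 1) c) (RB d a b c) (RA d a)"
proof (rule split_seq_sim_pair[OF irr_pair_swap[OF irr] RB_carrier RA_carrier split_seq_swap])
  show "swap_seq a b c d i \<in> fin_space (d + 1)" for i
    by (cases "i \<le> d") (simp_all only: swap_seq_def if_True if_False fin_space_closed
        uv_in_fin_space)
  show "swap_seq a b c d (Suc d) = 0" by (simp add: swap_seq_def)
  show "swap_seq a b c d 0 \<noteq> 0" by (auto simp: swap_seq_def uv_def fun_eq_iff)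
qed

text \<open>Exchanging the operators turns \<open>(a, - b - 1, c)\<close> into
  \<open>(b, - a - 1, c)\<close>, the first sign change gives \<open>(- b - 1, - a - 1, c)\<close>,
  and a second exchange leads to \<open>(a, b, c)\<close>. The sign changes of \<open>P_set\<close>
  supply the irreducibility required on the way.\<close>

lemma sim_pair_flip_b:
  fixes a :: "'a::field_char_0"
  assumes P: "(a, b, c) \<in> P_set d"
  shows "sim_pair (d + 1) (RA d a) (RB d a (- b - 1) c) (RA d a) (RB d a b c)"
proof -
  note irr = P_set_imp_irr_pair[OF P] P_set_imp_irr_pair[OF P_set_flips(2)[OF P]]
      P_set_imp_irr_pair[OF P_set_flips(4)[OF P]]
  note R = RA_carrier RB_carrier
  have 1: "sim_pair (d + 1) (RA d (- b - 1)) (RB d (- b - 1) (- a - 1) c) (RB d a b c) (RA d a)"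
    by (rule sim_pair_swap_ab[OF irr(1)])
  have 2: "sim_pair (d + 1) (RA d b) (RB d b (- a - 1) c) (RA d (- b - 1)) (RB d (- b - 1) (- a - 1)
      c)"
    using sim_pair_flip_a[OF irr(3)] by simp
  have 3: "sim_pair (d + 1) (RA d b) (RB d b (- a - 1) c) (RB d a (- b - 1) c) (RA d a)"
    using sim_pair_swap_ab[OF irr(2)] by simp
  have "sim_pair (d + 1) (RB d a (- b - 1) c) (RA d a) (RA d (- b - 1)) (RB d (- b - 1) (- a - 1)
      c)"
    by (rule sim_pair_trans[OF sim_pair_sym[OF 3 R R(2,1)] 2 R(2,1) R R])
  then have "sim_pair (d + 1) (RB d a (- b - 1) c) (RA d a) (RB d a b c) (RA d a)"
    by (rule sim_pair_trans[OF _ 1 R(2,1) R R(2,1)])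
  then show ?thesis by (rule sim_pair_swap)
qed

lemma iso_class_R_cong:
  fixes a :: "'a::field_char_0"
  assumes "sim_pair (d + 1) (RA d a) (RB d a b c) (RA d a') (RB d a' b' c')"
    and "delta_val a b c d = delta_val a' b' c' d"
  shows "iso_class (d + 1) (R_mod d a b c) = iso_class (d + 1) (R_mod d a' b' c')"
proof (rule iso_class_cong[OF racah_module_R racah_module_R])
  show "racah_iso (d + 1) (R_mod d a b c) (R_mod d a' b' c')"
    unfolding R_mod_eq_tuple assms(2) by (rule racah_iso_tuple[OF assms(1) RA_carrier RB_carrier
        RA_carrier RB_carrier])
qed

lemma delta_val_flips:
  "delta_val (- a - 1) b c d = delta_val a b c d" "delta_val a (- b - 1) c d = delta_val a b c d"
  "delta_val a b (- c - 1) d = delta_val a b (c :: 'a::field_char_0) d"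
  by (simp_all add: delta_val_def algebra_simps)

lemma iso_class_flips:
  fixes a :: "'a::field_char_0"
  assumes P: "(a, b, c) \<in> P_set d"
  shows "iso_class (d + 1) (R_mod d (- a - 1) b c) = iso_class (d + 1) (R_mod d a b c)"
    and "iso_class (d + 1) (R_mod d a (- b - 1) c) = iso_class (d + 1) (R_mod d a b c)"
    and "iso_class (d + 1) (R_mod d a b (- c - 1)) = iso_class (d + 1) (R_mod d a b c)"
proof -
  show "iso_class (d + 1) (R_mod d (- a - 1) b c) = iso_class (d + 1) (R_mod d a b c)"
    by (rule iso_class_R_cong[OF sim_pair_flip_a[OF P_set_imp_irr_pair[OF P]] delta_val_flips(1)])
  show "iso_class (d + 1) (R_mod d a (- b - 1) c) = iso_class (d + 1) (R_mod d a b c)"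
    by (rule iso_class_R_cong[OF sim_pair_flip_b[OF P] delta_val_flips(2)])
  \<comment> \<open>The third sign change exchanges the last two factors of \<open>ph\<close>, so
    the two modules are literally equal.\<close>
  have "ph a b (- c - 1) d i = ph a b c d i" for i
  proof -
    have "a + b + (- c - 1) + of_nat d / 2 - of_nat i + 2 = a + b - c + of_nat d / 2 - of_nat i + 1"
      "a + b - (- c - 1) + of_nat d / 2 - of_nat i + 1 = a + b + c + of_nat d / 2 - of_nat i + 2"
      by simp_all
    then show ?thesis unfolding ph_def by (simp only: mult_ac)
  qed
  then have "RB d a b (- c - 1) = RB d a b c" by (intro eq_matI) (auto simp: RB_def)
  then show "iso_class (d + 1) (R_mod d a b (- c - 1)) = iso_class (d + 1) (R_mod d a b c)"
    by (simp only: R_mod_eq_tuple delta_val_flips)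
qed

definition R_cls :: "nat \<Rightarrow> 'a::field \<times> 'a \<times> 'a \<Rightarrow> 'a rtuple set" where
  "R_cls d p = (case p of (a, b, c) \<Rightarrow> iso_class (d + 1) (R_mod d a b c))"

lemma R_cls_sact:
  fixes p :: "'a::field_char_0 \<times> 'a \<times> 'a"
  assumes "p \<in> P_set d" "g \<in> signs"
  shows "R_cls d (sact g p) = R_cls d p"
proof -
  obtain a b c where p: "p = (a, b, c)" by (metis prod_cases3)
  obtain e1 e2 e3 where g: "g = (e1, e2, e3)" by (metis prod_cases3)
  have P: "(a, b, c) \<in> P_set d" using assms p by simp
  note F = P_set_flips
  show ?thesis
    unfolding p g sact_def prod.case R_cls_def
    using iso_class_flips[OF P] iso_class_flips[OF F(1)[OF P]] iso_class_flips[OF F(2)[OF P]]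
      iso_class_flips[OF F(2)[OF F(1)[OF P]]] by simp
qed

lemma orbit_self: "p \<in> orbit (p :: 'a::field \<times> 'a \<times> 'a)"
proof -
  obtain a b c where p: "p = (a, b, c)" by (metis prod_cases3)
  show ?thesis
    unfolding p orbit_def by (rule image_eqI[of _ _ "(1, 1, 1)"]) (auto simp: sact_def signs_def)
qed

section \<open>Recovering the orbit from traces and delta\<close>

lemma sim_trace:
  fixes A :: "'a::field mat"
  assumes c: "P \<in> carrier_mat n n" "A \<in> carrier_mat n n" "A' \<in> carrier_mat n n"
    and inv: "invertible_mat P" and e: "P * A = A' * P"
  shows "(\<Sum>i<n. A $$ (i, i)) = (\<Sum>i<n. A' $$ (i, i))"
proof -
  from c(1) inv obtain Q where Q: "Q \<in> carrier_mat n n" "invertible_mat Q"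
    and PQ: "\<And>f. f \<in> fin_space n \<Longrightarrow> mop n P (mop n Q f) = f" and QP: "\<And>f. f \<in> fin_space n \<Longrightarrow> mop n Q
        (mop n P f) = f"
    by (rule invertible_mat_mop) blast
  have tr: "(\<Sum>i<n. (X * Y) $$ (i, i)) = (\<Sum>i<n. (Y * X) $$ (i, i))"
    if "X \<in> carrier_mat n n" "Y \<in> carrier_mat n n" for X Y :: "'a mat"
  proof -
    have "(\<Sum>i<n. (X * Y) $$ (i, i)) = (\<Sum>i<n. \<Sum>j<n. X $$ (i, j) * Y $$ (j, i))"
      using that by (auto simp: scalar_prod_def atLeast0LessThan intro!: sum.cong)
    also have "\<dots> = (\<Sum>j<n. \<Sum>i<n. Y $$ (j, i) * X $$ (i, j))"
      by (subst sum.swap) (simp add: mult.commute)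
    also have "\<dots> = (\<Sum>j<n. (Y * X) $$ (j, j))"
      using that by (auto simp: scalar_prod_def atLeast0LessThan intro!: sum.cong)
    finally show ?thesis .
  qed
  have "A = Q * (A' * P)"
    unfolding e[symmetric] using c Q by (subst mat_eq_iff_mop[of _ n]) (auto simp: mop_mult
        square_mat_closed QP mop_in_fin_space)
  moreover have "A' = (A' * P) * Q"
    using c Q by (subst mat_eq_iff_mop[of _ n]) (auto simp: mop_mult square_mat_closed PQ
        mop_in_fin_space)
  ultimately show ?thesis
    using tr[OF Q(1) square_mat_closed(3)[OF c(3,1)]] by simp
qed

text \<open>The part linear in \<open>d - 2 * i\<close> sums to 0 by symmetry. So, in characteristic
  0, the trace determines \<open>a * (a + 1)\<close>, that is, \<open>a\<close> up to its sign
  change.\<close>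

lemma sum_th:
  fixes a :: "'a::field_char_0"
  shows "(\<Sum>i<d + 1. th a d i) = of_nat (d + 1) * (a * (a + 1)) + (\<Sum>i<d + 1. th 0 d i)"
proof -
  have z: "(\<Sum>i<d + 1. of_nat d - 2 * of_nat i :: 'a) = 0"
  proof -
    have "(\<Sum>i<d + 1. of_nat d - 2 * of_nat i :: 'a) = of_nat (d + 1) * of_nat d - 2 * (\<Sum>i = 0..d.
        of_nat i)"
      by (simp add: sum_subtractf sum_distrib_left atLeast0AtMost lessThan_Suc_atMost del:
          sum.lessThan_Suc)
    then show ?thesis by (simp only: double_gauss_sum) (simp add: algebra_simps)
  qed
  have "th a d i = a * (a + 1) + a * (of_nat d - 2 * of_nat i) + th 0 d i" for i
    by (simp add: th_def field_simps)
  then have "(\<Sum>i<d + 1. th a d i) = of_nat (d + 1) * (a * (a + 1)) + a * (\<Sum>i<d + 1. of_nat d - 2 *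
      of_nat i) + (\<Sum>i<d + 1. th 0 d i)"
    by (simp add: sum.distrib sum_distrib_left del: sum.lessThan_Suc)
  then show ?thesis by (simp only: z) simp
qed

lemma pronic_eq_iff: "x * (x + 1) = y * (y + 1) \<longleftrightarrow> x = y \<or> x = - y - (1 :: 'a::field)"
proof -
  have "x * (x + 1) - y * (y + 1) = (x - y) * (x + y + 1)" by (simp add: algebra_simps)
  then have "x * (x + 1) = y * (y + 1) \<longleftrightarrow> x - y = 0 \<or> x + y + 1 = 0"
    by (metis eq_iff_diff_eq_0 mult_eq_0_iff)
  then show ?thesis by (auto simp: algebra_simps eq_neg_iff_add_eq_0)
qed

lemma racah_iso_R_imp_orbit:
  fixes a :: "'a::field_char_0"
  assumes "racah_iso (d + 1) (R_mod d a b c) (R_mod d a' b' c')"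
  shows "(a, b, c) \<in> orbit (a', b', c')"
proof -
  let ?n = "d + 1"
  let ?C = "\<lambda>a b c. delta_val a b c d \<cdot>\<^sub>m 1\<^sub>m ?n - RA d a - RB d a b c"
  obtain P where P: "P \<in> carrier_mat ?n ?n" "invertible_mat P"
    and eA: "P * RA d a = RA d a' * P" and eB: "P * RB d a b c = RB d a' b' c' * P"
    and eC: "P * ?C a b c = ?C a' b' c' * P"
    using assms unfolding R_mod_eq_tuple racah_tuple_def racah_iso_def prod.case by blast
  from P obtain Q where Q: "Q \<in> carrier_mat ?n ?n" "invertible_mat Q"
    and PQ: "\<And>f. f \<in> fin_space ?n \<Longrightarrow> mop ?n P (mop ?n Q f) = f" and QP: "\<And>f. f \<in> fin_space ?n \<Longrightarrow> mop
        ?n Q (mop ?n P f) = f"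
    by (rule invertible_mat_mop) blast
  have nz: "of_nat (d + 1) \<noteq> (0::'a)" using of_nat_neq_0[of d] by simp
  have "(\<Sum>i<d + 1. th a d i) = (\<Sum>i<d + 1. th a' d i)"
    using sim_trace[OF P(1) RA_carrier RA_carrier P(2) eA] by (simp add: RA_def del:
        sum.lessThan_Suc)
  then have a: "a * (a + 1) = a' * (a' + 1)"
    unfolding sum_th[of a] sum_th[of a'] using nz by (simp only: add_right_cancel mult_cancel_left)
        simp
  have "(\<Sum>i<d + 1. th b d i) = (\<Sum>i<d + 1. th b' d i)"
    using sim_trace[OF P(1) RB_carrier RB_carrier P(2) eB] by (simp add: RB_def del:
        sum.lessThan_Suc)
  then have b: "b * (b + 1) = b' * (b' + 1)"
    unfolding sum_th[of b] sum_th[of b'] using nz by (simp only: add_right_cancel mult_cancel_left)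
        simp
  \<comment> \<open>To compare the scalars by which \<open>A + B + C\<close> acts, the intertwining
    relations are added up at the preimage of one nonzero vector.\<close>
  let ?g = "uv ?n 0 :: nat \<Rightarrow> 'a"
  let ?f = "mop ?n Q ?g"
  note cl = RA_carrier RB_carrier P Q square_mat_closed
  have f: "?f \<in> fin_space ?n" by (rule mop_in_fin_space)
  have Pf: "mop ?n P ?f = ?g" by (rule PQ[OF uv_in_fin_space])
  have cc: "?C a b c \<in> carrier_mat ?n ?n" for a b c by (intro cl)
  have "mop ?n P (mop ?n (?C a b c) ?f) = mop ?n (?C a' b' c') (mop ?n P ?f)"
    using eC[unfolded intertwine_iff_mop[OF P(1) cc cc]] f by blast
  moreover have "mop ?n P (mop ?n (RA d a) ?f) = mop ?n (RA d a') (mop ?n P ?f)"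
    using eA[unfolded intertwine_iff_mop[OF P(1) RA_carrier RA_carrier]] f by blast
  moreover have "mop ?n P (mop ?n (RB d a b c) ?f) = mop ?n (RB d a' b' c') (mop ?n P ?f)"
    using eB[unfolded intertwine_iff_mop[OF P(1) RB_carrier RB_carrier]] f by blast
  ultimately have "sc (delta_val a b c d) (mop ?n P ?f) = sc (delta_val a' b' c' d) (mop ?n P ?f)"
    by (simp only: mop_minus mop_smult mop_one cl f mop_in_fin_space mop_simps) simp
  then have "sc (delta_val a b c d) ?g 0 = sc (delta_val a' b' c' d) ?g 0"
    unfolding Pf by (rule arg_cong)
  then have "delta_val a b c d = delta_val a' b' c' d" by (simp add: uv_def)
  then have c: "c * (c + 1) = c' * (c' + 1)"
    unfolding delta_val_def a b by simp
  show ?thesis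
    unfolding orbit_def
  proof (rule image_eqI)
    show "(a, b, c) = sact (if a = a' then 1 else - 1, if b = b' then 1 else - 1, if c = c' then 1
        else - 1) (a', b', c')"
      using a b c unfolding pronic_eq_iff by (auto simp: sact_def)
  qed (auto simp: signs_def)
qed

text \<open>An orbit is a product of three sets \<open>{x, - x - 1}\<close>, and each of these is
  determined by either of its members.\<close>

lemma orbit_eqI:
  fixes p :: "'a::field_char_0 \<times> 'a \<times> 'a"
  assumes "p \<in> orbit q"
  shows "orbit p = orbit q"
proof -
  obtain a b c where q: "q = (a, b, c)" by (metis prod_cases3)
  have o: "orbit (a, b, c) = {a, - a - 1} \<times> {b, - b - 1} \<times> {c, - c - 1}" for a b c :: 'a
    by (auto simp: orbit_def sact_def signs_def image_iff)
  obtain x y z where p: "p = (x, y, z)" by (metis prod_cases3)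
  have "{x, - x - 1} = {a, - a - 1}" "{y, - y - 1} = {b, - b - 1}" "{z, - z - 1} = {c, - c - 1}"
    using assms unfolding p q o by auto
  then show ?thesis unfolding p q o by simp
qed

section \<open>Opposite flags\<close>

definition op_eigenvalues :: "nat \<Rightarrow> ((nat \<Rightarrow> 'a::field) \<Rightarrow> nat \<Rightarrow> 'a) \<Rightarrow> 'a set" where
  "op_eigenvalues n A = {k. \<exists>f\<in>fin_space n. f \<noteq> 0 \<and> A f = sc k f}"

lemma op_eigenvalues_mop:
  fixes M :: "'a::field mat"
  assumes M: "M \<in> carrier_mat n n"
  shows "op_eigenvalues n (mop n M) = {k. poly (char_poly M) k = 0}"
proof -
  have "k \<in> op_eigenvalues n (mop n M) \<longleftrightarrow> eigenvalue M k" for k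
  proof
    assume "k \<in> op_eigenvalues n (mop n M)"
    then obtain f where f: "f \<in> fin_space n" "f \<noteq> 0" "mop n M f = sc k f"
      by (auto simp: op_eigenvalues_def)
    have "vfun (M *\<^sub>v vec n f) = vfun (k \<cdot>\<^sub>v vec n f)"
      using f by (simp add: mop_vfun[OF M] vfun_vec vfun_smult)
    then have "M *\<^sub>v vec n f = k \<cdot>\<^sub>v vec n f"
      using M by (intro vfun_inj[of _ n]) auto
    moreover have "vec n f \<noteq> 0\<^sub>v n"
      using f vfun_vec vfun_zero by metis
    ultimately show "eigenvalue M k"
      unfolding eigenvalue_def eigenvector_def using M by (intro exI[of _ "vec n f"]) auto
  next
    assume "eigenvalue M k"
    then obtain v where v: "v \<in> carrier_vec n" "v \<noteq> 0\<^sub>v n" "M *\<^sub>v v = k \<cdot>\<^sub>v v"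
      unfolding eigenvalue_def eigenvector_def using M by auto
    have "vfun v \<noteq> 0"
      using v vfun_inj[OF v(1), of "0\<^sub>v n"] by (auto simp: vfun_zero)
    moreover have "mop n M (vfun v) = sc k (vfun v)"
      using v by (simp flip: mop_vfun[OF M] add: vfun_smult)
    ultimately show "k \<in> op_eigenvalues n (mop n M)"
      using vfun_in_fin_space[OF v(1)] by (auto simp: op_eigenvalues_def)
  qed
  then show ?thesis using eigenvalue_root_char_poly[OF M] by auto
qed

lemma op_eigenvalues_finite_nonempty:
  fixes M :: "'a::alg_closed_field mat"
  assumes M: "M \<in> carrier_mat n n" and n: "n > 0"
  shows "finite (op_eigenvalues n (mop n M))" "op_eigenvalues n (mop n M) \<noteq> {}"
proof -
  have d: "degree (char_poly M) = n" using degree_monic_char_poly[OF M] by simp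
  then have "char_poly M \<noteq> 0" using n by auto
  then show "finite (op_eigenvalues n (mop n M))"
    unfolding op_eigenvalues_mop[OF M] by (rule poly_roots_finite)
  show "op_eigenvalues n (mop n M) \<noteq> {}"
    unfolding op_eigenvalues_mop[OF M] using alg_closed_imp_poly_has_root[of "char_poly M"] d n by
        auto
qed

lemma pronic_surj: "\<exists>x. x * (x + 1) = (k :: 'a::alg_closed_field)"
proof -
  obtain x where "poly [:- k, 1, 1:] x = 0"
    using alg_closed_imp_poly_has_root[of "[:- k, 1, 1:]"] by auto
  then show ?thesis by (intro exI[of _ x]) (simp add: algebra_simps)
qed

text \<open>Only finitely many \<open>x\<close> have \<open>x * (x + 1)\<close> in \<open>E\<close>,
  so in characteristic 0 the chain \<open>x\<close>, \<open>x + 1\<close>, ... must leave them;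
  \<open>y\<close> is the last member before the first exit. Applied to eigenvalues, it starts the
  flag of \<open>krylov_flag_exists\<close>.\<close>

lemma top_of_pronic_chain:
  fixes E :: "'a::{alg_closed_field, field_char_0} set"
  assumes "finite E" "E \<noteq> {}"
  obtains y where "y * (y + 1) \<in> E" "(y + 1) * (y + 2) \<notin> E"
proof -
  define F where "F = {x. x * (x + 1) \<in> E}"
  have "F = (\<Union>e\<in>E. {x. x * (x + 1) = e})" by (auto simp: F_def)
  moreover have "finite {x. x * (x + 1) = e}" for e :: 'a
  proof -
    obtain x0 where "x0 * (x0 + 1) = e" using pronic_surj by blast
    then have "{x. x * (x + 1) = e} \<subseteq> {x0, - x0 - 1}" using pronic_eq_iff[of _ x0] by auto
    then show ?thesis using finite_subset by blast
  qed
  ultimately have F: "finite F" using assms by auto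
  obtain y0 where y0: "y0 \<in> F" using assms(2) pronic_surj unfolding F_def by (metis ex_in_conv
      mem_Collect_eq)
  have "\<exists>i. y0 + of_nat i \<notin> F"
  proof (rule ccontr)
    assume "\<not> ?thesis"
    then have "range (\<lambda>i. y0 + of_nat i) \<subseteq> F" by auto
    moreover have "inj (\<lambda>i. y0 + of_nat i)" by (auto simp: inj_def)
    ultimately show False using F finite_subset range_inj_infinite by blast
  qed
  define i where "i = (LEAST i. y0 + of_nat i \<notin> F)"
  have i: "y0 + of_nat i \<notin> F" unfolding i_def by (rule LeastI_ex) fact
  then obtain j where j: "i = Suc j" using y0 by (cases i) auto
  have "y0 + of_nat j \<in> F" using not_less_Least[of j "\<lambda>i. y0 + of_nat i \<notin> F"] j unfolding i_def by
      auto
  then show thesis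
    using that[of "y0 + of_nat j"] i unfolding F_def j by (simp add: algebra_simps)
qed

section \<open>Krylov flags\<close>

definition krylov :: "((nat \<Rightarrow> 'a::field) \<Rightarrow> nat \<Rightarrow> 'a) \<Rightarrow> (nat \<Rightarrow> 'a) \<Rightarrow> nat \<Rightarrow> (nat \<Rightarrow> 'a) set" where
  "krylov A v i = fvs.span ((\<lambda>j. (A ^^ j) v) ` {..<i})"

lemma krylov_0: "krylov A v 0 = {0}"
  by (simp add: krylov_def)

lemma subspace_krylov: "fvs.subspace (krylov A v i)"
  by (simp add: krylov_def)

lemma krylov_mono: "i \<le> j \<Longrightarrow> krylov A v i \<subseteq> krylov A v j"
  unfolding krylov_def by (rule fvs.span_mono) auto

lemma funpow_in_krylov: "j < i \<Longrightarrow> (A ^^ j) v \<in> krylov A v i"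
  unfolding krylov_def by (rule fvs.span_base) auto

lemma krylov_Suc: "krylov A v (Suc i) = {f. \<exists>k. f - sc k ((A ^^ i) v) \<in> krylov A v i}"
  unfolding krylov_def lessThan_Suc image_insert fvs.span_insert ..

lemma krylov_subset:
  assumes "fvs.subspace S" "\<And>j. j < i \<Longrightarrow> (A ^^ j) v \<in> S"
  shows "krylov A v i \<subseteq> S"
  unfolding krylov_def by (rule fvs.span_minimal) (use assms in auto)

lemma lin_op_vimage_subspace:
  assumes "lin_op F" "fvs.subspace S"
  shows "fvs.subspace {f. F f \<in> S}"
  using assms(2) unfolding fvs.subspace_def by (auto simp: lin_op_simps[OF assms(1)])

lemma krylov_step:
  assumes A: "lin_op A" and f: "f \<in> krylov A v i"
  shows "A f \<in> krylov A v (Suc i)"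
proof -
  have "krylov A v i \<subseteq> {f. A f \<in> krylov A v (Suc i)}"
  proof (rule krylov_subset[OF lin_op_vimage_subspace[OF A subspace_krylov]])
    fix j assume "j < i"
    then have "(A ^^ Suc j) v \<in> krylov A v (Suc i)" by (intro funpow_in_krylov) simp
    then show "(A ^^ j) v \<in> {f. A f \<in> krylov A v (Suc i)}" by simp
  qed
  then show ?thesis using f by blast
qed

lemma fin_space_span: "(fin_space n :: (nat \<Rightarrow> 'a::field) set) = fvs.span (uv n ` {..<n})"
proof
  show "(fin_space n :: (nat \<Rightarrow> 'a) set) \<subseteq> fvs.span (uv n ` {..<n})"
  proof
    fix f :: "nat \<Rightarrow> 'a" assume f: "f \<in> fin_space n"
    show "f \<in> fvs.span (uv n ` {..<n})"
      by (subst fin_space_expand[OF f]) (intro fvs.span_sum fvs.span_scale fvs.span_base, auto)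
  qed
  show "fvs.span (uv n ` {..<n}) \<subseteq> (fin_space n :: (nat \<Rightarrow> 'a) set)"
    by (rule fvs.span_minimal) (auto simp: fvs.subspace_def uv_in_fin_space intro: fin_space_closed)
qed

lemma subspace_fin_space: "fvs.subspace (fin_space n)"
  unfolding fin_space_span by (rule fvs.subspace_span)

lemma card_independent_fin_space:
  assumes "fvs.independent S" "S \<subseteq> fin_space n"
  shows "finite S \<and> card S \<le> n"
proof -
  have "finite S \<and> card S \<le> card (uv n ` {..<n} :: (nat \<Rightarrow> 'a) set)"
    using assms fin_space_span by (intro fvs.independent_span_bound) auto
  moreover have "card (uv n ` {..<n} :: (nat \<Rightarrow> 'a) set) \<le> n"
    using card_image_le[of "{..<n}" "uv n :: nat \<Rightarrow> nat \<Rightarrow> 'a"] by simp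
  ultimately show ?thesis by linarith
qed

lemma independent_uv:
  "m \<le> n \<Longrightarrow> fvs.independent (uv n ` {..<m} :: (nat \<Rightarrow> 'a::field) set) \<and>
     card (uv n ` {..<m} :: (nat \<Rightarrow> 'a) set) = m"
proof (induction m)
  case (Suc m)
  have "fvs.span (uv n ` {..<m}) \<subseteq> fin_space m"
    by (rule fvs.span_minimal[OF _ subspace_fin_space]) (auto simp: fin_space_def uv_def)
  moreover have "uv n m \<notin> (fin_space m :: (nat \<Rightarrow> 'a) set)"
    using Suc.prems by (auto simp: fin_space_def uv_def)
  ultimately have ni: "uv n m \<notin> fvs.span (uv n ` {..<m} :: (nat \<Rightarrow> 'a) set)" by blast
  then have ni': "uv n m \<notin> (uv n ` {..<m} :: (nat \<Rightarrow> 'a) set)"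
    by (rule contra_subsetD[OF fvs.span_superset])
  have IH: "fvs.independent (uv n ` {..<m} :: (nat \<Rightarrow> 'a) set) \<and> card (uv n ` {..<m} :: (nat \<Rightarrow> 'a)
      set) = m"
    by (rule Suc.IH) (use Suc.prems in simp)
  show ?case
    unfolding lessThan_Suc image_insert
    using fvs.independent_insertI[OF ni conjunct1[OF IH]] ni' conjunct2[OF IH]
    by (intro conjI) (assumption, simp only: card_insert_disjoint finite_imageI finite_lessThan
        simp_thms)
qed (simp only: lessThan_0 image_empty fvs.independent_empty card.empty simp_thms)

lemma independent_krylov:
  assumes "\<And>i. i < m \<Longrightarrow> (A ^^ i) v \<notin> krylov A v i"
  shows "fvs.independent ((\<lambda>j. (A ^^ j) v) ` {..<m}) \<and> card ((\<lambda>j. (A ^^ j) v) ` {..<m}) = m"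
  using assms
proof (induction m)
  case (Suc m)
  have ni: "(A ^^ m) v \<notin> fvs.span ((\<lambda>j. (A ^^ j) v) ` {..<m})"
    using Suc.prems[of m] by (simp add: krylov_def)
  then have ni': "(A ^^ m) v \<notin> (\<lambda>j. (A ^^ j) v) ` {..<m}"
    by (rule contra_subsetD[OF fvs.span_superset])
  have IH: "fvs.independent ((\<lambda>j. (A ^^ j) v) ` {..<m}) \<and> card ((\<lambda>j. (A ^^ j) v) ` {..<m}) = m"
    by (rule Suc.IH) (use Suc.prems in simp)
  show ?case
    unfolding lessThan_Suc image_insert
    using fvs.independent_insertI[OF ni conjunct1[OF IH]] ni' conjunct2[OF IH]
    by (intro conjI) (assumption, simp only: card_insert_disjoint finite_imageI finite_lessThan
        simp_thms)
qed (simp only: lessThan_0 image_empty fvs.independent_empty card.empty simp_thms)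

text \<open>A complete flag of \<open>fin_space n\<close>: step \<open>i\<close> is spanned by
  \<open>i\<close> iterates, and \<open>B\<close> acts on the quotient of step \<open>i + 1\<close>
  by step \<open>i\<close> as the scalar \<open>(y - i) * (y - i + 1)\<close>.\<close>

definition krylov_flag where
  "krylov_flag n A B y v \<longleftrightarrow>
     krylov A v n = fin_space n \<and>
     (\<forall>i<n. (A ^^ i) v \<notin> krylov A v i) \<and>
     (\<forall>i. \<forall>f\<in>krylov A v (Suc i). B f - sc ((y - of_nat i) * (y - of_nat i + 1)) f \<in> krylov A v i)"

lemma irr_pairD:
  "irr_pair n A B \<Longrightarrow> W \<subseteq> fin_space n \<Longrightarrow> fvs.subspace W \<Longrightarrow> A ` W \<subseteq> W \<Longrightarrow> B ` W \<subseteq> W \<Longrightarrow> W \<noteq> {0} \<Longrightarrow>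
     W = fin_space n"
  unfolding irr_pair_def by metis

text \<open>The flag starts at a \<open>B\<close>-eigenvector whose eigenvalue is the top of a
  chain. The relation with \<open>A\<close> and \<open>B\<close> exchanged settles \<open>B\<close>
  on the second iterate, the other relation settles it on all later ones, and irreducibility forces
  the flag to grow up to the whole space.\<close>

lemma krylov_flag_exists:
  fixes A B :: "(nat \<Rightarrow> 'a::{alg_closed_field, field_char_0}) \<Rightarrow> nat \<Rightarrow> 'a"
  assumes A: "lin_op A" and B: "lin_op B"
    and AV: "\<And>f. A f \<in> fin_space n" and BV: "\<And>f. B f \<in> fin_space n"
    and irr: "irr_pair n A B"
    and relA: "\<And>f. f \<in> fin_space n \<Longrightarrow> racah_rel A B dl al f"
    and relB: "\<And>f. f \<in> fin_space n \<Longrightarrow> racah_rel B A dl be f"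
    and E: "finite (op_eigenvalues n B)" "op_eigenvalues n B \<noteq> {}"
  obtains y v where "krylov_flag n A B y v"
proof -
  obtain y where y: "y * (y + 1) \<in> op_eigenvalues n B" "(y + 1) * (y + 2) \<notin> op_eigenvalues n B"
    using top_of_pronic_chain[OF E] by blast
  obtain v where v: "v \<in> fin_space n" "v \<noteq> 0" "B v = sc (y * (y + 1)) v"
    using y(1) by (auto simp: op_eigenvalues_def)
  define ts where "ts i = (y - of_nat i) * (y - of_nat i + 1)" for i
  define K where "K = krylov A v"
  define u where "u j = (A ^^ j) v" for j
  have u0: "u 0 = v" and uS: "u (Suc j) = A (u j)" for j by (simp_all add: u_def)
  have uV: "u j \<in> fin_space n" for j by (cases j) (simp_all add: u0 uS v AV)
  have sub: "fvs.subspace (K i)" for i by (simp add: K_def subspace_krylov)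
  have uK: "u j \<in> K i" if "j < i" for i j using that by (simp add: u_def K_def funpow_in_krylov)
  have AK: "A f \<in> K (Suc i)" if "f \<in> K i" for f i using that by (simp add: K_def krylov_step[OF A])
  have mono: "K i \<subseteq> K j" if "i \<le> j" for i j using that by (simp add: K_def krylov_mono)
  \<comment> \<open>For \<open>y = - 1\<close> both \<open>y * (y + 1)\<close> and
    \<open>(y + 1) * (y + 2)\<close> would be 0.\<close>
  have yne: "y \<noteq> - 1" using y by auto
  obtain k1 where B1: "B (u (Suc 0)) = sc (ts (Suc 0)) (u (Suc 0)) + sc k1 v"
  proof -
    define g where "g = B (A v) - sc (ts (Suc 0)) (A v)"
    define s where "s = 2 * (y * (y + 1)) * (y * (y + 1)) - 2 * dl * (y * (y + 1)) + 2 * be"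
    define k where "k = s / (- 2 * (y + 1))"
    have "- 2 * (y + 1) \<noteq> 0" using yne by (metis eq_neg_iff_add_eq_0 mult_eq_0_iff
        neg_equal_0_iff_equal zero_neq_numeral)
    then have k: "k * (- 2 * (y + 1)) = s" unfolding k_def by (metis nonzero_eq_divide_eq)
    \<comment> \<open>The exchanged relation at \<open>v\<close> factors:
      \<open>B - (y + 1) * (y + 2)\<close> applied to \<open>g\<close> is a multiple of
      \<open>v\<close>.\<close>
    have "B g x - (y + 1) * (y + 2) * g x - s * v x -
      ((B (B (A v)) - sc 2 (B (A (B v))) + A (B (B v)) - sc 2 (B (A v)) - sc 2 (A (B v))) x -
       (sc 2 (B (B v)) - sc (2 * dl) (B v) + sc (2 * be) v) x) = 0" for x
      unfolding g_def s_def ts_def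
      apply (simp only: lin_op_simps[OF A] lin_op_simps[OF B] v(3) plus_fun_apply sc_apply
          minus_apply of_nat_Suc of_nat_0)
      by Groebner_Basis.algebra
    then have Bg: "B g x - (y + 1) * (y + 2) * g x = s * v x" for x
      unfolding relB[OF v(1), unfolded racah_rel_def] by simp
    \<comment> \<open>Since \<open>k\<close> corrects \<open>g\<close> by the right multiple of
      \<open>v\<close>, a nonzero \<open>h\<close> would be an eigenvector for
      \<open>(y + 1) * (y + 2)\<close>, which the choice of \<open>y\<close> excludes.\<close>
    define h where "h = g - sc k v"
    have "B h x - sc ((y + 1) * (y + 2)) h x = 0" for x
    proof -
      have "B h x - sc ((y + 1) * (y + 2)) h x - (B g x - (y + 1) * (y + 2) * g x - k * (- 2 * (y +
          1)) * v x) = 0"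
        unfolding h_def
        apply (simp only: lin_op_simps[OF B] v(3) plus_fun_apply sc_apply minus_apply)
        by Groebner_Basis.algebra
      then show ?thesis unfolding Bg k by simp
    qed
    then have "B h = sc ((y + 1) * (y + 2)) h" by (simp add: fun_eq_iff)
    moreover have "h \<in> fin_space n" unfolding h_def g_def by (intro fin_space_closed BV AV v)
    ultimately have "h = 0" using y(2) by (auto simp: op_eigenvalues_def)
    then have "B (u (Suc 0)) = sc (ts (Suc 0)) (u (Suc 0)) + sc k v"
      unfolding h_def g_def uS u0 by (simp add: algebra_simps)
    then show thesis using that by blast
  qed
  have Bu: "B (u i) - sc (ts i) (u i) \<in> K i" for i
  proof (induction i rule: less_induct)
    case (less i)
    consider "i = 0" | "i = Suc 0" | j where "i = Suc (Suc j)" by (metis nat.exhaust)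
    then show ?case
    proof cases
      case 1
      then have e: "B (u i) - sc (ts i) (u i) = 0" by (simp add: u0 v(3) ts_def fun_eq_iff)
      have "B (u i) - sc (ts i) (u i) \<in> K i" unfolding e by (rule fvs.subspace_0[OF sub])
      then show ?thesis .
    next
      case 2
      then have "B (u i) - sc (ts i) (u i) = sc k1 (u 0)" by (simp add: B1 u0)
      then show ?thesis using 2 by (simp only:) (intro fvs.subspace_scale sub uK, simp)
    next
      case 3
      define p where "p = B (u j) - sc (ts j) (u j)"
      define q where "q = B (u (Suc j)) - sc (ts (Suc j)) (u (Suc j))"
      have p: "p \<in> K j" unfolding p_def by (rule less) (simp add: 3)
      have q: "q \<in> K (Suc j)" unfolding q_def by (rule less) (simp add: 3)
      have Bp: "B (u j) = sc (ts j) (u j) + p" and Bq: "B (A (u j)) = sc (ts (Suc j)) (A (u j)) + q"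
        by (simp_all add: p_def q_def uS)
      \<comment> \<open>The relation at \<open>u j\<close>, solved for \<open>B (u (j + 2))\<close>.
        The multiples of \<open>u (j + 2)\<close> cancel because the second difference of
        \<open>ts\<close> is 2.\<close>
      have "(B (u i) - sc (ts i) (u i)) x = (sc 2 (A q) - A (A p) + sc 2 (A p) + sc 2 q
          + sc (2 * ts j + 2 * ts (Suc j) - 2 * dl) (A (u j)) + sc (2 * al) (u j)) x" for x
      proof -
        have "(B (u i) - sc (ts i) (u i)) x - (sc 2 (A q) - A (A p) + sc 2 (A p) + sc 2 q
          + sc (2 * ts j + 2 * ts (Suc j) - 2 * dl) (A (u j)) + sc (2 * al) (u j)) x -
          ((A (A (B (u j))) - sc 2 (A (B (A (u j)))) + B (A (A (u j))) - sc 2 (A (B (u j))) - sc 2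
              (B (A (u j)))) x -
           (sc 2 (A (A (u j))) - sc (2 * dl) (A (u j)) + sc (2 * al) (u j)) x) = 0"
          unfolding 3 uS
          apply (simp only: Bp Bq)
          apply (simp only: lin_op_simps[OF A] plus_fun_apply sc_apply minus_apply)
          unfolding ts_def of_nat_Suc by Groebner_Basis.algebra
        then show ?thesis unfolding relA[OF uV, unfolded racah_rel_def] by simp
      qed
      then have e: "B (u i) - sc (ts i) (u i) = sc 2 (A q) - A (A p) + sc 2 (A p) + sc 2 q
          + sc (2 * ts j + 2 * ts (Suc j) - 2 * dl) (u (Suc j)) + sc (2 * al) (u j)"
        unfolding uS by (rule ext)
      have "A q \<in> K i" "A (A p) \<in> K i" "A p \<in> K i" "q \<in> K i" "u (Suc j) \<in> K i" "u j \<in> K i"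
        using AK[OF q] AK[OF AK[OF p]] AK[OF p] q mono[of "Suc j" i] uK[of _ i] unfolding 3 by auto
      then show ?thesis
        unfolding e by (intro fvs.subspace_add fvs.subspace_diff fvs.subspace_scale sub)
    qed
  qed
  have BK: "B f \<in> K i" if "f \<in> K i" for f i
  proof -
    have "K i \<subseteq> {f. B f \<in> K i}"
      unfolding K_def
    proof (rule krylov_subset[OF lin_op_vimage_subspace[OF B subspace_krylov]])
      fix j assume j: "j < i"
      have "B (u j) - sc (ts j) (u j) + sc (ts j) (u j) \<in> K i"
        using Bu[of j] mono[of j i] j by (intro fvs.subspace_add fvs.subspace_scale sub uK) auto
      then show "(A ^^ j) v \<in> {f. B f \<in> krylov A v i}" by (simp add: u_def K_def)
    qed
    then show ?thesis using that by blast
  qed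
  have KV: "K i \<subseteq> fin_space n" for i
    unfolding K_def by (rule krylov_subset[OF subspace_fin_space]) (use uV in \<open>simp add: u_def\<close>)
  \<comment> \<open>Once the flag stops growing, its last step is invariant under \<open>A\<close>
    and \<open>B\<close> and contains \<open>v\<close>.\<close>
  have inv: "K i = fin_space n" if "u i \<in> K i" for i
  proof -
    have "K (Suc i) \<subseteq> K i"
      unfolding K_def
    proof (rule krylov_subset[OF subspace_krylov])
      fix j assume "j < Suc i"
      then show "(A ^^ j) v \<in> krylov A v i"
        using that uK[of j i] by (cases "j = i") (auto simp: u_def K_def)
    qed
    then have "A ` K i \<subseteq> K i" using AK by blast
    moreover have "B ` K i \<subseteq> K i" using BK by blast
    moreover have "i \<noteq> 0"
      using that v(2) by (cases i) (auto simp: K_def krylov_0 u0)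
    then have "v \<in> K i" using uK[of 0 i] by (simp add: u0)
    then have "K i \<noteq> {0}" using v(2) by auto
    ultimately show ?thesis by (intro irr_pairD[OF irr KV sub])
  qed
  \<comment> \<open>Stopping before \<open>n\<close> would let fewer than \<open>n\<close> vectors
    span the whole space.\<close>
  have ni: "u i \<notin> K i" if "i < n" for i
  proof
    assume "u i \<in> K i"
    then have Ki: "fvs.span ((\<lambda>j. (A ^^ j) v) ` {..<i}) = fin_space n" using inv by (simp add: K_def
        krylov_def)
    have "uv n ` {..<n} \<subseteq> (fin_space n :: (nat \<Rightarrow> 'a) set)" using uv_in_fin_space by auto
    then have "card (uv n ` {..<n} :: (nat \<Rightarrow> 'a) set) \<le> card ((\<lambda>j. (A ^^ j) v) ` {..<i})"
      by (intro fvs.independent_span_bound[THEN conjunct2] conjunct1[OF independent_uv]) (simp_all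
          only: Ki finite_imageI finite_lessThan order_refl)
    also have "\<dots> \<le> i" using card_image_le[of "{..<i}"] by simp
    finally show False using independent_uv[of n n, where ?'a = 'a] that by simp
  qed
  have "u n \<in> K n"
  proof (rule ccontr)
    assume "u n \<notin> K n"
    then have "(A ^^ i) v \<notin> krylov A v i" if "i < Suc n" for i
      using ni[of i] that by (cases "i = n") (auto simp: u_def K_def)
    then have ind: "fvs.independent ((\<lambda>j. (A ^^ j) v) ` {..<Suc n}) \<and> card ((\<lambda>j. (A ^^ j) v) `
        {..<Suc n}) = Suc n"
      by (rule independent_krylov)
    have "(\<lambda>j. (A ^^ j) v) ` {..<Suc n} \<subseteq> fin_space n" using uV by (auto simp: u_def)
    from conjunct2[OF card_independent_fin_space[OF conjunct1[OF ind] this]]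
    show False unfolding conjunct2[OF ind] by simp
  qed
  then have "K n = fin_space n" by (rule inv)
  moreover have "B f - sc (ts i) f \<in> K i" if "f \<in> K (Suc i)" for f i
  proof -
    from that obtain k where k: "f - sc k (u i) \<in> K i"
      unfolding K_def u_def krylov_Suc by blast
    define g where "g = f - sc k (u i)"
    have f: "f = g + sc k (u i)" by (simp add: g_def)
    have "B f - sc (ts i) f = B g - sc (ts i) g + sc k (B (u i) - sc (ts i) (u i))"
      unfolding f by (simp add: lin_op_simps[OF B] fun_eq_iff algebra_simps)
    also have "\<dots> \<in> K i"
      using k unfolding g_def[symmetric] by (intro fvs.subspace_add fvs.subspace_diff
          fvs.subspace_scale sub BK Bu)
    finally show ?thesis .
  qed
  ultimately have "krylov_flag n A B y v"
    unfolding krylov_flag_def using ni by (simp add: K_def u_def ts_def)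
  then show thesis by (rule that)
qed

text \<open>Modulo a multiple of the vector itself, \<open>A\<close> moves the intersection of
  \<open>V i\<close> and \<open>U (n - i)\<close> to that for \<open>i + 1\<close>, and
  \<open>B\<close> moves it to that for \<open>i - 1\<close>. So these intersections span a
  submodule, and it must vanish because it lies in the proper subspace
  \<open>V (n - 1)\<close>.\<close>

lemma krylov_flags_disjoint:
  fixes A B :: "(nat \<Rightarrow> 'a::field) \<Rightarrow> nat \<Rightarrow> 'a"
  assumes A: "lin_op A" and B: "lin_op B" and irr: "irr_pair n A B"
    and FV: "krylov_flag n A B y v" and FU: "krylov_flag n B A x u"
    and i: "i \<le> n" and f: "f \<in> krylov A v i" "f \<in> krylov B u (n - i)"
  shows "f = 0"
proof -
  have n: "n > 0" using irr by (simp add: irr_pair_def)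
  define V where "V = krylov A v"
  define U where "U = krylov B u"
  define G where "G = (\<Union>i\<le>n. V i \<inter> U (n - i))"
  have sV: "fvs.subspace (V i)" and sU: "fvs.subspace (U i)" for i
    by (simp_all add: V_def U_def subspace_krylov)
  have AV: "g \<in> V i \<Longrightarrow> A g \<in> V (Suc i)" and BU: "g \<in> U i \<Longrightarrow> B g \<in> U (Suc i)" for g i
    by (simp_all add: V_def U_def krylov_step A B)
  have BV: "B g - sc ((y - of_nat i) * (y - of_nat i + 1)) g \<in> V i" if "g \<in> V (Suc i)" for g i
    using FV that unfolding krylov_flag_def V_def by blast
  have AU: "A g - sc ((x - of_nat i) * (x - of_nat i + 1)) g \<in> U i" if "g \<in> U (Suc i)" for g i
    using FU that unfolding krylov_flag_def U_def by blast
  have mV: "V i \<subseteq> V j" and mU: "U i \<subseteq> U j" if "i \<le> j" for i j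
    using that by (simp_all add: V_def U_def krylov_mono)
  have V0: "V 0 = {0}" and U0: "U 0 = {0}" by (simp_all add: V_def U_def krylov_0)
  let ?W = "fvs.span G"
  have sW: "fvs.subspace ?W" by (rule fvs.subspace_span)
  have inG: "g \<in> ?W" if "g \<in> V i" "g \<in> U (n - i)" "i \<le> n" for g i
    using that by (intro fvs.span_base) (auto simp: G_def)
  have "G \<subseteq> {g. A g \<in> ?W}"
  proof
    fix g assume "g \<in> G"
    then obtain i where i: "i \<le> n" "g \<in> V i" "g \<in> U (n - i)" by (auto simp: G_def)
    have "A g \<in> ?W"
    proof (cases "i = n")
      case True
      then have "g = 0" using i U0 by simp
      then show ?thesis using fvs.subspace_0[OF sW] by (simp only: lin_op_zero[OF A])
    next
      case False
      define k where "k = n - Suc i"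
      have k: "n - i = Suc k" "n - Suc i = k" using False i by (auto simp: k_def)
      let ?h = "A g - sc ((x - of_nat k) * (x - of_nat k + 1)) g"
      have "?h \<in> U (n - Suc i)" using AU i(3) unfolding k by blast
      moreover have "?h \<in> V (Suc i)"
        using AV[OF i(2)] i(2) mV[of i "Suc i"] by (intro fvs.subspace_diff fvs.subspace_scale sV)
            auto
      ultimately have "?h \<in> ?W" using inG[of ?h "Suc i"] False i(1) by simp
      then have "?h + sc ((x - of_nat k) * (x - of_nat k + 1)) g \<in> ?W"
        using inG[OF i(2,3,1)] by (intro fvs.subspace_add fvs.subspace_scale sW)
      then show ?thesis by simp
    qed
    then show "g \<in> {g. A g \<in> ?W}" by simp
  qed
  then have WA: "A ` ?W \<subseteq> ?W"
    using fvs.span_minimal[OF _ lin_op_vimage_subspace[OF A sW]] by blast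
  have "G \<subseteq> {g. B g \<in> ?W}"
  proof
    fix g assume "g \<in> G"
    then obtain i where i: "i \<le> n" "g \<in> V i" "g \<in> U (n - i)" by (auto simp: G_def)
    have "B g \<in> ?W"
    proof (cases i)
      case 0
      then have "g = 0" using i V0 by simp
      then show ?thesis using fvs.subspace_0[OF sW] by (simp only: lin_op_zero[OF B])
    next
      case (Suc k)
      have k: "n - k = Suc (n - i)" using Suc i by auto
      let ?h = "B g - sc ((y - of_nat k) * (y - of_nat k + 1)) g"
      have "?h \<in> V k" using BV i(2) unfolding Suc by blast
      moreover have "?h \<in> U (n - k)"
        using BU[OF i(3)] i(3) mU[of "n - i" "n - k"] unfolding k by (intro fvs.subspace_diff
            fvs.subspace_scale sU) auto
      ultimately have "?h \<in> ?W" using inG[of ?h k] Suc i(1) by simp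
      then have "?h + sc ((y - of_nat k) * (y - of_nat k + 1)) g \<in> ?W"
        using inG[OF i(2,3,1)] by (intro fvs.subspace_add fvs.subspace_scale sW)
      then show ?thesis by simp
    qed
    then show "g \<in> {g. B g \<in> ?W}" by simp
  qed
  then have WB: "B ` ?W \<subseteq> ?W"
    using fvs.span_minimal[OF _ lin_op_vimage_subspace[OF B sW]] by blast
  \<comment> \<open>The intersection for \<open>i = n\<close> is harmless since \<open>U 0\<close>
    is zero.\<close>
  have "G \<subseteq> V (n - 1)"
  proof
    fix g assume "g \<in> G"
    then obtain i where i: "i \<le> n" "g \<in> V i" "g \<in> U (n - i)" by (auto simp: G_def)
    show "g \<in> V (n - 1)"
    proof (cases "i = n")
      case True
      then have "g = 0" using i U0 by simp
      then show ?thesis using fvs.subspace_0[OF sV] by (simp only:)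
    next
      case False
      then have "i \<le> n - 1" using i by simp
      then show ?thesis using i mV by blast
    qed
  qed
  then have W1: "?W \<subseteq> V (n - 1)" by (rule fvs.span_minimal[OF _ sV])
  have Vn: "V n = fin_space n" using FV by (simp add: krylov_flag_def V_def)
  have "(A ^^ (n - 1)) v \<notin> V (n - 1)" using FV n by (simp add: krylov_flag_def V_def)
  moreover have "(A ^^ (n - 1)) v \<in> fin_space n" unfolding Vn[symmetric] V_def by (rule
      funpow_in_krylov) (use n in simp)
  ultimately have "?W \<noteq> fin_space n" using W1 by blast
  moreover have "?W \<subseteq> fin_space n" using W1 mV[of "n - 1" n] Vn by auto
  ultimately have "?W = {0}" using irr_pairD[OF irr _ sW WA WB] by blast
  then show ?thesis using inG[of f i] f i by (simp add: V_def U_def)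
qed

section \<open>Surjectivity\<close>

lemma second_difference_zero:
  fixes p :: "nat \<Rightarrow> 'a::field_char_0"
  assumes "\<And>i. i < d \<Longrightarrow> p i - 2 * p (Suc i) + p (Suc (Suc i)) = 0" "p 0 = 0" "p (Suc d) = 0" "i \<le> Suc
      d"
  shows "p i = 0"
proof -
  have lin: "i \<le> Suc d \<Longrightarrow> p i = of_nat i * p 1" for i
  proof (induction i rule: induct_nat_012)
    case (ge2 j)
    then have "p (Suc (Suc j)) = 2 * p (Suc j) - p j"
      using assms(1)[of j] by (simp add: algebra_simps)
    then show ?case using ge2 by (simp add: algebra_simps)
  qed (use assms(2) in auto)
  have "of_nat (Suc d) * p 1 = 0" using lin[of "Suc d"] assms(3) by simp
  then have "p 1 = 0" using of_nat_neq_0 mult_eq_0_iff by blast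
  then show ?thesis using lin[OF assms(4)] by simp
qed

text \<open>The left side is the coefficient of \<open>w (i + 1)\<close> in the first relation at
  \<open>w i\<close>, for a sequence with the entries \<open>ph\<close>. It does not involve
  \<open>al\<close>.\<close>

lemma ph_second_difference:
  fixes a b c :: "'a::field_char_0" and i d :: nat
  defines "t \<equiv> th a d" and "s \<equiv> th b d" and "f \<equiv> ph a b c d"
  shows "s i * (t i + t (Suc i)) + f i - 2 * (t i * s i + s (Suc i) * t (Suc i) + f (Suc i))
    + (t i + t (Suc i)) * s (Suc i) + f (Suc (Suc i)) - 2 * s i - 2 * s (Suc i)
    - (2 * (t i + t (Suc i)) - 2 * delta_val a b c d) = 0"
proof -
  obtain h :: 'a where h: "of_nat d = 2 * h" using of_nat_eq_double_half by blast
  have h2: "of_nat d / 2 = h" using h by simp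
  show ?thesis
    unfolding t_def s_def f_def th_def ph_def delta_val_def h2 of_nat_Suc unfolding h
    by Groebner_Basis.algebra
qed

text \<open>With the flags \<open>V\<close> of \<open>A\<close> and \<open>U\<close> of
  \<open>B\<close>, the vectors \<open>w i\<close> are chosen in \<open>V (i + 1)\<close> and
  \<open>U (d + 1 - i)\<close>. Oppositeness of the flags makes \<open>B\<close> bidiagonal on them,
  and the first relation then identifies the superdiagonal.\<close>

lemma split_seq_exists:
  fixes A B :: "(nat \<Rightarrow> 'a::{alg_closed_field, field_char_0}) \<Rightarrow> nat \<Rightarrow> 'a"
  assumes A: "lin_op A" and B: "lin_op B"
    and AV: "\<And>f. A f \<in> fin_space (d + 1)" and BV: "\<And>f. B f \<in> fin_space (d + 1)"
    and irr: "irr_pair (d + 1) A B"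
    and relA: "\<And>f. f \<in> fin_space (d + 1) \<Longrightarrow> racah_rel A B dl al f"
    and relB: "\<And>f. f \<in> fin_space (d + 1) \<Longrightarrow> racah_rel B A dl be f"
    and EA: "finite (op_eigenvalues (d + 1) A)" "op_eigenvalues (d + 1) A \<noteq> {}"
    and EB: "finite (op_eigenvalues (d + 1) B)" "op_eigenvalues (d + 1) B \<noteq> {}"
  obtains a b c w where "split_seq A B a b c d w" "\<And>i. w i \<in> fin_space (d + 1)" "w (Suc d) = 0" "w 0
      \<noteq> 0"
    "delta_val a b c d = dl"
proof -
  obtain y v where FV: "krylov_flag (d + 1) A B y v"
    using krylov_flag_exists[OF A B AV BV irr relA relB EB] by blast
  obtain x u where FU: "krylov_flag (d + 1) B A x u"
    using krylov_flag_exists[OF B A BV AV irr_pair_swap[OF irr] relB relA EA] by blast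
  define V where "V = krylov A v"
  define U where "U = krylov B u"
  have sV: "fvs.subspace (V i)" and sU: "fvs.subspace (U i)" for i
    by (simp_all add: V_def U_def subspace_krylov)
  have AVs: "g \<in> V i \<Longrightarrow> A g \<in> V (Suc i)" and BUs: "g \<in> U i \<Longrightarrow> B g \<in> U (Suc i)" for g i
    by (simp_all add: V_def U_def krylov_step A B)
  have mV: "V i \<subseteq> V j" and mU: "U i \<subseteq> U j" if "i \<le> j" for i j
    using that by (simp_all add: V_def U_def krylov_mono)
  have V0: "V 0 = {0}" and U0: "U 0 = {0}" by (simp_all add: V_def U_def krylov_0)
  have Vn: "V (d + 1) = fin_space (d + 1)" and Un: "U (d + 1) = fin_space (d + 1)"
    using FV FU by (simp_all add: krylov_flag_def V_def U_def)
  have disj: "f = 0" if "i \<le> d + 1" "f \<in> V i" "f \<in> U (d + 1 - i)" for i f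
    using krylov_flags_disjoint[OF A B irr FV FU that(1)] that(2,3) by (simp add: V_def U_def)
  obtain h :: 'a where h: "of_nat d = 2 * h" using of_nat_eq_double_half by blast
  have h2: "of_nat d / 2 = h" using h by simp
  \<comment> \<open>Chosen so that \<open>th a d d\<close> is the top \<open>x * (x + 1)\<close> of
    the flag \<open>U\<close>, while \<open>th b d 0\<close> is the top \<open>y * (y + 1)\<close>
    of \<open>V\<close>.\<close>
  define a where "a = h - x - 1"
  define b where "b = y - h"
  have tha: "th a d i = (x - of_nat (d - i)) * (x - of_nat (d - i) + 1)" if "i \<le> d" for i
    unfolding th_def a_def h2 of_nat_diff[OF that] h by (subst eq_iff_diff_eq_0)
        Groebner_Basis.algebra
  have thb: "th b d i = (y - of_nat i) * (y - of_nat i + 1)" for i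
    by (simp add: th_def b_def h2)
  have BVs: "B g - sc (th b d i) g \<in> V i" if "g \<in> V (Suc i)" for g i
    using FV that unfolding krylov_flag_def V_def thb by blast
  have AUs: "A g - sc (th a d i) g \<in> U (d - i)" if "g \<in> U (Suc (d - i))" "i \<le> d" for g i
    using FU that unfolding krylov_flag_def U_def tha[OF that(2)] by blast
  define w where "w = rec_nat v (\<lambda>i g. A g - sc (th a d i) g)"
  have w0: "w 0 = v" and wS: "w (Suc i) = A (w i) - sc (th a d i) (w i)" for i by (simp_all add:
      w_def)
  have Aw: "A (w i) = sc (th a d i) (w i) + w (Suc i)" for i by (simp add: wS)
  have wV: "w i \<in> V (Suc i)" for i
  proof (induction i)
    case 0
    show ?case unfolding w0 V_def using funpow_in_krylov[of 0 "Suc 0" A v] by simp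
  next
    case (Suc i)
    have "w i \<in> V (Suc (Suc i))" using Suc mV[of "Suc i" "Suc (Suc i)"] by auto
    then show ?case unfolding wS using AVs[OF Suc] by (intro fvs.subspace_diff fvs.subspace_scale
        sV)
  qed
  have w_fin: "w i \<in> fin_space (d + 1)" for i
  proof (induction i)
    case 0
    show ?case using wV[of 0] mV[of "Suc 0" "d + 1"] Vn by auto
  next
    case (Suc i)
    then show ?case unfolding wS by (intro fin_space_closed AV)
  qed
  \<comment> \<open>Each factor \<open>A - th a d i\<close> lowers the step of \<open>U\<close> by
    one, so \<open>w (d + 1)\<close> lands in \<open>U 0\<close> and is zero.\<close>
  have wU: "w i \<in> U (d + 1 - i)" if "i \<le> d + 1" for i
    using that
  proof (induction i)
    case 0
    show ?case using w_fin[of 0] Un by simp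
  next
    case (Suc i)
    then have "w i \<in> U (Suc (d - i))" "i \<le> d" by (simp_all add: Suc_diff_le)
    then have "w (Suc i) \<in> U (d - i)" unfolding wS by (rule AUs)
    then show ?case by simp
  qed
  have wd: "w (Suc d) = 0" using wU[of "Suc d"] U0 by simp
  have w_ge: "w i = 0" if "d < i" for i
  proof -
    have "w (Suc d + k) = 0" for k
    proof (induction k)
      case 0
      show ?case using wd by simp
    next
      case (Suc k)
      have e: "w (Suc d + k) = 0" by (rule Suc)
      have "w (Suc (Suc d + k)) = 0" unfolding wS e lin_op_zero[OF A] by (simp add: fun_eq_iff)
      then show ?case by simp
    qed
    from this[of "i - Suc d"] that show ?thesis by simp
  qed
  \<comment> \<open>So \<open>w i\<close> is an iterate of \<open>A\<close> plus lower terms and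
    generates the quotient of \<open>V (i + 1)\<close> by \<open>V i\<close>.\<close>
  have monic: "w i - (A ^^ i) v \<in> V i" for i
  proof (induction i)
    case 0
    have "w 0 - (A ^^ 0) v = 0" by (simp add: w0)
    then show ?case using fvs.subspace_0[OF sV] by metis
  next
    case (Suc i)
    have "w (Suc i) - (A ^^ Suc i) v = A (w i - (A ^^ i) v) - sc (th a d i) (w i)"
      unfolding wS by (simp add: lin_op_simps[OF A] fun_eq_iff)
    also have "\<dots> \<in> V (Suc i)"
      using AVs[OF Suc] wV[of i] by (intro fvs.subspace_diff fvs.subspace_scale sV)
    finally show ?case .
  qed
  have w_notin: "w i \<notin> V i" if "i \<le> d" for i
  proof
    assume "w i \<in> V i"
    then have "w i - (w i - (A ^^ i) v) \<in> V i" by (rule fvs.subspace_diff[OF sV _ monic])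
    then have "(A ^^ i) v \<in> V i" by simp
    then show False using FV that by (simp add: krylov_flag_def V_def)
  qed
  have Bw0: "B (w 0) = sc (th b d 0) (w 0)"
    using BVs[OF wV[of 0]] V0 by (simp add: fun_eq_iff)
  \<comment> \<open>Removing a multiple of \<open>w i\<close> from \<open>g\<close> brings it into
    \<open>V i\<close> without leaving \<open>U (d + 1 - i)\<close>, and these two meet in
    0.\<close>
  have "\<exists>k. B (w (Suc i)) = sc (th b d (Suc i)) (w (Suc i)) + sc k (w i)" if "Suc i \<le> d" for i
  proof -
    define g where "g = B (w (Suc i)) - sc (th b d (Suc i)) (w (Suc i))"
    have gV: "g \<in> V (Suc i)" unfolding g_def by (rule BVs[OF wV])
    then obtain k where k: "g - sc k ((A ^^ i) v) \<in> V i" unfolding V_def krylov_Suc by blast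
    have "g - sc k (w i) = (g - sc k ((A ^^ i) v)) - sc k (w i - (A ^^ i) v)"
      by (simp add: fun_eq_iff algebra_simps)
    also have "\<dots> \<in> V i"
      by (rule fvs.subspace_diff[OF sV k fvs.subspace_scale[OF sV monic]])
    finally have 1: "g - sc k (w i) \<in> V i" .
    have s: "Suc (d + 1 - Suc i) = d + 1 - i" using that by simp
    have wSU: "w (Suc i) \<in> U (d + 1 - Suc i)" by (rule wU) (use that in simp)
    have "B (w (Suc i)) \<in> U (d + 1 - i)" using BUs[OF wSU] unfolding s .
    moreover have "w (Suc i) \<in> U (d + 1 - i)" by (rule subsetD[OF mU wSU]) simp
    moreover have "w i \<in> U (d + 1 - i)" by (rule wU) (use that in simp)
    ultimately have 2: "g - sc k (w i) \<in> U (d + 1 - i)"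
      unfolding g_def by (intro fvs.subspace_diff fvs.subspace_scale sU)
    have "g - sc k (w i) = 0" by (rule disj[OF _ 1 2]) (use that in simp)
    then have "B (w (Suc i)) = sc (th b d (Suc i)) (w (Suc i)) + sc k (w i)"
      unfolding g_def by (simp add: algebra_simps)
    then show ?thesis by blast
  qed
  then obtain k where k: "\<And>i. Suc i \<le> d \<Longrightarrow> B (w (Suc i)) = sc (th b d (Suc i)) (w (Suc i)) + sc (k i)
      (w i)"
    by metis
  \<comment> \<open>The coefficients shifted by one and continued by 0 at both ends, as
    \<open>ph\<close> vanishes at 0 and \<open>d + 1\<close>.\<close>
  define p where "p i = (case i of 0 \<Rightarrow> 0 | Suc j \<Rightarrow> if i \<le> d then k j else 0)" for i
  have p0: "p 0 = 0" and pd: "p (Suc d) = 0" by (simp_all add: p_def)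
  have Bw: "B (w (Suc i)) = sc (th b d (Suc i)) (w (Suc i)) + sc (p (Suc i)) (w i)" for i
  proof (cases "Suc i \<le> d")
    case True
    then show ?thesis using k by (simp add: p_def)
  next
    case False
    then have e: "w (Suc i) = 0" using w_ge by simp
    show ?thesis unfolding e lin_op_zero[OF B] using False by (simp add: p_def fun_eq_iff)
  qed
  \<comment> \<open>The third parameter is a solution of the quadratic equation
    \<open>delta_val a b c d = dl\<close>.\<close>
  define c where "c = (SOME c. c * (c + 1) = dl - (h * (h + 1) + a * (a + 1) + b * (b + 1)))"
  have "c * (c + 1) = dl - (h * (h + 1) + a * (a + 1) + b * (b + 1))"
    unfolding c_def by (rule someI_ex[OF pronic_surj])
  then have dl: "delta_val a b c d = dl" by (simp add: delta_val_def h2)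
  define t where "t = th a d"
  define s where "s = th b d"
  have K1: "s i * (t i + t (Suc i)) + p i - 2 * (t i * s i + s (Suc i) * t (Suc i) + p (Suc i))
    + (t i + t (Suc i)) * s (Suc i) + p (Suc (Suc i)) - 2 * s i - 2 * s (Suc i)
    - (2 * (t i + t (Suc i)) - 2 * dl) = 0" (is "?E = 0") if "i < d" for i
  proof -
    \<comment> \<open>The first relation at \<open>w i\<close>: the coefficients of
      \<open>w (i + 2)\<close> and, if present, of \<open>w (i - 1)\<close> vanish by the form of
      the eigenvalues, and \<open>e0\<close> is that of \<open>w i\<close>.\<close>
    have "\<exists>e0. sc ?E (w (Suc i)) + sc e0 (w i) = 0"
    proof (cases i)
      case 0
      define e0 where "e0 = 2 * s 0 * t 0 * t 0 - 2 * t 0 * (s 0 * t 0) - 2 * t 0 * p (Suc 0)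
        + (t 0 + t (Suc 0)) * p (Suc 0) - 4 * t 0 * s 0 - 2 * p (Suc 0) - 2 * t 0 * t 0 + 2 * dl * t
            0 - 2 * al"
      have "(sc ?E (w (Suc i)) + sc e0 (w i)) z = 0" for z
      proof -
        have "(sc ?E (w (Suc i)) + sc e0 (w i)) z -
          ((A (A (B (w 0))) - sc 2 (A (B (A (w 0)))) + B (A (A (w 0))) - sc 2 (A (B (w 0))) - sc 2
              (B (A (w 0)))) z -
           (sc 2 (A (A (w 0))) - sc (2 * dl) (A (w 0)) + sc (2 * al) (w 0)) z) = 0"
          unfolding 0 e0_def t_def s_def
          apply (simp only: Aw Bw Bw0 p0 lin_op_simps[OF A] lin_op_simps[OF B] plus_fun_apply
              sc_apply minus_apply
             th_def h2 of_nat_Suc of_nat_0)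
          by Groebner_Basis.algebra
        then show ?thesis unfolding relA[OF w_fin, unfolded racah_rel_def] by simp
      qed
      then have "sc ?E (w (Suc i)) + sc e0 (w i) = 0" unfolding fun_eq_iff zero_fun_apply by blast
      then show ?thesis by blast
    next
      case (Suc j)
      define e0 where "e0 = 2 * s i * t i * t i + p i * (t j + t i) - 2 * t i * (s i * t i + p i) -
          2 * t i * p (Suc i)
        + (t i + t (Suc i)) * p (Suc i) - 4 * t i * s i - 2 * p i - 2 * p (Suc i) - 2 * t i * t i +
            2 * dl * t i - 2 * al"
      have "(sc ?E (w (Suc i)) + sc e0 (w i)) z = 0" for z
      proof -
        have "(sc ?E (w (Suc i)) + sc e0 (w i)) z -
          ((A (A (B (w i))) - sc 2 (A (B (A (w i)))) + B (A (A (w i))) - sc 2 (A (B (w i))) - sc 2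
              (B (A (w i)))) z -
           (sc 2 (A (A (w i))) - sc (2 * dl) (A (w i)) + sc (2 * al) (w i)) z) = 0"
          unfolding Suc e0_def t_def s_def
          apply (simp only: Aw Bw lin_op_simps[OF A] lin_op_simps[OF B] plus_fun_apply sc_apply
              minus_apply
             th_def h2 of_nat_Suc)
          by Groebner_Basis.algebra
        then show ?thesis unfolding relA[OF w_fin, unfolded racah_rel_def] by simp
      qed
      then have "sc ?E (w (Suc i)) + sc e0 (w i) = 0" unfolding fun_eq_iff zero_fun_apply by blast
      then show ?thesis by blast
    qed
    then obtain e0 where e: "sc ?E (w (Suc i)) + sc e0 (w i) = 0" by blast
    show ?thesis
    proof (rule ccontr)
      assume ne: "?E \<noteq> 0"
      \<comment> \<open>\<open>w i\<close> lies in \<open>V (i + 1)\<close> but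
        \<open>w (i + 1)\<close> does not, so its coefficient is 0.\<close>
      have "sc ?E (w (Suc i)) = sc (- e0) (w i)"
        using e by (simp add: fun_eq_iff eq_neg_iff_add_eq_0)
      also have "\<dots> \<in> V (Suc i)" by (intro fvs.subspace_scale sV wV)
      finally have "sc (inverse ?E) (sc ?E (w (Suc i))) \<in> V (Suc i)" by (rule fvs.subspace_scale[OF
          sV])
      then have "w (Suc i) \<in> V (Suc i)" using ne by simp
      then show False using w_notin[of "Suc i"] that by simp
    qed
  qed
  have pph: "p i = ph a b c d i" if "i \<le> Suc d" for i
  proof -
    \<comment> \<open>Both sequences satisfy the same second-order recurrence and vanish at 0 and
      \<open>d + 1\<close>.\<close>
    have "p i - ph a b c d i = 0"
    proof (rule second_difference_zero[of d "\<lambda>i. p i - ph a b c d i"])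
      fix i assume "i < d"
      from K1[OF this] ph_second_difference[of b d i a c, unfolded dl]
      show "p i - ph a b c d i - 2 * (p (Suc i) - ph a b c d (Suc i)) + (p (Suc (Suc i)) - ph a b c
          d (Suc (Suc i))) = 0"
        unfolding t_def s_def by Groebner_Basis.algebra
    qed (use p0 pd that in \<open>simp_all add: ph_def\<close>)
    then show ?thesis by simp
  qed
  have "B (w (Suc i)) = sc (th b d (Suc i)) (w (Suc i)) + sc (ph a b c d (Suc i)) (w i)" for i
  proof (cases "Suc i \<le> Suc d")
    case True
    then show ?thesis unfolding pph[OF True, symmetric] by (intro Bw)
  next
    case False
    then have e: "w (Suc i) = 0" "w i = 0" using w_ge by simp_all
    show ?thesis unfolding e lin_op_zero[OF B] by (simp add: fun_eq_iff)
  qed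
  then have "split_seq A B a b c d w"
    unfolding split_seq_def using Aw Bw0 by blast
  moreover have "w 0 \<noteq> 0"
    using w_notin[of 0] V0 by auto
  ultimately show thesis using that w_fin wd dl by blast
qed

text \<open>An eigenspace of a matrix commuting with the action is a nonzero submodule, hence
  everything; algebraic closedness supplies the eigenvalue.\<close>

lemma central_scalar:
  fixes A :: "'a::alg_closed_field mat"
  assumes irr: "racah_irreducible n (A, B, C, D)"
    and c: "A \<in> carrier_mat n n" "B \<in> carrier_mat n n" "C \<in> carrier_mat n n" "D \<in> carrier_mat n n"
    and Z: "Z \<in> carrier_mat n n" and comm: "\<And>X. X \<in> {A, B, C, D} \<Longrightarrow> X * Z = Z * X"
  shows "\<exists>k. Z = k \<cdot>\<^sub>m 1\<^sub>m n"
proof -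
  have n: "n > 0" using irr by (simp add: racah_irreducible_def)
  have "op_eigenvalues n (mop n Z) \<noteq> {}" by (rule op_eigenvalues_finite_nonempty(2)[OF Z n])
  then obtain k f where f: "f \<in> fin_space n" "f \<noteq> 0" "mop n Z f = sc k f"
    by (auto simp: op_eigenvalues_def)
  define W where "W = {v \<in> carrier_vec n. mop n Z (vfun v) = sc k (vfun v)}"
  have "W \<subseteq> carrier_vec n \<and> 0\<^sub>v n \<in> W \<and> (\<forall>v\<in>W. \<forall>w\<in>W. v + w \<in> W) \<and> (\<forall>k. \<forall>v\<in>W. k \<cdot>\<^sub>v v \<in> W) \<and>
        (\<forall>X\<in>{A,B,C,D}. \<forall>v\<in>W. X *\<^sub>v v \<in> W)"
  proof (intro conjI ballI allI)
    show "W \<subseteq> carrier_vec n" by (auto simp: W_def)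
    have "mop n Z (vfun (0\<^sub>v n)) = sc k (vfun (0\<^sub>v n))"
      unfolding vfun_zero lin_op_zero[OF lin_op_mop] by (simp add: fun_eq_iff)
    then show "0\<^sub>v n \<in> W" by (simp add: W_def)
    fix v assume v: "v \<in> W"
    then have vc: "v \<in> carrier_vec n" and Zv: "mop n Z (vfun v) = sc k (vfun v)" by (simp_all add:
        W_def)
    show "v + w \<in> W" if w: "w \<in> W" for w
    proof -
      have wc: "w \<in> carrier_vec n" and Zw: "mop n Z (vfun w) = sc k (vfun w)" using w by (simp_all
          add: W_def)
      have "mop n Z (vfun (v + w)) = sc k (vfun (v + w))"
        unfolding vfun_add[OF vc wc] mop_simps Zv Zw by (simp add: fun_eq_iff algebra_simps)
      then show ?thesis using vc wc by (simp add: W_def)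
    qed
    show "j \<cdot>\<^sub>v v \<in> W" for j
    proof -
      have "mop n Z (vfun (j \<cdot>\<^sub>v v)) = sc k (vfun (j \<cdot>\<^sub>v v))"
        unfolding vfun_smult mop_simps Zv by (simp add: fun_eq_iff algebra_simps)
      then show ?thesis using vc by (simp add: W_def)
    qed
    fix X assume X: "X \<in> {A, B, C, D}"
    then have Xc: "X \<in> carrier_mat n n" using c by auto
    have "mop n Z (mop n X (vfun v)) = mop n X (mop n Z (vfun v))"
      using comm[OF X] by (simp flip: mop_mult[OF Z Xc] mop_mult[OF Xc Z])
    then have "mop n Z (vfun (X *\<^sub>v v)) = sc k (vfun (X *\<^sub>v v))"
      unfolding mop_vfun[OF Xc vc] Zv mop_simps .
    then show "X *\<^sub>v v \<in> W" using Xc vc by (simp add: W_def)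
  qed
  then have "W = {0\<^sub>v n} \<or> W = carrier_vec n"
    using irr unfolding racah_irreducible_def prod.case by blast
  moreover have "vec n f \<in> W"
    using f by (simp add: W_def vfun_vec)
  moreover have "vec n f \<noteq> 0\<^sub>v n"
    using f vfun_vec vfun_zero by metis
  ultimately have W: "W = carrier_vec n" by auto
  have "mop n Z g = mop n (k \<cdot>\<^sub>m 1\<^sub>m n) g" if g: "g \<in> fin_space n" for g
  proof -
    have "vec n g \<in> W" using W by simp
    then have "mop n Z g = sc k g" using g by (simp add: W_def vfun_vec)
    then show ?thesis using g by (simp add: mop_smult[of _ n] mop_one)
  qed
  then show ?thesis
    using Z by (intro exI[of _ k]) (subst mat_eq_iff_mop[of _ n], auto)
qed

text \<open>The commutator relations make \<open>A + B + C\<close> commute with every generator, so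
  it is a scalar \<open>dl\<close>. This expresses \<open>C\<close> through \<open>A\<close> and
  \<open>B\<close>, after which the scalars of \<open>racah_alpha\<close> and
  \<open>racah_beta\<close> give the two relations.\<close>

lemma irreducible_module_tuple:
  fixes M :: "'a::{alg_closed_field, field_char_0} rtuple"
  assumes mod: "racah_module n M" and irr: "racah_irreducible n M"
  obtains A B dl al be where "M = racah_tuple n A B dl" "A \<in> carrier_mat n n" "B \<in> carrier_mat n n"
    "\<And>f. f \<in> fin_space n \<Longrightarrow> racah_rel (mop n A) (mop n B) dl al f"
    "\<And>f. f \<in> fin_space n \<Longrightarrow> racah_rel (mop n B) (mop n A) dl be f"
proof -
  obtain A B C D where M: "M = (A, B, C, D)" by (metis prod_cases4)
  have c: "A \<in> carrier_mat n n" "B \<in> carrier_mat n n" "C \<in> carrier_mat n n" "D \<in> carrier_mat n n"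
    and r: "comm A B = 2 \<cdot>\<^sub>m D" "comm B C = 2 \<cdot>\<^sub>m D" "comm C A = 2 \<cdot>\<^sub>m D"
    and cen: "\<And>Z X. Z \<in> {racah_alpha M, racah_beta M, racah_gamma M} \<Longrightarrow> X \<in> {A, B, C, D} \<Longrightarrow> X * Z = Z
        * X"
    using mod unfolding racah_module_def M prod.case by blast+
  note scal = central_scalar[OF irr[unfolded M] c]
  let ?A = "mop n A" and ?B = "mop n B" and ?C = "mop n C" and ?D = "mop n D"
  have rm: "?A (?B f) - ?B (?A f) = sc 2 (?D f)" "?B (?C f) - ?C (?B f) = sc 2 (?D f)"
    "?C (?A f) - ?A (?C f) = sc 2 (?D f)" for f
    using arg_cong[OF r(1), of "\<lambda>X. mop n X f"] arg_cong[OF r(2), of "\<lambda>X. mop n X f"]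
      arg_cong[OF r(3), of "\<lambda>X. mop n X f"] c by (simp_all only: comm_def mop_mat_simps)
  \<comment> \<open>The relations oriented as rewrite rules that bring products of two generators
    into the orders \<open>BA\<close>, \<open>BC\<close> and \<open>AC\<close>.\<close>
  have rx: "?A (?B f) x = ?B (?A f) x + 2 * ?D f x" "?C (?B f) x = ?B (?C f) x - 2 * ?D f x"
    "?C (?A f) x = ?A (?C f) x + 2 * ?D f x" for f x
    using fun_cong[OF rm(1)[of f], of x] fun_cong[OF rm(2)[of f], of x] fun_cong[OF rm(3)[of f], of
        x]
    by (simp_all add: algebra_simps)
  let ?S = "A + B + C"
  have S: "?S \<in> carrier_mat n n" using c by simp
  have comAB: "mop n X (mop n ?S f) = mop n ?S (mop n X f)" if "X \<in> {A, B, C}" for X f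
    using that c by (auto simp: mop_mat_simps fun_eq_iff rx)
  have comD: "mop n D (mop n ?S f) = mop n ?S (mop n D f)" for f
  proof -
    have d: "?D g = sc (1 / 2) (?A (?B g) - ?B (?A g))" for g unfolding rm by (simp add: fun_eq_iff)
    show ?thesis unfolding d using comAB[of A] comAB[of B] by (simp add: mop_simps)
  qed
  have "\<exists>k. ?S = k \<cdot>\<^sub>m 1\<^sub>m n"
  proof (rule scal[OF S])
    fix X assume X: "X \<in> {A, B, C, D}"
    then have Xc: "X \<in> carrier_mat n n" using c by auto
    have "mop n X (mop n ?S f) = mop n ?S (mop n X f)" for f
      using X comAB comD by blast
    then show "X * ?S = ?S * X"
      using Xc S by (subst mat_eq_iff_mop[of _ n]) (simp_all only: mop_mult square_mat_closed
          ball_simps, simp)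
  qed
  then obtain dl where dl: "?S = dl \<cdot>\<^sub>m 1\<^sub>m n" by blast
  have C: "C = dl \<cdot>\<^sub>m 1\<^sub>m n - A - B"
    unfolding dl[symmetric] using c by (intro eq_matI) auto
  have D: "D = (1 / 2) \<cdot>\<^sub>m comm A B"
    unfolding r using c by (intro eq_matI) auto
  have MT: "M = racah_tuple n A B dl"
    unfolding M racah_tuple_def C[symmetric] D[symmetric] ..
  have ac: "racah_alpha M \<in> carrier_mat n n" "racah_beta M \<in> carrier_mat n n"
    unfolding MT by (rule racah_tuple_carrier[OF c(1,2)])+
  obtain al where al: "racah_alpha M = al \<cdot>\<^sub>m 1\<^sub>m n" using scal[OF ac(1)] cen by blast
  obtain be where be: "racah_beta M = be \<cdot>\<^sub>m 1\<^sub>m n" using scal[OF ac(2)] cen by blast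
  show thesis
  proof (rule that[OF MT c(1,2)])
    show "racah_rel (mop n A) (mop n B) dl al f" if "f \<in> fin_space n" for f
      using al that unfolding MT racah_alpha_scalar_iff[OF c(1,2)] by blast
    show "racah_rel (mop n B) (mop n A) dl (- be) f" if "f \<in> fin_space n" for f
      using be that unfolding MT racah_beta_scalar_iff[OF c(1,2)] by blast
  qed
qed

lemma irreducible_module_is_R:
  fixes M :: "'a::{alg_closed_field, field_char_0} rtuple"
  assumes mod: "racah_module (d + 1) M" and irr: "racah_irreducible (d + 1) M"
  obtains a b c where "(a, b, c) \<in> P_set d" "iso_class (d + 1) M = iso_class (d + 1) (R_mod d a b
      c)"
proof -
  obtain A B dl al be where M: "M = racah_tuple (d + 1) A B dl"
    and c: "A \<in> carrier_mat (d + 1) (d + 1)" "B \<in> carrier_mat (d + 1) (d + 1)"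
    and rel: "\<And>f. f \<in> fin_space (d + 1) \<Longrightarrow> racah_rel (mop (d + 1) A) (mop (d + 1) B) dl al f"
      "\<And>f. f \<in> fin_space (d + 1) \<Longrightarrow> racah_rel (mop (d + 1) B) (mop (d + 1) A) dl be f"
    using irreducible_module_tuple[OF mod irr] by metis
  have ip: "irr_pair (d + 1) (mop (d + 1) A) (mop (d + 1) B)"
    using irr unfolding M racah_irreducible_tuple_iff[OF c] .
  have n: "d + 1 > 0" by simp
  obtain x y z w where w: "split_seq (mop (d + 1) A) (mop (d + 1) B) x y z d w"
    "\<And>i. w i \<in> fin_space (d + 1)" "w (Suc d) = 0" "w 0 \<noteq> 0" and dl: "delta_val x y z d = dl"
    by (rule split_seq_exists[OF lin_op_mop lin_op_mop mop_in_fin_space mop_in_fin_space ip rel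
        op_eigenvalues_finite_nonempty[OF c(1) n] op_eigenvalues_finite_nonempty[OF c(2) n]]) blast+
  have sim: "sim_pair (d + 1) (RA d x) (RB d x y z) A B"
    by (rule split_seq_sim_pair[OF ip c w])
  have iso: "racah_iso (d + 1) (R_mod d x y z) M"
    unfolding M R_mod_eq_tuple dl by (rule racah_iso_tuple[OF sim RA_carrier RB_carrier c])
  have ipR: "irr_pair (d + 1) (mop (d + 1) (RA d x)) (mop (d + 1) (RB d x y z))"
    by (rule irr_pair_sim[OF ip sim RA_carrier RB_carrier c])
  \<comment> \<open>The sign-changed module is isomorphic to an irreducible one, which makes its
    entries \<open>ph\<close> nonzero as well and gives the other half of
    \<open>P_set\<close>.\<close>
  have ipR': "irr_pair (d + 1) (mop (d + 1) (RA d (- x - 1))) (mop (d + 1) (RB d (- x - 1) y z))"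
    by (rule irr_pair_sim[OF ipR sim_pair_flip_a[OF ipR] RA_carrier RB_carrier RA_carrier
        RB_carrier])
  have "(x, y, z) \<in> P_set d"
    unfolding P_set_iff_ph using irr_pair_R_imp_ph_nonzero[OF ipR] irr_pair_R_imp_ph_nonzero[OF
        ipR'] by blast
  moreover have "iso_class (d + 1) M = iso_class (d + 1) (R_mod d x y z)"
    using iso_class_cong[OF racah_module_R mod iso] by simp
  ultimately show thesis by (rule that)
qed

theorem theorem2p5:
  fixes d :: nat
  shows "\<exists>\<R> :: ('a::{alg_closed_field, field_char_0} \<times> 'a \<times> 'a) set \<Rightarrow> 'a rtuple set.
           (\<forall>a b c. (a,b,c) \<in> P_set d \<longrightarrow> \<R> (orbit (a,b,c)) = iso_class (d+1) (R_mod d a b c))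
         \<and> bij_betw \<R> (P_orbits d) (irred_classes (d+1))"
proof -
  \<comment> \<open>The class is read off from a chosen representative; \<open>R_cls_sact\<close>
    makes it independent of the choice.\<close>
  define \<R> :: "('a \<times> 'a \<times> 'a) set \<Rightarrow> 'a rtuple set"
    where "\<R> X = R_cls d (SOME p. p \<in> P_set d \<and> orbit p = X)" for X
  have wd: "\<R> (orbit p) = R_cls d p" if p: "p \<in> P_set d" for p
  proof -
    define q where "q = (SOME q. q \<in> P_set d \<and> orbit q = orbit p)"
    have q: "q \<in> P_set d \<and> orbit q = orbit p"
      unfolding q_def by (rule someI[of _ p]) (use p in simp)
    then have "q \<in> orbit p" using orbit_self[of q] by simp
    then obtain g where "g \<in> signs" "q = sact g p" unfolding orbit_def by blast
    then have "R_cls d q = R_cls d p" using R_cls_sact[OF p] by simp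
    then show ?thesis unfolding \<R>_def q_def .
  qed
  have inj: "orbit p = orbit q" if eq: "R_cls d p = R_cls d q" for p q :: "'a \<times> 'a \<times> 'a"
  proof -
    obtain a b c a' b' c' where pq: "p = (a, b, c)" "q = (a', b', c')" by (metis prod_cases3)
    have "R_mod d a b c \<in> iso_class (d + 1) (R_mod d a b c)"
      unfolding iso_class_def using racah_module_R racah_iso_refl by blast
    then have "R_mod d a b c \<in> iso_class (d + 1) (R_mod d a' b' c')"
      using eq unfolding pq R_cls_def prod.case by blast
    then have "racah_iso (d + 1) (R_mod d a' b' c') (R_mod d a b c)"
      unfolding iso_class_def by blast
    then have "q \<in> orbit p" unfolding pq by (rule racah_iso_R_imp_orbit)
    then show ?thesis using orbit_eqI by blast
  qed
  have mem: "R_cls d p \<in> irred_classes (d + 1)" if "p \<in> P_set d" for p :: "'a \<times> 'a \<times> 'a"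
  proof -
    obtain a b c where p: "p = (a, b, c)" by (metis prod_cases3)
    have "racah_irreducible (d + 1) (R_mod d a b c)"
      unfolding R_mod_eq_tuple racah_irreducible_tuple_iff[OF RA_carrier RB_carrier]
      using that P_set_imp_irr_pair p by blast
    then show ?thesis
      unfolding p R_cls_def prod.case irred_classes_def using racah_module_R by blast
  qed
  have "bij_betw \<R> (P_orbits d) (irred_classes (d + 1))"
    unfolding bij_betw_def
  proof
    show "inj_on \<R> (P_orbits d)"
    proof (rule inj_onI)
      fix X Y assume "X \<in> P_orbits d" "Y \<in> P_orbits d" and e: "\<R> X = \<R> Y"
      then obtain p q where "p \<in> P_set d" "q \<in> P_set d" and XY: "X = orbit p" "Y = orbit q"
        unfolding P_orbits_def by blast
      then have "R_cls d p = R_cls d q" using e wd by simp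
      then show "X = Y" unfolding XY by (rule inj)
    qed
    show "\<R> ` P_orbits d = irred_classes (d + 1)"
    proof
      show "\<R> ` P_orbits d \<subseteq> irred_classes (d + 1)"
        unfolding P_orbits_def using wd mem by auto
      show "irred_classes (d + 1) \<subseteq> \<R> ` P_orbits d"
      proof
        fix K :: "'a rtuple set" assume "K \<in> irred_classes (d + 1)"
        then obtain M where K: "K = iso_class (d + 1) M" and M: "racah_module (d + 1) M"
            "racah_irreducible (d + 1) M"
          unfolding irred_classes_def by blast
        obtain a b c where P: "(a, b, c) \<in> P_set d" and e: "iso_class (d + 1) M = iso_class (d + 1)
            (R_mod d a b c)"
          using irreducible_module_is_R[OF M] by blast
        have "K = \<R> (orbit (a, b, c))" unfolding wd[OF P] K e R_cls_def prod.case ..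
        then show "K \<in> \<R> ` P_orbits d" unfolding P_orbits_def using P by blast
      qed
    qed
  qed
  moreover have "\<R> (orbit (a, b, c)) = iso_class (d + 1) (R_mod d a b c)" if "(a, b, c) \<in> P_set d"
      for a b c
    unfolding wd[OF that] R_cls_def prod.case ..
  ultimately show ?thesis by blast
qed

end
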